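(* Let $d\ge3$. There is a constant $c>0$ depending only on $d$ such that the following holds. Let $N,L,r$ be positive integers with $L\ge1$, $r\ge10L$, $N\ge4r+6$, let $x_1,x_2\in E$ satisfy $|x_1-x_2|_\infty\ge2r+3$, and let $u\in E\setminus(\tilde C(x_1)\cup\tilde C(x_2))$ and $w\in\partial\tilde C(x_1)\cup\partial\tilde C(x_2)$. Then $$\|Q_{u,w}-Q\|_{TV}\le c\,\frac{L^2}{r},$$ where for a signed measure $\nu$ on the countable set $\mathcal W$, $\|\nu\|_{TV}=\sum_{\bar w\in\mathcal W}|\nu(\bar w)|$.
   Context: $E=(\mathbb Z/N\mathbb Z)^d$; $|\cdot|$, $|\cdot|_\infty$ are the Euclidean and $\ell^\infty$ distances on $\mathbb Z^d$ or $E$; $B(x,\rho)$ is the closed $|\cdot|_\infty$-ball of radius $\rho$ centered at $x$. For $U$ a subset of $\mathbb Z^d$ or $E$, $\partial U=\{x\in U^c:\exists y\in U,|x-y|=1\}$. For $x\in E$, $C(x)=B(x,L)$, $\tilde C(x)=B(x,r)$ (subsets of $E$); $C=B(0,L)$, $\tilde C=B(0,r)$ (subsets of $\mathbb Z^d$). $C(0)$ and $\tilde C(0)$ in $E$ are identified with $C$ and $\tilde C$ in $\mathbb Z^d$. $P_x$ is the law of simple random walk $(X_n)_{n\ge0}$ on $E$ started at $x$ (each step adds $\pm e_i$ with probability $1/(2d)$), and $P^{\mathbb Z^d}_x$ that of simple random walk on $\mathbb Z^d$ (also written $X$). Set $R_1=\inf\{n\ge0:X_n\in C(x_1)\cup C(x_2)\}$,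 $D_1=\inf\{n\ge R_1:X_n\notin\tilde C(x_1)\cup\tilde C(x_2)\}$, and $L_1=\sup\{n\ge R_1: n<D_1,\ X_n\in C(x_1)\cup C(x_2)\}$. $\mathcal W$ is the countable set of finite nearest neighbor paths $\bar w=(\bar w_k)_{0\le k\le T}$ in $\mathbb Z^d$ (arbitrary finite $T\ge 0$) with $|\bar w_0|_\infty=|\bar w_T|_\infty=L$. For $u\notin\tilde C(x_1)\cup\tilde C(x_2)$ and $w\in\partial\tilde C(x_i)$ ($i=1$ or $2$; the sets $\partial\tilde C(x_1)$, $\partial\tilde C(x_2)$ are disjoint), $Q_{u,w}$ is the law on $\mathcal W$ of $(X_{R_1+k}-x_i)_{0\le k\le L_1-R_1}$ under $P_u[\,\cdot\,|X_{D_1}=w]$ (a path in $\tilde C(0)$, identified with $\tilde C\subset\mathbb Z^d$). Let $e_C(z)=P_z^{\mathbb Z^d}[X_n\notin C\text{ for all }n\ge1]$ for $z\in C$, $e_C(z)=0$ for $z\notin C$, $\mathrm{cap}(C)=\sum_ze_C(z)$, and $\mu_C=e_C/\mathrm{cap}(C)$. Let $L_C=\sup\{n\ge0:X_n\in C\}$. $Q$ is the law on $\mathcal W$ of $(X_k)_{0\le k\le L_C}$ under $P^{\mathbb Z^d}_{\mu_C}$, the law of simple random walk on $\mathbb Z^d$ with initial distribution $\mu_C$. *)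

theory Defs
  imports "HOL-Probability.Probability"
begin

abbreviation dist2 :: "int ^ 'd \<Rightarrow> int ^ 'd \<Rightarrow> real" where
  "dist2 x y \<equiv> norm ((\<chi> i. real_of_int (x $ i - y $ i)) :: real ^ 'd)"

abbreviation distinf :: "int ^ 'd \<Rightarrow> int ^ 'd \<Rightarrow> real" where
  "distinf x y \<equiv> infnorm ((\<chi> i. real_of_int (x $ i - y $ i)) :: real ^ 'd)"

definition cube :: "nat \<Rightarrow> (int ^ 'd) set" where
  "cube \<rho> = {z. distinf z 0 \<le> real \<rho>}"

text \<open>The torus \<open>(\<int>/N\<int>)\<^sup>d\<close> is represented by its canonical representatives in \<open>{0..<N}\<^sup>d\<close>;
  \<open>wrap N\<close> is the canonical projection. Distances on the torus are quotient distances.\<close>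

definition torus :: "nat \<Rightarrow> (int ^ 'd) set" where
  "torus N = {x. \<forall>i. 0 \<le> x $ i \<and> x $ i < int N}"

definition wrap :: "nat \<Rightarrow> int ^ 'd \<Rightarrow> int ^ 'd" where
  "wrap N z = (\<chi> i. z $ i mod int N)"

definition torus_dist2 :: "nat \<Rightarrow> int ^ 'd \<Rightarrow> int ^ 'd \<Rightarrow> real" where
  "torus_dist2 N x y = (INF z\<in>{z. wrap N z = wrap N x}. dist2 z y)"

definition torus_distinf :: "nat \<Rightarrow> int ^ 'd \<Rightarrow> int ^ 'd \<Rightarrow> real" where
  "torus_distinf N x y = (INF z\<in>{z. wrap N z = wrap N x}. distinf z y)"

definition torus_ball :: "nat \<Rightarrow> int ^ 'd \<Rightarrow> nat \<Rightarrow> (int ^ 'd) set" where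
  "torus_ball N x \<rho> = {y \<in> torus N. torus_distinf N y x \<le> real \<rho>}"

definition torus_boundary :: "nat \<Rightarrow> (int ^ 'd) set \<Rightarrow> (int ^ 'd) set" where
  "torus_boundary N U = {x \<in> torus N - U. \<exists>y\<in>U. torus_dist2 N x y = 1}"

text \<open>The identification of a box \<open>torus_ball N 0 \<rho>\<close> with \<open>cube \<rho>\<close>; it is meaningful
  on that box, and for \<open>2 * \<rho> < N\<close> only.\<close>

definition lift :: "nat \<Rightarrow> nat \<Rightarrow> int ^ 'd \<Rightarrow> int ^ 'd" where
  "lift N \<rho> y = (THE z. z \<in> cube \<rho> \<and> wrap N z = y)"

text \<open>Trajectories are the partial sums of independent steps, uniform on the \<open>2 * CARD('d)\<close>
  vectors \<open>\<plusminus>e\<^sub>i\<close>.\<close>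

definition unit_steps :: "(int ^ 'd) set" where
  "unit_steps = {axis i s | i s. s \<in> {1, - 1}}"

definition step_seq :: "(nat \<Rightarrow> int ^ 'd) measure" where
  "step_seq = (\<Pi>\<^sub>M n\<in>UNIV. measure_pmf (pmf_of_set unit_steps))"

definition trajectories :: "(nat \<Rightarrow> int ^ 'd) measure" where
  "trajectories = (\<Pi>\<^sub>M n\<in>UNIV. count_space UNIV)"

definition srw :: "int ^ 'd \<Rightarrow> (nat \<Rightarrow> int ^ 'd) measure" where
  "srw x = distr step_seq trajectories (\<lambda>\<xi> n. x + (\<Sum>k<n. \<xi> k))"

definition torus_srw :: "nat \<Rightarrow> int ^ 'd \<Rightarrow> (nat \<Rightarrow> int ^ 'd) measure" where
  "torus_srw N x = distr step_seq trajectories (\<lambda>\<xi> n. wrap N (x + (\<Sum>k<n. \<xi> k)))"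

text \<open>Times take values in \<open>enat\<close>, so that the infimum of the empty set is \<open>\<infinity>\<close>.
  The argument \<open>A\<close> is the union of the two small boxes, \<open>B\<close> that of the two large ones.\<close>

definition entry_time :: "'a set \<Rightarrow> (nat \<Rightarrow> 'a) \<Rightarrow> enat" where
  "entry_time A X = Inf {enat n | n. X n \<in> A}"

definition departure_time :: "'a set \<Rightarrow> 'a set \<Rightarrow> (nat \<Rightarrow> 'a) \<Rightarrow> enat" where
  "departure_time A B X = Inf {enat n | n. entry_time A X \<le> enat n \<and> X n \<notin> B}"

definition last_visit_before_departure :: "'a set \<Rightarrow> 'a set \<Rightarrow> (nat \<Rightarrow> 'a) \<Rightarrow> enat" where
  "last_visit_before_departure A B X =
     Sup {enat n | n. entry_time A X \<le> enat n \<and> enat n < departure_time A B X \<and> X n \<in> A}"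

definition last_visit :: "'a set \<Rightarrow> (nat \<Rightarrow> 'a) \<Rightarrow> enat" where
  "last_visit A X = Sup {enat n | n. X n \<in> A}"

text \<open>A path \<open>(w\<^sub>k)\<close>, \<open>0 \<le> k \<le> T\<close>, is the list of its \<open>T + 1\<close> values.\<close>

definition excursion_paths :: "nat \<Rightarrow> (int ^ 'd) list set" where
  "excursion_paths L = {ws. ws \<noteq> [] \<and> successively (\<lambda>a b. dist2 a b = 1) ws \<and>
     distinf (hd ws) 0 = real L \<and> distinf (last ws) 0 = real L}"

text \<open>Laws on the countable set of paths are given by their point masses. The centre \<open>x\<close> below
  is the \<open>x\<^sub>i\<close> for which \<open>w\<close> is in the boundary of the box of radius \<open>r\<close> around \<open>x\<^sub>i\<close>;
  it is unique as the two boundaries are disjoint for \<open>torus_distinf N x\<^sub>1 x\<^sub>2 \<ge> 2 * r + 3\<close>.\<close>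

definition Q_cond ::
  "nat \<Rightarrow> nat \<Rightarrow> nat \<Rightarrow> int ^ 'd \<Rightarrow> int ^ 'd \<Rightarrow> int ^ 'd \<Rightarrow> int ^ 'd \<Rightarrow> (int ^ 'd) list \<Rightarrow> real" where
  "Q_cond N L r x\<^sub>1 x\<^sub>2 u w ws =
    (let A = torus_ball N x\<^sub>1 L \<union> torus_ball N x\<^sub>2 L;
         B = torus_ball N x\<^sub>1 r \<union> torus_ball N x\<^sub>2 r;
         x = (if w \<in> torus_boundary N (torus_ball N x\<^sub>1 r) then x\<^sub>1 else x\<^sub>2)
     in \<P>(X in torus_srw N u.
          (\<exists>s t. entry_time A X = enat s \<and> last_visit_before_departure A B X = enat t \<and>
                 map (\<lambda>k. lift N r (wrap N (X k - x))) [s..<Suc t] = ws)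
          \<bar> \<exists>m. departure_time A B X = enat m \<and> X m = w))"

definition escape_prob :: "nat \<Rightarrow> int ^ 'd \<Rightarrow> real" where
  "escape_prob L z = (if z \<in> cube L then \<P>(X in srw z. \<forall>n\<ge>1. X n \<notin> cube L) else 0)"

definition capacity :: "'d::finite itself \<Rightarrow> nat \<Rightarrow> real" where
  "capacity _ L = (\<Sum>z\<in>(cube L :: (int ^ 'd) set). escape_prob L z)"

definition equilibrium :: "nat \<Rightarrow> int ^ 'd \<Rightarrow> real" where
  "equilibrium L z = escape_prob L z / capacity TYPE('d) L"

definition srw_equilibrium :: "nat \<Rightarrow> (nat \<Rightarrow> int ^ 'd) measure" where
  "srw_equilibrium L = point_measure UNIV (\<lambda>z. ennreal (equilibrium L z)) \<bind> srw"

definition Q_limit :: "nat \<Rightarrow> (int ^ 'd) list \<Rightarrow> real" where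
  "Q_limit L ws = \<P>(X in srw_equilibrium L.
     \<exists>t. last_visit (cube L) X = enat t \<and> map X [0..<Suc t] = ws)"

text \<open>The sum is taken in \<^typ>\<open>ennreal\<close>, where it always converges.\<close>

definition tv_norm :: "'a set \<Rightarrow> ('a \<Rightarrow> real) \<Rightarrow> ennreal" where
  "tv_norm W \<nu> = (\<Sum>\<^sub>\<infinity>w\<in>W. ennreal \<bar>\<nu> w\<bar>)"

end

theory Submission
  imports Defs
begin

text \<open>
  The probability of an excursion \<open>(a, \<dots>, b)\<close> under the conditioned law is, up to normalisation, the
  product of the probability of entering the small box at \<open>a\<close>, of the weight \<open>(2 d) powr (- T)\<close> of the
  path, and of the probability of leaving the large box at \<open>w\<close> from \<open>b\<close> without returning to the
  small one. Under the limit law the outer factors are \<open>e\<^sub>C(a) / cap(C)\<close> and \<open>e\<^sub>C(b)\<close>. Both outer factors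
  of the conditioned law have the form \<open>P k\<close> with \<open>P\<close> the one-step mean and \<open>k\<close> a nonnegative function
  that vanishes on the small cube and is harmonic between the cubes. If \<open>M\<close> is the harmonic function
  on the large cube with the exterior values of \<open>k\<close>, then \<open>P k(b) = M(b) - E\<^sub>b[M(X\<^sub>H); H < T]\<close>, where \<open>H\<close>
  is the return time to the small cube and \<open>T\<close> the exit time of the large one. A gradient estimate for positive
  harmonic functions makes \<open>M\<close> constant on the small cube up to a factor \<open>1 + O(L/r)\<close>, and the cube is
  hit from distance \<open>r\<close> with probability \<open>O(L/r)\<close>, so that \<open>P k(b) = M(0) (e\<^sub>C(b) + O(L/r))\<close>. As \<open>e\<^sub>C(b)\<close>
  is at least of order \<open>1/L\<close> on the boundary of the cube, the relative error is \<open>O(L\<^sup>2/r)\<close>.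

  The gradient estimate is a lattice version of the Cheng--Yau argument, applied to \<open>\<surd>u\<close> instead of \<open>ln u\<close>;
  the bound on hitting probabilities comes from an explicit superharmonic function.
\<close>

section \<open>Nearest neighbour steps and cubes\<close>

text \<open>The torus, the start \<open>u\<close> and the second box enter only through two unknown
  scalars, the values at the centre of the comparison functions \<open>M\<close> for the entrance
  and for the exit. Both scalars cancel in the conditional probability, so they only have to be
  positive, and the bound is uniform in everything but \<open>L\<close> and \<open>r\<close>.
  Positivity is a matter of connectedness; its delicate case is reaching the box around
  \<open>x\<close> without entering the other small box.

  One-sided estimates control the total variation because the conditioned law has mass one and the
  limit law mass at most one. Hence the numerator is bounded above, the conditioning probability and
  the limit law below.

  The square root has an algebraic reason: harmonicity says that the ratios
  \<open>u (x + e) / u x\<close>, the squares of the root ratios, have a constant sum over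
  \<open>e\<close>. The cross terms in the generator of the defect then complete to squares exactly,
  with no remainder to estimate.

  If L^2/r is not small, the claim holds because the norm is at most two; this frees the main
  argument to assume that \<open>r\<close> is large compared with L^2.\<close>

definition step_mean :: "(int ^ 'd \<Rightarrow> real) \<Rightarrow> int ^ 'd \<Rightarrow> real" where
  "step_mean f x = (\<Sum>e\<in>unit_steps. f (x + e)) / real (card (unit_steps :: (int ^ 'd) set))"

definition normsq :: "int ^ 'd \<Rightarrow> real" where
  "normsq x = (\<Sum>i\<in>UNIV. (real_of_int (x $ i))\<^sup>2)"

lemma sum_unit_steps:
  fixes f :: "int ^ 'd \<Rightarrow> 'b::comm_monoid_add"
  shows "(\<Sum>e\<in>unit_steps. f e) = (\<Sum>i\<in>UNIV. f (axis i 1) + f (axis i (-1)))"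
proof -
  have eq: "unit_steps = (\<Union>i\<in>(UNIV::'d set). {axis i 1, axis i (-1) :: int ^ 'd})"
    by (auto simp: unit_steps_def)
  have "(\<Sum>e\<in>unit_steps. f e) = (\<Sum>i\<in>(UNIV::'d set). \<Sum>e\<in>{axis i 1, axis i (-1)}. f e)"
    unfolding eq by (intro sum.UNION_disjoint) (auto simp: axis_eq_axis)
  also have "\<dots> = (\<Sum>i\<in>UNIV. f (axis i 1) + f (axis i (-1)))"
    by (intro sum.cong refl sum.insert[THEN trans]) (auto simp: axis_eq_axis)
  finally show ?thesis .
qed

lemma finite_unit_steps [simp]: "finite (unit_steps :: (int ^ 'd) set)"
proof -
  have "unit_steps = (\<Union>i\<in>(UNIV::'d set). {axis i 1, axis i (-1) :: int ^ 'd})"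
    by (auto simp: unit_steps_def)
  moreover have "finite (\<Union>i\<in>(UNIV::'d set). {axis i 1, axis i (-1) :: int ^ 'd})"
    by (intro finite_UN_I) auto
  ultimately show ?thesis by metis
qed

lemma card_unit_steps: "card (unit_steps :: (int ^ 'd) set) = 2 * CARD('d)"
  using sum_unit_steps[of "\<lambda>_::int^'d. 1::nat"] by simp

lemma card_unit_steps_pos: "1 \<le> real (card (unit_steps :: (int ^ 'd) set))"
proof -
  have "0 < CARD('d)" by simp
  then have "1 \<le> card (unit_steps :: (int ^ 'd) set)"
    unfolding card_unit_steps by linarith
  then show ?thesis by simp
qed

lemma unit_steps_nonempty [simp]: "unit_steps \<noteq> ({} :: (int ^ 'd) set)"
  by (auto simp: unit_steps_def)

lemma axis_in_unit_steps [simp]: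
  "axis i 1 \<in> unit_steps" "axis i (-1) \<in> unit_steps"
  by (auto simp: unit_steps_def)

lemma axis_uminus: "- axis i s = axis i (- s :: int)"
  by (auto simp: axis_def vec_eq_iff)

lemma uminus_in_unit_steps [simp]: "- e \<in> unit_steps \<longleftrightarrow> e \<in> unit_steps"
proof -
  have "- e \<in> unit_steps" if "e \<in> unit_steps" for e :: "int ^ 'd"
    using that unfolding unit_steps_def by (force simp: axis_uminus)
  from this[of e] this[of "- e"] show ?thesis by auto
qed

lemma sum_unit_steps_uminus:
  "(\<Sum>e\<in>unit_steps. f (- e)) = (\<Sum>e\<in>unit_steps. f (e :: int ^ 'd))"
  by (rule sum.reindex_bij_witness[of _ uminus uminus]) auto

lemma step_mean_mono:
  assumes "\<And>e. e \<in> unit_steps \<Longrightarrow> f (x + e) \<le> g (x + e)"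
  shows "step_mean f x \<le> step_mean g x"
  unfolding step_mean_def by (intro divide_right_mono sum_mono assms) auto

lemma step_mean_cong:
  assumes "\<And>e. e \<in> unit_steps \<Longrightarrow> f (x + e) = g (x + e)"
  shows "step_mean f x = step_mean g x"
  unfolding step_mean_def by (simp add: assms)

lemma step_mean_const [simp]: "step_mean (\<lambda>_. c) x = c"
  using card_unit_steps_pos[where 'd='a] unfolding step_mean_def by simp

lemma step_mean_add: "step_mean (\<lambda>y. f y + g y) x = step_mean f x + step_mean g x"
  unfolding step_mean_def by (simp add: sum.distrib add_divide_distrib)

lemma step_mean_diff: "step_mean (\<lambda>y. f y - g y) x = step_mean f x - step_mean g x"
  unfolding step_mean_def by (simp add: sum_subtractf diff_divide_distrib)

lemma step_mean_mult: "step_mean (\<lambda>y. c * f y) x = c * step_mean f x"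
  unfolding step_mean_def by (simp add: sum_distrib_left)

lemma step_mean_nonneg:
  assumes "\<And>e. e \<in> unit_steps \<Longrightarrow> 0 \<le> f (x + e)"
  shows "0 \<le> step_mean f x"
  unfolding step_mean_def by (intro divide_nonneg_nonneg sum_nonneg assms) auto

lemma le_step_mean:
  assumes "\<And>e. e \<in> unit_steps \<Longrightarrow> 0 \<le> f (x + e)" "e \<in> unit_steps"
  shows "f (x + e) / real (card (unit_steps :: (int ^ 'd) set)) \<le> step_mean f (x :: int ^ 'd)"
  unfolding step_mean_def using assms by (intro divide_right_mono member_le_sum) auto

lemma step_mean_translate: "step_mean (\<lambda>z. f (x + z)) y = step_mean f (x + y)"
  by (simp add: step_mean_def add.assoc)

section \<open>Cubes and the squared Euclidean norm\<close>

lemma mem_cube: "z \<in> cube \<rho> \<longleftrightarrow> (\<forall>i. \<bar>z $ i\<bar> \<le> int \<rho>)"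
proof -
  let ?v = "(\<chi> i. real_of_int (z $ i)) :: real ^ 'a"
  have "infnorm ?v \<le> real \<rho> \<longleftrightarrow> (\<forall>i. \<bar>?v $ i\<bar> \<le> real \<rho>)"
  proof
    assume "infnorm ?v \<le> real \<rho>"
    then show "\<forall>i. \<bar>?v $ i\<bar> \<le> real \<rho>"
      using component_le_infnorm_cart[of ?v] order_trans by blast
  next
    assume "\<forall>i. \<bar>?v $ i\<bar> \<le> real \<rho>"
    then show "infnorm ?v \<le> real \<rho>"
      unfolding infnorm_cart by (intro cSup_least) auto
  qed
  then show ?thesis
    by (simp add: cube_def) (metis of_int_abs of_int_le_iff of_int_of_nat_eq)
qed

lemma distinf_le_iff: "distinf x y \<le> real \<rho> \<longleftrightarrow> x - y \<in> cube \<rho>"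
  by (simp add: cube_def)

lemma finite_cube [simp]: "finite (cube \<rho> :: (int ^ 'd) set)"
proof (rule finite_subset)
  show "cube \<rho> \<subseteq> vec_lambda ` (PiE (UNIV::'d set) (\<lambda>_. {- int \<rho>..int \<rho>}))"
  proof
    fix z :: "int ^ 'd" assume "z \<in> cube \<rho>"
    then have "vec_nth z \<in> PiE (UNIV::'d set) (\<lambda>_. {- int \<rho>..int \<rho>})"
      by (auto simp: mem_cube abs_le_iff minus_le_iff)
    then show "z \<in> vec_lambda ` (PiE (UNIV::'d set) (\<lambda>_. {- int \<rho>..int \<rho>}))"
      by (metis image_eqI vec_nth_inverse)
  qed
  show "finite (vec_lambda ` (PiE (UNIV::'d set) (\<lambda>_. {- int \<rho>..int \<rho>})))"
    by (intro finite_imageI finite_PiE) auto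
qed

lemma zero_in_cube [simp]: "0 \<in> cube \<rho>"
  by (simp add: mem_cube)

lemma cube_mono: "\<rho> \<le> \<rho>' \<Longrightarrow> z \<in> cube \<rho> \<Longrightarrow> z \<in> cube \<rho>'"
  unfolding mem_cube by (meson dual_order.trans of_nat_mono)

lemma cube_add:
  assumes "y \<in> cube \<rho>" "z \<in> cube \<sigma>" shows "y + z \<in> cube (\<rho> + \<sigma>)"
  unfolding mem_cube
proof
  fix i
  have "\<bar>y $ i\<bar> \<le> int \<rho>" "\<bar>z $ i\<bar> \<le> int \<sigma>" using assms by (auto simp: mem_cube)
  then show "\<bar>(y + z) $ i\<bar> \<le> int (\<rho> + \<sigma>)" by simp
qed

lemma cube_uminus [simp]: "- z \<in> cube \<rho> \<longleftrightarrow> z \<in> cube \<rho>"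
  by (simp add: mem_cube)

lemma unit_step_in_cube: "e \<in> unit_steps \<Longrightarrow> e \<in> cube 1"
  by (auto simp: unit_steps_def mem_cube axis_def)

lemma cube_step: "z \<in> cube \<rho> \<Longrightarrow> e \<in> unit_steps \<Longrightarrow> z + e \<in> cube (Suc \<rho>)"
  using cube_add[of z \<rho> e 1] unit_step_in_cube[of e] by simp

lemma normsq_nonneg [simp]: "0 \<le> normsq x"
  by (simp add: normsq_def sum_nonneg)

lemma coord_le_normsq: "(real_of_int (x $ i))\<^sup>2 \<le> normsq x"
  unfolding normsq_def by (rule member_le_sum) auto

lemma normsq_le_cube:
  assumes "x \<in> cube \<rho>" shows "normsq (x :: int ^ 'd) \<le> real CARD('d) * (real \<rho>)\<^sup>2"
proof -
  have "(real_of_int (x $ i))\<^sup>2 \<le> (real \<rho>)\<^sup>2" for i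
  proof -
    have "\<bar>real_of_int (x $ i)\<bar> \<le> real \<rho>"
      using assms by (metis mem_cube of_int_abs of_int_le_iff of_int_of_nat_eq)
    then show ?thesis by (metis abs_of_nat abs_le_square_iff)
  qed
  then have "normsq x \<le> of_nat CARD('d) * (real \<rho>)\<^sup>2"
    unfolding normsq_def by (intro sum_bounded_above) auto
  then show ?thesis by simp
qed

lemma in_cube_of_normsq:
  assumes "normsq x \<le> (real \<rho>)\<^sup>2" shows "x \<in> cube \<rho>"
  unfolding mem_cube
proof
  fix i
  have "(real_of_int (x $ i))\<^sup>2 \<le> (real \<rho>)\<^sup>2"
    using coord_le_normsq[of x i] assms by linarith
  then have "\<bar>real_of_int (x $ i)\<bar> \<le> \<bar>real \<rho>\<bar>" by (simp only: abs_le_square_iff)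
  then show "\<bar>x $ i\<bar> \<le> int \<rho>" by linarith
qed

lemma normsq_add_axis:
  "normsq (x + axis i s) = normsq x + 2 * real_of_int s * real_of_int (x $ i) + (real_of_int s)\<^sup>2"
proof -
  have "(real_of_int ((x + axis i s) $ j))\<^sup>2 = (real_of_int (x $ j))\<^sup>2
      + (if j = i then 2 * real_of_int s * real_of_int (x $ j) + (real_of_int s)\<^sup>2 else 0)" for j
    by (cases "j = i") (simp_all add: axis_def power2_sum)
  then have "normsq (x + axis i s) = (\<Sum>j\<in>UNIV. (real_of_int (x $ j))\<^sup>2
      + (if j = i then 2 * real_of_int s * real_of_int (x $ j) + (real_of_int s)\<^sup>2 else 0))"
    unfolding normsq_def by (intro sum.cong refl)
  then show ?thesis by (simp only: sum.distrib sum.delta finite normsq_def) simp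
qed

section \<open>A gradient estimate for positive harmonic functions\<close>

definition root_ratio :: "(int ^ 'd \<Rightarrow> real) \<Rightarrow> int ^ 'd \<Rightarrow> int ^ 'd \<Rightarrow> real" where
  "root_ratio u e x = sqrt (u (x + e) / u x)"

text \<open>For harmonic \<open>u\<close> this is \<open>- \<Delta>\<surd>u / \<surd>u\<close>, hence half the sum of the squares \<open>(1 - root_ratio u e x)\<^sup>2\<close>.\<close>

definition defect :: "(int ^ 'd \<Rightarrow> real) \<Rightarrow> int ^ 'd \<Rightarrow> real" where
  "defect u x = (\<Sum>e\<in>unit_steps. 1 - root_ratio u e x)"

abbreviation valency :: "'d::finite itself \<Rightarrow> real" where
  "valency (_ :: 'd itself) \<equiv> real (card (unit_steps :: (int ^ 'd) set))"

context
  fixes u :: "int ^ 'd \<Rightarrow> real"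
  assumes pos: "\<And>x. 0 < u x"
begin

lemma root_ratio_pos: "0 < root_ratio u e x"
  using pos by (simp add: root_ratio_def)

lemma root_ratio_sq: "(root_ratio u e x)\<^sup>2 = u (x + e) / u x"
  using pos[of x] pos[of "x + e"] by (simp add: root_ratio_def)

lemma root_ratio_inverse: "root_ratio u (- e) (x + e) = 1 / root_ratio u e x"
  by (simp add: root_ratio_def real_sqrt_divide)

text \<open>Both sides are the square root of \<open>u (x + e + e') / u x\<close>: the two orders of
  crossing a lattice square. This takes the place of commuting derivatives in the Bochner
  formula.\<close>

lemma root_ratio_commute:
  "root_ratio u e x * root_ratio u e' (x + e) = root_ratio u e' x * root_ratio u e (x + e')"
  using pos[of "x + e"] pos[of "x + e'"]
  by (simp add: root_ratio_def add_ac flip: real_sqrt_mult)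

text \<open>The form in which harmonicity enters all estimates of this part: the jump rates
  \<open>u (x + e) / u x\<close> of the walk transformed by \<open>u\<close> have the same total as
  those of the simple walk.\<close>

lemma sum_root_ratio_sq:
  assumes "step_mean u x = u x"
  shows "(\<Sum>e\<in>unit_steps. (root_ratio u e x)\<^sup>2) = valency TYPE('d)"
proof -
  have "(\<Sum>e\<in>unit_steps. u (x + e)) = valency TYPE('d) * u x"
    using assms card_unit_steps_pos[where 'd='d] by (simp add: step_mean_def field_simps)
  then show ?thesis
    using pos[of x] unfolding root_ratio_sq by (simp flip: sum_divide_distrib)
qed

lemma sum_root_ratio_deviation:
  assumes "step_mean u x = u x"
  shows "(\<Sum>e\<in>unit_steps. (1 - root_ratio u e x)\<^sup>2) = 2 * defect u x"
proof -
  have "(\<Sum>e\<in>unit_steps. (1 - root_ratio u e x)\<^sup>2)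
      = (\<Sum>e\<in>unit_steps. 2 * (1 - root_ratio u e x) - (1 - (root_ratio u e x)\<^sup>2))"
    by (intro sum.cong refl) (simp add: power2_eq_square algebra_simps)
  also have "\<dots> = 2 * defect u x - (valency TYPE('d) - valency TYPE('d))"
    using sum_root_ratio_sq[OF assms]
    by (simp only: sum_subtractf defect_def sum_distrib_left[symmetric]) simp
  finally show ?thesis by simp
qed

lemma defect_nonneg:
  assumes "step_mean u x = u x" shows "0 \<le> defect u x"
proof -
  have "0 \<le> (\<Sum>e\<in>unit_steps. (1 - root_ratio u e x)\<^sup>2)" by (intro sum_nonneg) auto
  then show ?thesis unfolding sum_root_ratio_deviation[OF assms] by simp
qed

lemma defect_le: "defect u x \<le> valency TYPE('d)"
proof -
  have "defect u x \<le> (\<Sum>e\<in>(unit_steps :: (int^'d) set). 1)"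
    unfolding defect_def by (intro sum_mono) (simp add: less_imp_le[OF root_ratio_pos])
  then show ?thesis by simp
qed

lemma root_ratio_le:
  assumes "step_mean u x = u x" "e \<in> unit_steps"
  shows "root_ratio u e x \<le> valency TYPE('d)"
proof -
  have "(root_ratio u e x)\<^sup>2 \<le> (\<Sum>e\<in>unit_steps. (root_ratio u e x)\<^sup>2)"
    using assms(2) by (intro member_le_sum) auto
  also have "\<dots> = valency TYPE('d)" by (rule sum_root_ratio_sq[OF assms(1)])
  also have "\<dots> \<le> (valency TYPE('d))\<^sup>2"
    using card_unit_steps_pos[where 'd='d] by (simp add: power2_eq_square)
  finally show ?thesis by (rule power2_le_imp_le) simp
qed

text \<open>A discrete Bochner identity. On the left is the generator of the walk transformed by
  \<open>u\<close>. Commuting the two steps pulls out one factor \<open>root_ratio u e x\<close>;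
  since the squares of the ratios sum to the valency both at \<open>x\<close> and at
  \<open>x + e\<close>, the rest completes to squares.\<close>

lemma defect_generator_eq:
  assumes hx: "step_mean u x = u x"
    and hn: "\<And>e. e \<in> unit_steps \<Longrightarrow> step_mean u (x + e) = u (x + e)"
  shows "(\<Sum>e\<in>unit_steps. (root_ratio u e x)\<^sup>2 * (defect u (x + e) - defect u x))
    = (\<Sum>e\<in>unit_steps. root_ratio u e x *
         ((\<Sum>e'\<in>unit_steps. (root_ratio u e' x - root_ratio u e' (x + e))\<^sup>2) / 2))"
proof -
  let ?D = "valency TYPE('d)"
  let ?s = "\<lambda>e. root_ratio u e x"
  let ?t = "\<lambda>e' e. root_ratio u e' (x + e)"
  have def1: "defect u y = ?D - (\<Sum>e\<in>unit_steps. root_ratio u e y)" for y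
    by (simp add: defect_def sum_subtractf)
  have "(\<Sum>e\<in>unit_steps. (?s e)\<^sup>2 * (defect u (x + e) - defect u x))
      = (\<Sum>e\<in>unit_steps. (?s e)\<^sup>2 * ((\<Sum>e'\<in>unit_steps. ?s e') - (\<Sum>e'\<in>unit_steps. ?t e' e)))"
    by (simp add: def1)
  also have "\<dots> = (\<Sum>e\<in>unit_steps. (?s e)\<^sup>2) * (\<Sum>e'\<in>unit_steps. ?s e')
      - (\<Sum>e\<in>unit_steps. \<Sum>e'\<in>unit_steps. (?s e)\<^sup>2 * ?t e' e)"
    by (simp only: right_diff_distrib sum_subtractf sum_distrib_right[symmetric]
      sum_distrib_left[symmetric])
  also have "(\<Sum>e\<in>unit_steps. \<Sum>e'\<in>unit_steps. (?s e)\<^sup>2 * ?t e' e)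
      = (\<Sum>e\<in>unit_steps. \<Sum>e'\<in>unit_steps. ?s e * (?s e' * ?t e e'))"
    using root_ratio_commute by (intro sum.cong refl) (simp add: power2_eq_square mult.assoc)
  also have "\<dots> = (\<Sum>e\<in>unit_steps. \<Sum>e'\<in>unit_steps. ?s e' * (?s e * ?t e' e))"
    by (rule sum.swap)
  also have "\<dots> = (\<Sum>e\<in>unit_steps. ?s e * (\<Sum>e'\<in>unit_steps. ?s e' * ?t e' e))"
    by (simp add: sum_distrib_left algebra_simps)
  also have "(\<Sum>e\<in>unit_steps. (?s e)\<^sup>2) = ?D" by (rule sum_root_ratio_sq[OF hx])
  finally have 1: "(\<Sum>e\<in>unit_steps. (?s e)\<^sup>2 * (defect u (x + e) - defect u x))
      = (\<Sum>e\<in>unit_steps. ?s e * (?D - (\<Sum>e'\<in>unit_steps. ?s e' * ?t e' e)))"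
    by (simp add: right_diff_distrib sum_subtractf sum_distrib_left sum_distrib_right mult.commute)
  have 2: "(\<Sum>e'\<in>unit_steps. (?s e' - ?t e' e)\<^sup>2) / 2 = ?D - (\<Sum>e'\<in>unit_steps. ?s e' * ?t e' e)"
    if "e \<in> unit_steps" for e
  proof -
    have "(\<Sum>e'\<in>unit_steps. (?s e' - ?t e' e)\<^sup>2)
        = (\<Sum>e'\<in>unit_steps. (?s e')\<^sup>2 + (?t e' e)\<^sup>2 - 2 * (?s e' * ?t e' e))"
      by (intro sum.cong refl) (simp add: power2_eq_square algebra_simps)
    also have "\<dots> = ?D + ?D - 2 * (\<Sum>e'\<in>unit_steps. ?s e' * ?t e' e)"
      using sum_root_ratio_sq[OF hx] sum_root_ratio_sq[OF hn[OF that]]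
      by (simp add: sum_subtractf sum.distrib sum_distrib_left)
    finally show ?thesis by simp
  qed
  show ?thesis unfolding 1 by (intro sum.cong refl) (simp only: 2)
qed

text \<open>This is the term \<open>e' = - e\<close> of the identity above; pairing opposite directions makes it
  control the defect.\<close>

lemma defect_le_curvature:
  "(defect u x)\<^sup>2 \<le> valency TYPE('d) * (\<Sum>e\<in>unit_steps. (1 - root_ratio u e x * root_ratio u (- e) x)\<^sup>2)"
  if h: "step_mean u x = u x"
proof -
  let ?s = "\<lambda>e. root_ratio u e x"
  have "2 * defect u x = (\<Sum>e\<in>unit_steps. 1 - ?s e) + (\<Sum>e\<in>unit_steps. 1 - ?s (- e))"
    unfolding defect_def by (subst sum_unit_steps_uminus) simp
  also have "\<dots> = (\<Sum>e\<in>unit_steps. 2 - (?s e + ?s (- e)))"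
    unfolding sum.distrib[symmetric] by (intro sum.cong refl) simp
  also have "\<dots> \<le> (\<Sum>e\<in>unit_steps. 2 * \<bar>1 - ?s e * ?s (- e)\<bar>)"
  proof (rule sum_mono)
    fix e :: "int ^ 'd"
    define p where "p = ?s e * ?s (- e)"
    have p: "0 \<le> p" unfolding p_def using root_ratio_pos by (simp add: less_imp_le)
    have "sqrt p \<le> (?s e + ?s (- e)) / 2"
      unfolding p_def using root_ratio_pos by (intro arith_geo_mean_sqrt) (auto simp: less_imp_le)
    moreover have "1 - sqrt p \<le> \<bar>1 - p\<bar>"
    proof (cases "p \<le> 1")
      case True
      then have "p * p \<le> p" using p mult_left_le by blast
      then have "p \<le> sqrt p" using p by (intro real_le_rsqrt) (simp add: power2_eq_square)
      then show ?thesis by simp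
    next
      case False
      then have "1 \<le> sqrt p" by simp
      then have "1 - sqrt p \<le> 0" by simp
      then show ?thesis using abs_ge_zero order_trans by blast
    qed
    ultimately have "2 - (?s e + ?s (- e)) \<le> 2 * \<bar>1 - p\<bar>" by argo
    then show "2 - (?s e + ?s (- e)) \<le> 2 * \<bar>1 - ?s e * ?s (- e)\<bar>"
      by (simp only: p_def)
  qed
  finally have "defect u x \<le> (\<Sum>e\<in>unit_steps. \<bar>1 - ?s e * ?s (- e)\<bar>)"
    by (simp add: sum_distrib_left[symmetric])
  then have "(defect u x)\<^sup>2 \<le> (\<Sum>e\<in>unit_steps. 1 * \<bar>1 - ?s e * ?s (- e)\<bar>)\<^sup>2"
    using defect_nonneg[OF h] by (intro power_mono) auto
  also have "\<dots> \<le> (\<Sum>e\<in>(unit_steps :: (int ^ 'd) set). 1\<^sup>2) * (\<Sum>e\<in>unit_steps. \<bar>1 - ?s e * ?s (- e)\<bar>\<^sup>2)"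
    by (rule Cauchy_Schwarz_ineq_sum)
  finally show ?thesis by simp
qed

text \<open>All terms of the identity are nonnegative, and for each \<open>e\<close> only
  \<open>e' = - e\<close> is kept. The ratio for the step back is the reciprocal of the one for
  \<open>e\<close>, so this term involves values around \<open>x\<close> alone.\<close>

lemma defect_generator_ge:
  assumes hx: "step_mean u x = u x"
    and hn: "\<And>e. e \<in> unit_steps \<Longrightarrow> step_mean u (x + e) = u (x + e)"
  shows "(defect u x)\<^sup>2 / (2 * (valency TYPE('d))\<^sup>2)
    \<le> (\<Sum>e\<in>unit_steps. (root_ratio u e x)\<^sup>2 * (defect u (x + e) - defect u x))"
proof -
  let ?D = "valency TYPE('d)"
  let ?s = "\<lambda>e. root_ratio u e x"
  have D: "1 \<le> ?D" by (rule card_unit_steps_pos)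
  have "(defect u x)\<^sup>2 / (2 * ?D\<^sup>2) \<le> (?D * (\<Sum>e\<in>unit_steps. (1 - ?s e * ?s (- e))\<^sup>2)) / (2 * ?D\<^sup>2)"
    using defect_le_curvature[OF hx] by (intro divide_right_mono) auto
  also have "\<dots> = (\<Sum>e\<in>unit_steps. (1 - ?s e * ?s (- e))\<^sup>2 / (2 * ?D))"
    using D by (simp add: power2_eq_square sum_divide_distrib)
  also have "\<dots> \<le> (\<Sum>e\<in>unit_steps. ?s e *
         ((\<Sum>e'\<in>unit_steps. (?s e' - root_ratio u e' (x + e))\<^sup>2) / 2))"
  proof (rule sum_mono)
    fix e :: "int ^ 'd" assume e: "e \<in> unit_steps"
    have s: "0 < ?s e" by (rule root_ratio_pos)
    have "(1 - ?s e * ?s (- e))\<^sup>2 / (2 * ?D) \<le> (1 - ?s e * ?s (- e))\<^sup>2 / (2 * ?s e)"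
      using root_ratio_le[OF hx e] s D by (intro divide_left_mono) auto
    also have "\<dots> = ?s e * ((?s (- e) - root_ratio u (- e) (x + e))\<^sup>2 / 2)"
    proof -
      have "1 - ?s e * ?s (- e) = - ?s e * (?s (- e) - 1 / ?s e)"
        using s by (simp add: right_diff_distrib)
      then have "(1 - ?s e * ?s (- e))\<^sup>2 = (?s e)\<^sup>2 * (?s (- e) - 1 / ?s e)\<^sup>2"
        by (simp add: power_mult_distrib)
      then show ?thesis unfolding root_ratio_inverse using s by (simp add: power2_eq_square)
    qed
    also have "\<dots> \<le> ?s e * ((\<Sum>e'\<in>unit_steps. (?s e' - root_ratio u e' (x + e))\<^sup>2) / 2)"
      using s e
      by (intro mult_left_mono divide_right_mono
            member_le_sum[where f="\<lambda>e'. (?s e' - root_ratio u e' (x + e))\<^sup>2"]) auto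
    finally show "(1 - ?s e * ?s (- e))\<^sup>2 / (2 * ?D)
      \<le> ?s e * ((\<Sum>e'\<in>unit_steps. (?s e' - root_ratio u e' (x + e))\<^sup>2) / 2)" .
  qed
  finally show ?thesis by (simp only: defect_generator_eq[OF hx hn])
qed

text \<open>Measures how far the transformed walk is from the simple one. The factor
  \<open>(root_ratio u e x)\<^sup>2 - 1\<close> contains \<open>1 - root_ratio u e x\<close>, whose
  squares sum to twice the defect; Cauchy-Schwarz then gives the square root of the defect.\<close>

lemma sum_abs_root_ratio_sq_deviation:
  assumes "step_mean u x = u x"
  shows "(\<Sum>e\<in>unit_steps. \<bar>(root_ratio u e x)\<^sup>2 - 1\<bar>)
    \<le> (valency TYPE('d) + 1) * (2 * valency TYPE('d) * sqrt (defect u x))"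
proof -
  let ?D = "valency TYPE('d)"
  let ?s = "\<lambda>e. root_ratio u e x"
  have D: "1 \<le> ?D" by (rule card_unit_steps_pos)
  have "(\<Sum>e\<in>unit_steps. \<bar>(?s e)\<^sup>2 - 1\<bar>) \<le> (\<Sum>e\<in>unit_steps. (?D + 1) * \<bar>1 - ?s e\<bar>)"
  proof (rule sum_mono)
    fix e :: "int ^ 'd" assume e: "e \<in> unit_steps"
    have "(?s e)\<^sup>2 - 1 = (?s e + 1) * (?s e - 1)"
      by (simp add: power2_eq_square algebra_simps)
    then have "\<bar>(?s e)\<^sup>2 - 1\<bar> = (?s e + 1) * \<bar>1 - ?s e\<bar>"
      using root_ratio_pos[of e x] by (simp add: abs_mult abs_minus_commute)
    also have "\<dots> \<le> (?D + 1) * \<bar>1 - ?s e\<bar>"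
      using root_ratio_le[OF assms e] by (intro mult_right_mono) auto
    finally show "\<bar>(?s e)\<^sup>2 - 1\<bar> \<le> (?D + 1) * \<bar>1 - ?s e\<bar>" .
  qed
  also have "\<dots> = (?D + 1) * (\<Sum>e\<in>unit_steps. \<bar>1 - ?s e\<bar>)" by (simp add: sum_distrib_left)
  also have "(\<Sum>e\<in>unit_steps. \<bar>1 - ?s e\<bar>) \<le> 2 * ?D * sqrt (defect u x)"
  proof -
    have "(\<Sum>e\<in>unit_steps. 1 * \<bar>1 - ?s e\<bar>)\<^sup>2
        \<le> (\<Sum>e\<in>(unit_steps :: (int ^ 'd) set). 1\<^sup>2) * (\<Sum>e\<in>unit_steps. \<bar>1 - ?s e\<bar>\<^sup>2)"
      by (rule Cauchy_Schwarz_ineq_sum)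
    also have "\<dots> = ?D * (2 * defect u x)" using sum_root_ratio_deviation[OF assms] by simp
    also have "\<dots> \<le> (2 * ?D)\<^sup>2 * defect u x"
    proof -
      have "?D * 2 \<le> (2 * ?D)\<^sup>2" using D by (simp add: power2_eq_square)
      from mult_right_mono[OF this defect_nonneg[OF assms]] show ?thesis by (simp add: mult.assoc)
    qed
    also have "\<dots> = (2 * ?D * sqrt (defect u x))\<^sup>2"
      using defect_nonneg[OF assms] by (simp add: power_mult_distrib)
    finally have sq: "(\<Sum>e\<in>unit_steps. 1 * \<bar>1 - ?s e\<bar>)\<^sup>2 \<le> (2 * ?D * sqrt (defect u x))\<^sup>2" .
    have "0 \<le> 2 * ?D * sqrt (defect u x)" using defect_nonneg[OF assms] by simp
    from power2_le_imp_le[OF sq this] show ?thesis by simp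
  qed
  finally show ?thesis using D by simp
qed

end

text \<open>The linear coefficient has to be exact, because the linear terms nearly cancel when
  summed over the steps; the quadratic coefficient may be wasteful.\<close>

lemma inverse_square_taylor:
  fixes T t :: real
  assumes "0 < T" "\<bar>t\<bar> \<le> T / 2"
  shows "1 / (T - t)\<^sup>2 \<le> 1 / T\<^sup>2 + 2 * t / T ^ 3 + 8 * t\<^sup>2 / T ^ 4"
proof -
  define \<tau> where "\<tau> = t / T"
  have \<tau>: "\<bar>\<tau>\<bar> \<le> 1/2" unfolding \<tau>_def using assms by (simp add: abs_divide field_simps)
  have t: "t = \<tau> * T" unfolding \<tau>_def using assms by simp
  \<comment> \<open>This is \<open>(1 + 2 * \<tau> + 8 * \<tau>\<^sup>2) * (1 - \<tau>)\<^sup>2 -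
    1\<close>. With \<open>v = 1 - \<tau>\<close>, at least one half, the second factor is
    \<open>(2 * v - 1) * (4 * v + 1)\<close>.\<close>
  have "0 \<le> \<tau>\<^sup>2 * (8 * (1 - \<tau>)\<^sup>2 - 3 + 2 * \<tau>)"
  proof (intro mult_nonneg_nonneg)
    have "(1/2)\<^sup>2 \<le> (1 - \<tau>)\<^sup>2" using \<tau> by (intro power_mono) (auto simp: abs_le_iff)
    moreover have "8 * (1 - \<tau>)\<^sup>2 - 3 + 2 * \<tau> = 8 * (1 - \<tau>)\<^sup>2 - 2 * (1 - \<tau>) - 1" by simp
    moreover have "0 \<le> (2 * (1 - \<tau>) - 1) * (4 * (1 - \<tau>) + 1)"
      using \<tau> by (intro mult_nonneg_nonneg) (auto simp: abs_le_iff)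
    ultimately show "0 \<le> 8 * (1 - \<tau>)\<^sup>2 - 3 + 2 * \<tau>"
      by (simp add: power2_eq_square algebra_simps)
  qed simp
  then have "1 \<le> (1 + 2 * \<tau> + 8 * \<tau>\<^sup>2) * (1 - \<tau>)\<^sup>2"
    by (simp add: power2_eq_square algebra_simps)
  moreover have "0 < 1 - \<tau>" using \<tau> by (simp add: abs_le_iff)
  ultimately have "1 / (1 - \<tau>)\<^sup>2 \<le> 1 + 2 * \<tau> + 8 * \<tau>\<^sup>2" by (simp add: divide_le_eq)
  then have "1 / (1 - \<tau>)\<^sup>2 / T\<^sup>2 \<le> (1 + 2 * \<tau> + 8 * \<tau>\<^sup>2) / T\<^sup>2"
    by (intro divide_right_mono) auto
  moreover have "1 / (1 - \<tau>)\<^sup>2 / T\<^sup>2 = 1 / (T - t)\<^sup>2"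
  proof -
    have "T - t = (1 - \<tau>) * T" unfolding t by (simp add: left_diff_distrib)
    then show ?thesis by (simp add: power_mult_distrib)
  qed
  moreover have "(1 + 2 * \<tau> + 8 * \<tau>\<^sup>2) / T\<^sup>2 = 1 / T\<^sup>2 + 2 * t / T ^ 3 + 8 * t\<^sup>2 / T ^ 4"
  proof -
    have "2 * t / T ^ 3 = 2 * \<tau> / T\<^sup>2" "8 * t\<^sup>2 / T ^ 4 = 8 * \<tau>\<^sup>2 / T\<^sup>2"
      unfolding t using assms(1) by (simp_all add: eval_nat_numeral)
    then show ?thesis by (simp add: add_divide_distrib)
  qed
  ultimately show ?thesis by simp
qed

lemma sum_normsq_increments:
  "(\<Sum>e\<in>unit_steps. normsq (x + e) - normsq x) = valency TYPE('d)" for x :: "int ^ 'd"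
  unfolding sum_unit_steps normsq_add_axis card_unit_steps by simp

lemma normsq_step_bound:
  fixes R :: real
  assumes "normsq x \<le> R\<^sup>2" "0 \<le> R" "e \<in> unit_steps"
  shows "\<bar>normsq (x + e) - normsq x\<bar> \<le> 2 * R + 1"
proof -
  obtain i s where e: "e = axis i s" and s: "s = 1 \<or> s = -1"
    using assms(3) by (auto simp: unit_steps_def)
  have "(real_of_int (x $ i))\<^sup>2 \<le> R\<^sup>2" using coord_le_normsq[of x i] assms(1) by linarith
  then have "\<bar>real_of_int (x $ i)\<bar> \<le> R" using assms(2) by (simp add: abs_le_square_iff[symmetric])
  then show ?thesis unfolding e normsq_add_axis using s by auto
qed

lemma finite_normsq_less: "finite {x :: int ^ 'd. normsq x < R}"
proof -
  obtain n :: nat where n: "max 1 R \<le> real n" using real_arch_simple by blast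
  have "{x :: int ^ 'd. normsq x < R} \<subseteq> cube n"
  proof
    fix x :: "int ^ 'd" assume "x \<in> {x. normsq x < R}"
    then have "normsq x \<le> real n" using n by simp
    also have "\<dots> \<le> (real n)\<^sup>2" using n by (simp add: power2_eq_square)
    finally show "x \<in> cube n" by (rule in_cube_of_normsq)
  qed
  then show ?thesis by (rule finite_subset) simp
qed

text \<open>Read off the end of the maximum argument, where \<open>K / (2 * D\<^sup>2)\<close> is at
  most \<open>74 * D * R\<^sup>2 + 12 * R * D * (D + 1) * sqrt K\<close>. Here 74 is 2 + 72, from
  the total increment \<open>D\<close> of \<open>normsq\<close> and from its squared increments; 12
  comes from the drift. For \<open>sqrt K\<close> above \<open>R\<close> both terms are absorbed
  into a multiple of \<open>R * sqrt K\<close>.\<close>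

definition gradient_const :: "real \<Rightarrow> real" where
  "gradient_const D = 2 * D\<^sup>2 * (74 * D + 12 * D * (D + 1))"

lemma gradient_const_ge:
  assumes "1 \<le> D" shows "6 * D \<le> gradient_const D"
proof -
  have "1 * 1 \<le> D * D" by (intro mult_mono) (use assms in auto)
  then have "1 * (74 * D) \<le> 2 * D\<^sup>2 * (74 * D + 12 * D * (D + 1))"
    using assms by (intro mult_mono) (auto simp: power2_eq_square)
  then show ?thesis unfolding gradient_const_def using assms by linarith
qed

text \<open>Cheng--Yau argument: at a maximum of the weighted defect, the quadratic lower bound
  on the generator beats the terms produced by the weight.\<close>

lemma weighted_defect_bound:
  fixes u :: "int ^ 'd \<Rightarrow> real" and R :: real
  defines "D \<equiv> valency TYPE('d)"
  assumes pos: "\<And>x. 0 < u x" and R: "1 \<le> R"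
    and harm: "\<And>x. normsq x \<le> (R + 1)\<^sup>2 \<Longrightarrow> step_mean u x = u x"
    and x: "normsq x < R\<^sup>2"
  shows "(R\<^sup>2 - normsq x)\<^sup>2 * defect u x \<le> (gradient_const D)\<^sup>2 * R\<^sup>2"
proof -
  define B where "B = {x :: int ^ 'd. normsq x < R\<^sup>2}"
  define T where "T x = R\<^sup>2 - normsq x" for x :: "int ^ 'd"
  define \<Phi> where "\<Phi> x = (T x)\<^sup>2 * defect u x" for x
  have D: "1 \<le> D" unfolding D_def by (rule card_unit_steps_pos)
  have "finite B" unfolding B_def by (rule finite_normsq_less)
  moreover have "B \<noteq> {}" using x unfolding B_def by blast
  ultimately obtain z where z: "z \<in> B" and zmax: "\<And>y. y \<in> B \<Longrightarrow> \<Phi> y \<le> \<Phi> z"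
    using finite_has_maximal[of "\<Phi> ` B"]
    by (metis (no_types, lifting) Max_ge Max_in finite_imageI image_eqI image_iff image_is_empty)
  have zR: "normsq z < R\<^sup>2" using z by (simp add: B_def)
  have big: "normsq y \<le> (R + 1)\<^sup>2" if "normsq y \<le> R\<^sup>2 + 2 * R + 1" for y :: "int ^ 'd"
    using that by (simp add: power2_eq_square algebra_simps)
  have hz: "step_mean u z = u z" using zR R by (intro harm big) linarith
  have hn: "step_mean u (z + e) = u (z + e)" if "e \<in> unit_steps" for e
    using normsq_step_bound[of z R e] zR R that by (intro harm big) auto
  have H0: "0 \<le> defect u z" by (rule defect_nonneg[OF pos hz])
  have HD: "defect u z \<le> D" unfolding D_def by (rule defect_le[OF pos])
  have T0: "0 < T z" using zR by (simp add: T_def)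
  have TR: "T z \<le> R\<^sup>2" by (simp add: T_def)
  \<comment> \<open>From \<open>6 * R\<close> on, a step changes \<open>T\<close> by at most
    \<open>3 * R\<close>, half its value at most, as the Taylor bound requires. Below that threshold
    the trivial bound of the defect by \<open>D\<close> is enough.\<close>
  have main: "\<Phi> z \<le> (gradient_const D)\<^sup>2 * R\<^sup>2"
  proof (cases "T z < 6 * R")
    case True
    have "\<Phi> z \<le> (6 * R)\<^sup>2 * D" unfolding \<Phi>_def
      using True T0 HD H0 by (intro mult_mono power_mono) auto
    also have "\<dots> \<le> (6 * D)\<^sup>2 * R\<^sup>2"
    proof -
      have "D \<le> D\<^sup>2" using D by (simp add: power2_eq_square)
      then have "36 * R\<^sup>2 * D \<le> 36 * R\<^sup>2 * D\<^sup>2" by (rule mult_left_mono) simp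
      then show ?thesis by (simp add: power_mult_distrib ac_simps)
    qed
    also have "\<dots> \<le> (gradient_const D)\<^sup>2 * R\<^sup>2"
      using gradient_const_ge[OF D] D by (intro mult_right_mono power_mono) auto
    finally show ?thesis .
  next
    case False
    define K where "K = \<Phi> z"
    have K0: "0 \<le> K" unfolding K_def \<Phi>_def using H0 by simp
    define \<delta> where "\<delta> e = normsq (z + e) - normsq z" for e
    define s where "s e = root_ratio u e z" for e
    have \<delta>: "\<bar>\<delta> e\<bar> \<le> 3 * R" if "e \<in> unit_steps" for e
      using normsq_step_bound[of z R e] zR R that unfolding \<delta>_def by auto
    have \<delta>T: "\<bar>\<delta> e\<bar> \<le> T z / 2" if "e \<in> unit_steps" for e
      using \<delta>[OF that] False by linarith
    have Te: "T (z + e) = T z - \<delta> e" for e by (simp add: T_def \<delta>_def)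
    have Hz: "defect u z = K / (T z)\<^sup>2" using T0 by (simp add: K_def \<Phi>_def)
    \<comment> \<open>\<open>T\<close> stays positive at the neighbours, so they compete in the
      maximum, and their defect is at most \<open>K\<close> over the squared weight.\<close>
    have inc: "defect u (z + e) - defect u z \<le> K * (2 * \<delta> e / T z ^ 3 + 8 * (\<delta> e)\<^sup>2 / T z ^ 4)"
      if e: "e \<in> unit_steps" for e
    proof -
      have Tp: "0 < T (z + e)" using \<delta>T[OF e] T0 unfolding Te by (auto simp: abs_le_iff)
      then have "z + e \<in> B" by (simp add: B_def T_def)
      then have "(T (z + e))\<^sup>2 * defect u (z + e) \<le> K" using zmax unfolding \<Phi>_def K_def by blast
      then have "defect u (z + e) \<le> K * (1 / (T z - \<delta> e)\<^sup>2)"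
        using Tp unfolding Te by (simp add: field_simps)
      also have "\<dots> \<le> K * (1 / (T z)\<^sup>2 + 2 * \<delta> e / T z ^ 3 + 8 * (\<delta> e)\<^sup>2 / T z ^ 4)"
        using inverse_square_taylor[OF T0 \<delta>T[OF e]] K0 by (rule mult_left_mono)
      finally show ?thesis unfolding Hz by (simp add: algebra_simps)
    qed
    have s2: "(\<Sum>e\<in>unit_steps. (s e)\<^sup>2) = D"
      unfolding s_def D_def by (rule sum_root_ratio_sq[OF pos hz])
    \<comment> \<open>With equal weights the increments of \<open>normsq\<close> add up to
      \<open>D\<close> only; the deviation of the weights costs the square root of the defect.
      Bounding each increment by \<open>3 * R\<close> instead would lose a factor of order
      \<open>R\<close> in the end.\<close>
    have S1: "(\<Sum>e\<in>unit_steps. (s e)\<^sup>2 * \<delta> e) \<le> D + 3 * R * ((D + 1) * (2 * D * sqrt (defect u z)))"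
    proof -
      have "(\<Sum>e\<in>unit_steps. (s e)\<^sup>2 * \<delta> e)
          = (\<Sum>e\<in>unit_steps. \<delta> e) + (\<Sum>e\<in>unit_steps. ((s e)\<^sup>2 - 1) * \<delta> e)"
        by (simp add: sum.distrib[symmetric] algebra_simps)
      also have "(\<Sum>e\<in>unit_steps. \<delta> e) = D"
        unfolding \<delta>_def D_def by (rule sum_normsq_increments)
      also have "(\<Sum>e\<in>unit_steps. ((s e)\<^sup>2 - 1) * \<delta> e) \<le> (\<Sum>e\<in>unit_steps. 3 * R * \<bar>(s e)\<^sup>2 - 1\<bar>)"
      proof (rule sum_mono)
        fix e :: "int ^ 'd" assume "e \<in> unit_steps"
        then have "\<bar>(s e)\<^sup>2 - 1\<bar> * \<bar>\<delta> e\<bar> \<le> \<bar>(s e)\<^sup>2 - 1\<bar> * (3 * R)"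
          using \<delta> by (intro mult_left_mono) auto
        then show "((s e)\<^sup>2 - 1) * \<delta> e \<le> 3 * R * \<bar>(s e)\<^sup>2 - 1\<bar>"
          using abs_ge_self[of "((s e)\<^sup>2 - 1) * \<delta> e"] unfolding abs_mult by (simp add: mult.commute)
      qed
      also have "\<dots> = 3 * R * (\<Sum>e\<in>unit_steps. \<bar>(s e)\<^sup>2 - 1\<bar>)" by (simp add: sum_distrib_left)
      also have "\<dots> \<le> 3 * R * ((D + 1) * (2 * D * sqrt (defect u z)))"
        using sum_abs_root_ratio_sq_deviation[OF pos hz] R unfolding s_def D_def
        by (intro mult_left_mono) auto
      finally show ?thesis by simp
    qed
    have S2: "(\<Sum>e\<in>unit_steps. (s e)\<^sup>2 * (\<delta> e)\<^sup>2) \<le> 9 * R\<^sup>2 * D"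
    proof -
      have "(\<Sum>e\<in>unit_steps. (s e)\<^sup>2 * (\<delta> e)\<^sup>2) \<le> (\<Sum>e\<in>unit_steps. (s e)\<^sup>2 * (3 * R)\<^sup>2)"
      proof (intro sum_mono mult_left_mono)
        fix e :: "int ^ 'd" assume "e \<in> unit_steps"
        then have "\<bar>\<delta> e\<bar> \<le> \<bar>3 * R\<bar>" using \<delta>[of e] by linarith
        then show "(\<delta> e)\<^sup>2 \<le> (3 * R)\<^sup>2" by (simp only: abs_le_square_iff)
      qed auto
      also have "\<dots> = 9 * R\<^sup>2 * D" by (simp add: sum_distrib_right[symmetric] s2 power_mult_distrib)
      finally show ?thesis .
    qed
    have gen: "(defect u z)\<^sup>2 / (2 * D\<^sup>2)
        \<le> K * (2 / T z ^ 3 * (\<Sum>e\<in>unit_steps. (s e)\<^sup>2 * \<delta> e)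
          + 8 / T z ^ 4 * (\<Sum>e\<in>unit_steps. (s e)\<^sup>2 * (\<delta> e)\<^sup>2))"
    proof -
      have "(defect u z)\<^sup>2 / (2 * D\<^sup>2)
          \<le> (\<Sum>e\<in>unit_steps. (s e)\<^sup>2 * (defect u (z + e) - defect u z))"
        unfolding s_def D_def by (rule defect_generator_ge[OF pos hz hn])
      also have "\<dots> \<le> (\<Sum>e\<in>unit_steps. (s e)\<^sup>2 *
            (K * (2 * \<delta> e / T z ^ 3 + 8 * (\<delta> e)\<^sup>2 / T z ^ 4)))"
        by (intro sum_mono mult_left_mono inc) auto
      also have "\<dots> = (\<Sum>e\<in>unit_steps. K * (2 / T z ^ 3 * ((s e)\<^sup>2 * \<delta> e)
          + 8 / T z ^ 4 * ((s e)\<^sup>2 * (\<delta> e)\<^sup>2)))"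
        by (intro sum.cong refl) (simp add: field_simps)
      finally show ?thesis by (simp only: sum_distrib_left[symmetric] sum.distrib)
    qed
    have sqrtH: "sqrt (defect u z) = sqrt K / T z"
      unfolding Hz using T0 by (simp add: real_sqrt_divide)
    have "(K / (T z)\<^sup>2)\<^sup>2 / (2 * D\<^sup>2)
        \<le> K * (2 / T z ^ 3 * (D + 3 * R * ((D + 1) * (2 * D * (sqrt K / T z))))
          + 8 / T z ^ 4 * (9 * R\<^sup>2 * D))"
    proof -
      have "K * (2 / T z ^ 3 * (\<Sum>e\<in>unit_steps. (s e)\<^sup>2 * \<delta> e)
          + 8 / T z ^ 4 * (\<Sum>e\<in>unit_steps. (s e)\<^sup>2 * (\<delta> e)\<^sup>2))
         \<le> K * (2 / T z ^ 3 * (D + 3 * R * ((D + 1) * (2 * D * (sqrt K / T z))))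
          + 8 / T z ^ 4 * (9 * R\<^sup>2 * D))"
        using T0 K0 S1[unfolded sqrtH] S2 by (intro mult_left_mono add_mono) auto
      with gen show ?thesis unfolding Hz by linarith
    qed
    also have "\<dots> = K * (2 * D * T z + 12 * R * D * (D + 1) * sqrt K + 72 * R\<^sup>2 * D) / T z ^ 4"
      using T0 by (simp add: field_simps eval_nat_numeral)
    finally have "K * (K / (2 * D\<^sup>2)) / T z ^ 4
        \<le> K * (2 * D * T z + 12 * R * D * (D + 1) * sqrt K + 72 * R\<^sup>2 * D) / T z ^ 4"
      using T0 by (simp add: field_simps eval_nat_numeral)
    then have K1: "K * (K / (2 * D\<^sup>2)) \<le> K * (2 * D * T z + 12 * R * D * (D + 1) * sqrt K + 72 * R\<^sup>2 * D)"
      unfolding divide_le_cancel using zero_less_power[OF T0, of 4] by linarith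
    show ?thesis
    proof (cases "K = 0")
      case True
      then show ?thesis unfolding K_def by simp
    next
      case False
      then have "K / (2 * D\<^sup>2) \<le> 2 * D * T z + 12 * R * D * (D + 1) * sqrt K + 72 * R\<^sup>2 * D"
        using K1 K0 by (simp only: mult_le_cancel_left)
      also have "\<dots> \<le> 2 * D * R\<^sup>2 + 12 * R * D * (D + 1) * sqrt K + 72 * R\<^sup>2 * D"
        using TR D by simp
      finally have K2: "K \<le> (2 * D\<^sup>2) * (74 * D * R\<^sup>2 + 12 * R * D * (D + 1) * sqrt K)"
        using D by (simp add: field_simps)
      define y where "y = sqrt K / R"
      have y0: "0 \<le> y" unfolding y_def using K0 R by simp
      have Ky: "sqrt K = R * y" unfolding y_def using R by simp
      have Ky2: "K = R\<^sup>2 * y\<^sup>2"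
        using K0 by (metis Ky power_mult_distrib real_sqrt_pow2)
      have "y \<le> gradient_const D"
      proof (cases "y \<le> 1")
        case True
        then show ?thesis using gradient_const_ge[OF D] D by linarith
      next
        case False
        have "R\<^sup>2 * y\<^sup>2 \<le> R\<^sup>2 * ((2 * D\<^sup>2) * (74 * D + 12 * D * (D + 1) * y))"
          using K2 unfolding Ky unfolding Ky2 by (simp add: power2_eq_square algebra_simps)
        then have "y\<^sup>2 \<le> (2 * D\<^sup>2) * (74 * D + 12 * D * (D + 1) * y)"
          using R by simp
        also have "\<dots> \<le> (2 * D\<^sup>2) * (74 * D * y + 12 * D * (D + 1) * y)"
          using False D by (intro mult_left_mono add_right_mono) auto
        also have "\<dots> = gradient_const D * y"
          unfolding gradient_const_def by (simp only: distrib_left distrib_right ac_simps)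
        finally show ?thesis using False by (simp add: power2_eq_square)
      qed
      then have "y\<^sup>2 \<le> (gradient_const D)\<^sup>2" using y0 by (rule power_mono)
      then have "K \<le> (gradient_const D)\<^sup>2 * R\<^sup>2"
        unfolding Ky2 mult.commute[of "R\<^sup>2"] by (rule mult_right_mono) simp
      then show ?thesis unfolding K_def .
    qed
  qed
  have "\<Phi> x \<le> \<Phi> z" using x by (intro zmax) (simp add: B_def)
  with main show ?thesis unfolding \<Phi>_def T_def by linarith
qed

definition harnack_const :: "real \<Rightarrow> real" where
  "harnack_const D = 2 * gradient_const D * (D + 1)"

text \<open>On the inner half of the ball the weight is at least
  \<open>(3 / 4 * R\<^sup>2)\<^sup>2\<close>, so the defect is of order R^-2 and each root ratio is
  at most 1 + O(1/R). Squaring the ratio contributes the factor \<open>D + 1\<close> of the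
  constant.\<close>

lemma gradient_estimate:
  fixes u :: "int ^ 'd \<Rightarrow> real" and R :: real
  defines "D \<equiv> valency TYPE('d)"
  assumes pos: "\<And>x. 0 < u x" and R: "1 \<le> R"
    and harm: "\<And>x. normsq x \<le> (R + 1)\<^sup>2 \<Longrightarrow> step_mean u x = u x"
    and x: "normsq x \<le> R\<^sup>2 / 4" and e: "e \<in> unit_steps"
  shows "u (x + e) \<le> (1 + harnack_const D / R) * u x"
proof -
  have D: "1 \<le> D" unfolding D_def by (rule card_unit_steps_pos)
  define G where "G = gradient_const D"
  have G: "0 \<le> G" unfolding G_def using gradient_const_ge[OF D] D by linarith
  have R2: "0 < R\<^sup>2" using R by simp
  have xR: "normsq x < R\<^sup>2" using x R2 by linarith
  have "normsq x \<le> (R + 1)\<^sup>2"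
  proof -
    have "R\<^sup>2 \<le> (R + 1)\<^sup>2" using R by (intro power_mono) auto
    then show ?thesis using xR by linarith
  qed
  then have hx: "step_mean u x = u x" by (rule harm)
  have H0: "0 \<le> defect u x" by (rule defect_nonneg[OF pos hx])
  have "(3 / 4 * R\<^sup>2)\<^sup>2 * defect u x \<le> (R\<^sup>2 - normsq x)\<^sup>2 * defect u x"
    using x H0 by (intro mult_right_mono power_mono) auto
  also have "\<dots> \<le> G\<^sup>2 * R\<^sup>2"
    unfolding G_def D_def by (rule weighted_defect_bound[OF pos R harm xR])
  finally have "R\<^sup>2 * (9 / 16 * R\<^sup>2 * defect u x) \<le> R\<^sup>2 * G\<^sup>2"
    by (simp add: power2_eq_square algebra_simps)
  then have "9 / 16 * R\<^sup>2 * defect u x \<le> G\<^sup>2" using R2 by (simp only: mult_le_cancel_left_pos)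
  moreover have "(R * (1 - root_ratio u e x))\<^sup>2 \<le> 2 * (R\<^sup>2 * defect u x)"
  proof -
    have "(1 - root_ratio u e x)\<^sup>2 \<le> (\<Sum>e\<in>unit_steps. (1 - root_ratio u e x)\<^sup>2)"
      using e by (intro member_le_sum) auto
    also have "\<dots> = 2 * defect u x" by (rule sum_root_ratio_deviation[OF pos hx])
    finally have "R\<^sup>2 * (1 - root_ratio u e x)\<^sup>2 \<le> R\<^sup>2 * (2 * defect u x)"
      by (rule mult_left_mono) simp
    then show ?thesis by (simp add: power_mult_distrib)
  qed
  moreover have "0 \<le> R\<^sup>2 * defect u x" using H0 by simp
  ultimately have "(R * (1 - root_ratio u e x))\<^sup>2 \<le> (2 * G)\<^sup>2"
    by (simp add: power_mult_distrib)
  then have "\<bar>R * (1 - root_ratio u e x)\<bar> \<le> 2 * G"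
    using abs_le_square_iff[of "R * (1 - root_ratio u e x)" "2 * G"] G by simp
  then have dev: "root_ratio u e x - 1 \<le> 2 * G / R"
    using R by (simp add: abs_le_iff field_simps)
  have s: "0 < root_ratio u e x" "root_ratio u e x \<le> D"
    unfolding D_def using root_ratio_pos[OF pos] root_ratio_le[OF pos hx e] by auto
  have "u (x + e) / u x = (root_ratio u e x)\<^sup>2" by (simp only: root_ratio_sq[OF pos])
  also have "\<dots> = 1 + (root_ratio u e x - 1) * (root_ratio u e x + 1)"
    by (simp add: power2_eq_square algebra_simps)
  also have "\<dots> \<le> 1 + 2 * G / R * (root_ratio u e x + 1)"
    using dev s by (intro add_left_mono mult_right_mono) auto
  also have "\<dots> \<le> 1 + 2 * G / R * (D + 1)"
    using s G R by (intro add_left_mono mult_left_mono) auto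
  also have "\<dots> = 1 + harnack_const D / R" by (simp add: harnack_const_def G_def)
  finally show ?thesis using pos[of x] by (simp add: divide_le_eq)
qed

section \<open>Lattice paths inside a cube and the Harnack inequality\<close>

lemma cube_geodesic_step:
  fixes x y :: "int ^ 'd"
  assumes "x \<in> cube \<rho>" "y \<in> cube \<rho>" "x \<noteq> y"
  obtains e where "e \<in> unit_steps" "x + e \<in> cube \<rho>"
    "(\<Sum>i\<in>UNIV. nat \<bar>x $ i - y $ i\<bar>) = Suc (\<Sum>i\<in>UNIV. nat \<bar>(x + e) $ i - y $ i\<bar>)"
    "\<And>i. x $ i = y $ i \<Longrightarrow> (x + e) $ i = x $ i"
proof -
  obtain j where j: "x $ j \<noteq> y $ j" using assms(3) by (auto simp: vec_eq_iff)
  define s :: int where "s = (if x $ j < y $ j then 1 else - 1)"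
  define e where "e = (axis j s :: int ^ 'd)"
  have e: "e \<in> unit_steps" by (auto simp: e_def s_def)
  have ej: "(x + e) $ j = x $ j + s" and ei: "i \<noteq> j \<Longrightarrow> (x + e) $ i = x $ i" for i
    by (auto simp: e_def axis_def)
  have xj: "\<bar>x $ j\<bar> \<le> int \<rho>" "\<bar>y $ j\<bar> \<le> int \<rho>" using assms by (auto simp: mem_cube)
  have "x + e \<in> cube \<rho>" unfolding mem_cube
  proof
    fix i show "\<bar>(x + e) $ i\<bar> \<le> int \<rho>"
    proof (cases "i = j")
      case True
      show ?thesis unfolding True ej s_def using xj j by auto
    next
      case False
      then show ?thesis using assms(1) unfolding ei[OF False] mem_cube by blast
    qed
  qed
  moreover have "(\<Sum>i\<in>UNIV. nat \<bar>x $ i - y $ i\<bar>) = Suc (\<Sum>i\<in>UNIV. nat \<bar>(x + e) $ i - y $ i\<bar>)"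
  proof -
    have "nat \<bar>x $ j - y $ j\<bar> = Suc (nat \<bar>(x + e) $ j - y $ j\<bar>)"
      unfolding ej s_def using j by auto
    moreover have "(\<Sum>i\<in>UNIV - {j}. nat \<bar>x $ i - y $ i\<bar>) = (\<Sum>i\<in>UNIV - {j}. nat \<bar>(x + e) $ i - y $ i\<bar>)"
    proof (intro sum.cong refl)
      fix i assume "i \<in> UNIV - {j}"
      then have "i \<noteq> j" by simp
      show "nat \<bar>x $ i - y $ i\<bar> = nat \<bar>(x + e) $ i - y $ i\<bar>" by (simp only: ei[OF \<open>i \<noteq> j\<close>])
    qed
    ultimately show ?thesis by (simp only: sum.remove[of UNIV j] finite UNIV_I)
  qed
  \<comment> \<open>Coordinates that already agree stay fixed along the whole path. The detours
    around the other box rely on this.\<close>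
  moreover have "(x + e) $ i = x $ i" if "x $ i = y $ i" for i
    using that j by (intro ei) blast
  ultimately show ?thesis using e that by blast
qed

lemma cube_l1_bound:
  fixes x y :: "int ^ 'd"
  assumes "x \<in> cube \<rho>" "y \<in> cube \<rho>"
  shows "(\<Sum>i\<in>UNIV. nat \<bar>x $ i - y $ i\<bar>) \<le> CARD('d) * (2 * \<rho>)"
proof -
  have "nat \<bar>x $ i - y $ i\<bar> \<le> 2 * \<rho>" for i
  proof -
    have "\<bar>x $ i\<bar> \<le> int \<rho>" "\<bar>y $ i\<bar> \<le> int \<rho>" using assms by (auto simp: mem_cube)
    then show ?thesis by linarith
  qed
  then show ?thesis using sum_bounded_above[of "UNIV :: 'd set" "\<lambda>i. nat \<bar>x $ i - y $ i\<bar>" "2 * \<rho>"] by simp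
qed

lemma cube_chain_ratio:
  fixes u :: "int ^ 'd \<Rightarrow> real"
  assumes "x \<in> cube \<rho>" "y \<in> cube \<rho>" "1 \<le> q"
    and nonneg: "\<And>z. 0 \<le> u z"
    and step: "\<And>z e. z \<in> cube \<rho> \<Longrightarrow> e \<in> unit_steps \<Longrightarrow> u (z + e) \<le> q * u z"
  shows "u y \<le> q ^ (CARD('d) * (2 * \<rho>)) * u x"
proof -
  have "u y \<le> q ^ n * u x" if "n = (\<Sum>i\<in>UNIV. nat \<bar>x $ i - y $ i\<bar>)" "x \<in> cube \<rho>" for n x
    using that
  proof (induction n arbitrary: x)
    case 0
    then have "x = y" by (auto simp: vec_eq_iff)
    then show ?case by simp
  next
    case (Suc n)
    then have "x \<noteq> y" by auto
    then obtain e where e: "e \<in> unit_steps" "x + e \<in> cube \<rho>"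
      "(\<Sum>i\<in>UNIV. nat \<bar>x $ i - y $ i\<bar>) = Suc (\<Sum>i\<in>UNIV. nat \<bar>(x + e) $ i - y $ i\<bar>)"
      using cube_geodesic_step[OF Suc.prems(2) assms(2)] by blast
    have "u y \<le> q ^ n * u (x + e)" using Suc.prems e by (intro Suc.IH) auto
    also have "\<dots> \<le> q ^ n * (q * u x)"
      using step[OF Suc.prems(2) e(1)] assms(3) by (intro mult_left_mono) auto
    finally show ?case by (simp add: ac_simps)
  qed
  then have "u y \<le> q ^ (\<Sum>i\<in>UNIV. nat \<bar>x $ i - y $ i\<bar>) * u x" using assms(1) by blast
  also have "\<dots> \<le> q ^ (CARD('d) * (2 * \<rho>)) * u x"
    using assms cube_l1_bound by (intro mult_right_mono power_increasing) auto
  finally show ?thesis .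
qed

lemma one_plus_power_le:
  fixes a :: real
  assumes "0 \<le> a" "real n * a \<le> 1"
  shows "(1 + a) ^ n \<le> 1 + 2 * (real n * a)"
proof -
  have "(1 + a) ^ n \<le> exp a ^ n"
    using assms(1) exp_ge_add_one_self[of a] by (intro power_mono) auto
  also have "\<dots> = exp (real n * a)" by (simp add: exp_of_nat_mult)
  also have "\<dots> \<le> 1 + real n * a + (real n * a)\<^sup>2" using assms by (intro exp_bound) auto
  also have "(real n * a)\<^sup>2 \<le> real n * a"
    using assms mult_left_le[of "real n * a" "real n * a"] by (simp add: power2_eq_square)
  finally show ?thesis by linarith
qed

text \<open>The 8 is a product of three factors 2: two points of the cube are joined by at most
  \<open>2 * d * L\<close> steps, \<open>R\<close> is at least \<open>r / 2\<close>, and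
  \<open>(1 + a) ^ n\<close> is bounded by \<open>1 + 2 * n * a\<close>.\<close>

definition cube_harnack_const :: "'d::finite itself \<Rightarrow> real" where
  "cube_harnack_const _ = 8 * real CARD('d) * harnack_const (valency TYPE('d))"

lemma harnack_const_ge: "1 \<le> D \<Longrightarrow> 12 \<le> harnack_const D"
proof -
  assume D: "1 \<le> D"
  have "6 \<le> gradient_const D" using gradient_const_ge[OF D] D by linarith
  then have "2 * 6 * 1 \<le> 2 * gradient_const D * (D + 1)" using D by (intro mult_mono) auto
  then show ?thesis by (simp add: harnack_const_def)
qed

lemma cube_harnack_const_ge: "8 \<le> cube_harnack_const TYPE('d::finite)"
proof -
  have "12 \<le> harnack_const (valency TYPE('d))" by (rule harnack_const_ge[OF card_unit_steps_pos])
  moreover have "1 \<le> real CARD('d)" using zero_less_card_finite[where 'a='d] by linarith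
  ultimately have "8 * 1 * 1 \<le> 8 * real CARD('d) * harnack_const (valency TYPE('d))"
    by (intro mult_mono) auto
  then show ?thesis by (simp add: cube_harnack_const_def)
qed

lemma cube_harnack:
  fixes M :: "int ^ 'd \<Rightarrow> real" and L r :: nat
  defines "c \<equiv> cube_harnack_const TYPE('d)"
  assumes nonneg: "\<And>x. 0 \<le> M x"
    and harm: "\<And>x. x \<in> cube r \<Longrightarrow> step_mean M x = M x"
    and L: "1 \<le> L" and r: "c * real L \<le> real r"
    and x: "x \<in> cube L" and y: "y \<in> cube L"
  shows "M y \<le> (1 + c * real L / real r) * M x"
proof -
  define h where "h = harnack_const (valency TYPE('d))"
  define d where "d = real CARD('d)"
  \<comment> \<open>The gradient estimate asks for harmonicity up to Euclidean radius
    \<open>R + 1\<close>, and the ball of radius \<open>r\<close> lies in the cube of radius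
    \<open>r\<close>.\<close>
  define R where "R = real r - 1"
  have h: "12 \<le> h" unfolding h_def by (rule harnack_const_ge[OF card_unit_steps_pos])
  have d: "1 \<le> d" unfolding d_def using zero_less_card_finite[where 'a='d] by linarith
  have c: "c = 8 * d * h" by (simp add: c_def cube_harnack_const_def h_def d_def)
  have L1: "1 \<le> real L" using L by simp
  have dL: "1 * 1 \<le> d * real L" by (intro mult_mono) (use d L1 in auto)
  have r1: "8 * h * (d * real L) \<le> real r" using r unfolding c by (simp add: ac_simps)
  have "12 * 1 \<le> h * (d * real L)" using h dL by (intro mult_mono) auto
  then have r96: "96 \<le> real r" using r1 by linarith
  have R1: "1 \<le> R" "real r / 2 \<le> R" using r96 by (auto simp: R_def)
  \<comment> \<open>The gradient estimate divides by its function, while \<open>M\<close> may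
    vanish. Adding a constant preserves harmonicity; \<epsilon> tends to zero at the end.\<close>
  have key: "M y + \<epsilon> \<le> (1 + c * real L / real r) * (M x + \<epsilon>)" if \<epsilon>: "0 < \<epsilon>" for \<epsilon>
  proof -
    let ?u = "\<lambda>z. M z + \<epsilon>"
    have upos: "0 < ?u z" for z using nonneg[of z] \<epsilon> by simp
    have uharm: "step_mean ?u z = ?u z" if "normsq z \<le> (R + 1)\<^sup>2" for z
    proof -
      have "z \<in> cube r" using that by (intro in_cube_of_normsq) (simp add: R_def)
      then show ?thesis by (simp add: step_mean_add harm)
    qed
    have ustep: "?u (z + e) \<le> (1 + h / R) * ?u z" if "z \<in> cube L" "e \<in> unit_steps" for z e
      unfolding h_def
    proof (rule gradient_estimate[OF upos R1(1) uharm _ that(2)])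
      have "normsq z \<le> d * (real L)\<^sup>2" unfolding d_def by (rule normsq_le_cube[OF that(1)])
      also have "\<dots> \<le> d\<^sup>2 * (real L)\<^sup>2"
        using d by (intro mult_right_mono) (auto simp: power2_eq_square)
      also have "\<dots> = (d * real L)\<^sup>2" by (simp only: power_mult_distrib)
      also have "\<dots> \<le> (R / 2)\<^sup>2"
      proof (rule power_mono)
        have "8 * 12 * (d * real L) \<le> 8 * h * (d * real L)"
          using h dL by (intro mult_right_mono) auto
        then show "d * real L \<le> R / 2" using r1 R1(2) dL by linarith
      qed (use d in auto)
      finally show "normsq z \<le> R\<^sup>2 / 4" by (simp add: power_divide)
    qed
    define n where "n = CARD('d) * (2 * L)"
    have n: "real n = 2 * (d * real L)" by (simp add: n_def d_def)
    have "real n * (h / R) \<le> real n * (h / (real r / 2))"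
      using R1 h r96 by (intro mult_left_mono divide_left_mono) auto
    also have "\<dots> = c * real L / real r / 2" unfolding n c using r96 by simp
    finally have na: "real n * (h / R) \<le> c * real L / real r / 2" .
    have "c * real L / real r \<le> 1" using r r96 by (simp add: divide_le_eq)
    then have "c * real L / real r / 2 \<le> 1 / 2" by (rule divide_right_mono) simp
    also have "(1::real) / 2 \<le> 1" by simp
    finally have "c * real L / real r / 2 \<le> 1" .
    with na have "real n * (h / R) \<le> 1" by (rule order_trans)
    moreover have "0 \<le> h / R" using h R1 by simp
    ultimately have "(1 + h / R) ^ n \<le> 1 + 2 * (real n * (h / R))"
      by (intro one_plus_power_le)
    also have "\<dots> \<le> 1 + c * real L / real r" using na by simp
    finally have pow: "(1 + h / R) ^ n \<le> 1 + c * real L / real r" .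
    have "?u y \<le> (1 + h / R) ^ n * ?u x"
      unfolding n_def by (rule cube_chain_ratio[OF x y _ less_imp_le[OF upos] ustep]) (use h R1 in auto)
    also have "\<dots> \<le> (1 + c * real L / real r) * ?u x"
      using pow upos[of x] by (intro mult_right_mono) auto
    finally show ?thesis .
  qed
  define q where "q = 1 + c * real L / real r"
  have q: "0 < q" unfolding q_def c using h d L1 r96 by (intro add_pos_nonneg) auto
  show ?thesis unfolding q_def[symmetric]
  proof (rule field_le_epsilon)
    fix e :: real assume "0 < e"
    then have "0 < e / q" using q by simp
    from key[OF this, folded q_def] have "M y + e / q \<le> q * M x + e"
      using q by (simp add: distrib_left)
    moreover have "0 < e / q" by fact
    ultimately show "M y \<le> q * M x + e" by linarith
  qed
qed

section \<open>Hitting and escape probabilities of cubes\<close>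

text \<open>The third-order Taylor polynomial, with \<open>\<tau> ^ 4\<close> as a generous bound
  for the remainder. After squaring and multiplying by \<open>1 + \<tau>\<close>, the terms of order
  one to three cancel, so a factor \<open>\<tau> ^ 4\<close> splits off.\<close>

lemma inverse_sqrt_taylor:
  fixes \<tau> :: real
  assumes "\<bar>\<tau>\<bar> \<le> 1 / 2"
  shows "1 / sqrt (1 + \<tau>) \<le> 1 - \<tau> / 2 + 3 / 8 * \<tau>\<^sup>2 - 5 / 16 * \<tau> ^ 3 + \<tau> ^ 4"
proof -
  define p where "p = 1 - \<tau> / 2 + 3 / 8 * \<tau>\<^sup>2 - 5 / 16 * \<tau> ^ 3 + \<tau> ^ 4"
  have t2: "\<tau>\<^sup>2 \<le> (1/2)\<^sup>2" "0 \<le> \<tau>\<^sup>2"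
    using assms by (auto simp: abs_le_square_iff[symmetric])
  have a3: "\<bar>\<tau> ^ 3\<bar> \<le> (1/2) ^ 3" unfolding power_abs by (rule power_mono[OF assms]) simp
  then have t3: "\<tau> ^ 3 \<le> 1/8" "- (1/8) \<le> \<tau> ^ 3" by (auto simp: abs_le_iff eval_nat_numeral)
  have a4: "\<bar>\<tau>\<bar> ^ 4 \<le> (1/2) ^ 4" by (rule power_mono[OF assms]) simp
  have "\<bar>\<tau>\<bar> ^ 4 = \<tau> ^ 4" by (simp add: power_even_abs)
  with a4 have t4: "\<tau> ^ 4 \<le> 1/16" "0 \<le> \<tau> ^ 4" by (auto simp: power_divide)
  have t1: "\<tau> \<le> 1/2" "- (1/2) \<le> \<tau>" using assms by (auto simp: abs_le_iff)
  have t2': "\<tau>\<^sup>2 \<le> 1/4" using t2 by (simp add: power2_eq_square)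
  have p0: "0 < p" unfolding p_def using t1 t2 t3 t4 by linarith
  define q where "q = 16 - 8 * \<tau> + 6 * \<tau>\<^sup>2 - 5 * \<tau> ^ 3 + 16 * \<tau> ^ 4"
  have pq: "p = q / 16" by (simp add: p_def q_def)
  have "q\<^sup>2 * (1 + \<tau>) - 256 = \<tau> ^ 4 * (372 + 312 * \<tau> - 99 * \<tau>\<^sup>2 + 57 * \<tau> ^ 3 + 96 * \<tau> ^ 4)
      + \<tau> ^ 4 * \<tau> ^ 4 * (256 * \<tau>)"
    unfolding q_def by algebra
  \<comment> \<open>As \<tau> may be negative, \<open>256 * \<tau> ^ 8\<close> is moved from the
    first group to the second, where it turns \<open>256 * \<tau>\<close> into
    \<open>256 * (1 + \<tau>)\<close>.\<close>
  also have "\<dots> = \<tau> ^ 4 * (372 + 312 * \<tau> - 99 * \<tau>\<^sup>2 + 57 * \<tau> ^ 3 - 160 * \<tau> ^ 4)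
      + \<tau> ^ 4 * \<tau> ^ 4 * (256 * (1 + \<tau>))"
    by algebra
  also have "\<dots> \<ge> 0"
  proof -
    have "0 \<le> 372 + 312 * \<tau> - 99 * \<tau>\<^sup>2 + 57 * \<tau> ^ 3 - 160 * \<tau> ^ 4"
      using t1 t2' t3 t4 by linarith
    moreover have "0 \<le> 256 * (1 + \<tau>)" using t1 by simp
    ultimately show ?thesis using t4(2) mult_nonneg_nonneg add_nonneg_nonneg by metis
  qed
  finally have "1 \<le> p\<^sup>2 * (1 + \<tau>)" unfolding pq by (simp add: power_divide)
  then have "1 \<le> sqrt (p\<^sup>2 * (1 + \<tau>))" by simp
  also have "\<dots> = p * sqrt (1 + \<tau>)" using p0 by (simp add: real_sqrt_mult)
  finally show ?thesis unfolding p_def[symmetric] using t1 by (simp add: divide_le_eq)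
qed

text \<open>In the continuum \<open>(\<bar>x\<bar>\<^sup>2 + K) powr (-1/2)\<close> has Laplacian at most \<open>- 3 K (\<bar>x\<bar>\<^sup>2 + K) powr (-5/2)\<close>
  for \<open>d \<ge> 3\<close>; for \<open>K = d + 27\<close> this beats the lattice correction, which is of the same order.\<close>

definition barrier :: "int ^ 'd \<Rightarrow> real" where
  "barrier x = 1 / sqrt (normsq x + (real CARD('d) + 27))"

text \<open>Opposite steps are added so that the odd powers of \<open>a\<close> cancel. The
  third-order terms then have a favourable sign and are dropped, which explains why powers two and
  four of \<open>\<rho>\<close> appear without the third.\<close>

lemma barrier_pair_bound:
  fixes x :: "int ^ 'd" and i :: 'd
  defines "\<rho> \<equiv> normsq x + (real CARD('d) + 27)"
  defines "a \<equiv> real_of_int (x $ i)"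
  shows "barrier (x + axis i 1) + barrier (x + axis i (-1))
    \<le> barrier x * (2 - 1 / \<rho> + (3/4 + 3 * a\<^sup>2) / \<rho>\<^sup>2 + (2 + 48 * a\<^sup>2 + 32 * a ^ 4) / \<rho> ^ 4)"
proof -
  have a2: "a\<^sup>2 \<le> normsq x" unfolding a_def by (rule coord_le_normsq)
  have \<rho>27: "27 + a\<^sup>2 \<le> \<rho>" unfolding \<rho>_def using a2 by simp
  have "0 \<le> a\<^sup>2" by simp
  then have \<rho>: "0 < \<rho>" using \<rho>27 by linarith
  have small: "2 * (1 + 2 * \<bar>a\<bar>) \<le> \<rho>"
  proof -
    have "0 \<le> (\<bar>a\<bar> - 2)\<^sup>2" by simp
    then have "4 * \<bar>a\<bar> \<le> a\<^sup>2 + 4" by (simp add: power2_eq_square algebra_simps)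
    then show ?thesis using \<rho>27 by simp
  qed
  have one: "barrier (x + axis i s) \<le> barrier x * (1 - ((1 + 2 * s * a) / \<rho>) / 2
      + 3 / 8 * ((1 + 2 * s * a) / \<rho>)\<^sup>2 - 5 / 16 * ((1 + 2 * s * a) / \<rho>) ^ 3 + ((1 + 2 * s * a) / \<rho>) ^ 4)"
    if s: "s = 1 \<or> s = -1" for s :: int
  proof -
    define \<tau> where "\<tau> = (1 + 2 * s * a) / \<rho>"
    have "\<bar>1 + 2 * s * a\<bar> \<le> \<rho> / 2"
    proof -
      have "\<bar>2 * s * a\<bar> = 2 * \<bar>a\<bar>" using s by (auto simp: abs_mult)
      then show ?thesis using small abs_triangle_ineq[of 1 "2 * s * a"] by argo
    qed
    then have \<tau>: "\<bar>\<tau>\<bar> \<le> 1/2" unfolding \<tau>_def using \<rho> by (simp add: abs_divide divide_le_eq)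
    have "normsq (x + axis i s) + (real CARD('d) + 27) = \<rho> * (1 + \<tau>)"
    proof -
      have "\<rho> * (1 + \<tau>) = \<rho> + (1 + 2 * s * a)"
      proof -
        have "\<rho> * \<tau> = 1 + 2 * s * a" unfolding \<tau>_def using \<rho> by simp
        then show ?thesis by (simp only: distrib_left mult_1_right)
      qed
      moreover have "(real_of_int s)\<^sup>2 = 1" using s by auto
      ultimately show ?thesis unfolding normsq_add_axis \<rho>_def a_def by simp
    qed
    then have "barrier (x + axis i s) = barrier x * (1 / sqrt (1 + \<tau>))"
      unfolding barrier_def by (simp add: real_sqrt_mult \<rho>_def)
    also have "\<dots> \<le> barrier x * (1 - \<tau> / 2 + 3 / 8 * \<tau>\<^sup>2 - 5 / 16 * \<tau> ^ 3 + \<tau> ^ 4)"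
      by (intro mult_left_mono inverse_sqrt_taylor[OF \<tau>]) (simp add: barrier_def)
    finally show ?thesis unfolding \<tau>_def .
  qed
  have "barrier (x + axis i 1) + barrier (x + axis i (-1))
    \<le> barrier x * ((1 - ((1 + 2 * a) / \<rho>) / 2
      + 3 / 8 * ((1 + 2 * a) / \<rho>)\<^sup>2 - 5 / 16 * ((1 + 2 * a) / \<rho>) ^ 3 + ((1 + 2 * a) / \<rho>) ^ 4)
     + (1 - ((1 - 2 * a) / \<rho>) / 2
      + 3 / 8 * ((1 - 2 * a) / \<rho>)\<^sup>2 - 5 / 16 * ((1 - 2 * a) / \<rho>) ^ 3 + ((1 - 2 * a) / \<rho>) ^ 4))"
    unfolding distrib_left[of "barrier x" "_ + _ ^ 4"] using add_mono[OF one[of 1] one[of "-1"]] by simp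
  also have "\<dots> = barrier x * (2 - 1 / \<rho> + (3/4 + 3 * a\<^sup>2) / \<rho>\<^sup>2 + (2 + 48 * a\<^sup>2 + 32 * a ^ 4) / \<rho> ^ 4
      - 5 / 16 * (2 + 24 * a\<^sup>2) / \<rho> ^ 3)"
  proof -
    have p2: "(1 + 2 * a)\<^sup>2 + (1 - 2 * a)\<^sup>2 = 2 + 8 * a\<^sup>2"
      and p3: "(1 + 2 * a) ^ 3 + (1 - 2 * a) ^ 3 = 2 + 24 * a\<^sup>2"
      and p4: "(1 + 2 * a) ^ 4 + (1 - 2 * a) ^ 4 = 2 + 48 * a\<^sup>2 + 32 * a ^ 4"
      by (simp_all add: eval_nat_numeral algebra_simps)
    have split: "(1 - (P / \<rho>) / 2 + 3 / 8 * (P / \<rho>)\<^sup>2 - 5 / 16 * (P / \<rho>) ^ 3 + (P / \<rho>) ^ 4)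
        + (1 - (Q / \<rho>) / 2 + 3 / 8 * (Q / \<rho>)\<^sup>2 - 5 / 16 * (Q / \<rho>) ^ 3 + (Q / \<rho>) ^ 4)
      = 2 - (P + Q) / 2 / \<rho> + 3/8 * ((P\<^sup>2 + Q\<^sup>2) / \<rho>\<^sup>2)
        - 5/16 * ((P ^ 3 + Q ^ 3) / \<rho> ^ 3) + (P ^ 4 + Q ^ 4) / \<rho> ^ 4" for P Q
      by (simp add: power_divide add_divide_distrib)
    have "(1 - ((1 + 2 * a) / \<rho>) / 2
      + 3 / 8 * ((1 + 2 * a) / \<rho>)\<^sup>2 - 5 / 16 * ((1 + 2 * a) / \<rho>) ^ 3 + ((1 + 2 * a) / \<rho>) ^ 4)
     + (1 - ((1 - 2 * a) / \<rho>) / 2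
      + 3 / 8 * ((1 - 2 * a) / \<rho>)\<^sup>2 - 5 / 16 * ((1 - 2 * a) / \<rho>) ^ 3 + ((1 - 2 * a) / \<rho>) ^ 4)
      = 2 - 1 / \<rho> + 3/8 * (((1 + 2 * a)\<^sup>2 + (1 - 2 * a)\<^sup>2) / \<rho>\<^sup>2)
        - 5/16 * (((1 + 2 * a) ^ 3 + (1 - 2 * a) ^ 3) / \<rho> ^ 3)
        + ((1 + 2 * a) ^ 4 + (1 - 2 * a) ^ 4) / \<rho> ^ 4"
      unfolding split by simp
    also have "\<dots> = 2 - 1 / \<rho> + (3/4 + 3 * a\<^sup>2) / \<rho>\<^sup>2 + (2 + 48 * a\<^sup>2 + 32 * a ^ 4) / \<rho> ^ 4
      - 5 / 16 * (2 + 24 * a\<^sup>2) / \<rho> ^ 3"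
      unfolding p2 p3 p4 by (simp add: add_divide_distrib distrib_left)
    finally show ?thesis by (simp only:)
  qed
  also have "\<dots> \<le> barrier x * (2 - 1 / \<rho> + (3/4 + 3 * a\<^sup>2) / \<rho>\<^sup>2 + (2 + 48 * a\<^sup>2 + 32 * a ^ 4) / \<rho> ^ 4)"
    using \<rho> by (intro mult_left_mono) (auto simp: barrier_def)
  finally show ?thesis .
qed

lemma barrier_superharmonic:
  assumes "3 \<le> CARD('d)"
  shows "step_mean barrier x \<le> barrier (x :: int ^ 'd)"
proof -
  define d where "d = real CARD('d)"
  define n where "n = normsq x"
  define \<rho> where "\<rho> = n + (d + 27)"
  let ?a = "\<lambda>i. real_of_int (x $ i)"
  have d: "3 \<le> d" using assms by (simp add: d_def)
  have n0: "0 \<le> n" by (simp add: n_def)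
  have \<rho>: "1 \<le> \<rho>" using d n0 by (simp add: \<rho>_def)
  have b0: "0 \<le> barrier x" by (simp add: barrier_def)
  have fourth: "(\<Sum>i\<in>UNIV. ?a i ^ 4) \<le> n\<^sup>2"
  proof -
    have "(\<Sum>i\<in>UNIV. ?a i ^ 4) \<le> (\<Sum>i\<in>UNIV. n * (?a i)\<^sup>2)"
    proof (rule sum_mono)
      fix i :: 'd
      have "(?a i)\<^sup>2 * (?a i)\<^sup>2 \<le> n * (?a i)\<^sup>2"
        unfolding n_def by (intro mult_right_mono coord_le_normsq) auto
      then show "?a i ^ 4 \<le> n * (?a i)\<^sup>2" by (simp add: eval_nat_numeral ac_simps)
    qed
    also have "\<dots> = n * n" by (simp add: sum_distrib_left[symmetric] n_def normsq_def)
    finally show ?thesis by (simp add: power2_eq_square)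
  qed
  have "(\<Sum>e\<in>unit_steps. barrier (x + e))
     = (\<Sum>i\<in>UNIV. barrier (x + axis i 1) + barrier (x + axis i (-1)))" by (rule sum_unit_steps)
  also have "\<dots> \<le> (\<Sum>i\<in>UNIV. barrier x * (2 - 1 / \<rho> + (3/4 + 3 * (?a i)\<^sup>2) / \<rho>\<^sup>2
      + (2 + 48 * (?a i)\<^sup>2 + 32 * ?a i ^ 4) / \<rho> ^ 4))"
    unfolding \<rho>_def n_def d_def by (intro sum_mono barrier_pair_bound)
  also have "\<dots> = barrier x * (2 * d - d / \<rho> + (3/4 * d + 3 * n) / \<rho>\<^sup>2
      + (2 * d + 48 * n + 32 * (\<Sum>i\<in>UNIV. ?a i ^ 4)) / \<rho> ^ 4)"
    unfolding n_def normsq_def d_def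
    by (simp add: sum_distrib_left[symmetric] sum.distrib sum_subtractf sum_divide_distrib[symmetric]
        right_diff_distrib mult.commute)
  also have "\<dots> \<le> barrier x * (2 * d)"
  proof (rule mult_left_mono[OF _ b0])
    let ?S = "\<Sum>i\<in>UNIV. ?a i ^ 4"
    have "2 * d + 48 * n + 32 * ?S \<le> (2 * d + 80) * \<rho>\<^sup>2"
    proof -
      have "1 \<le> \<rho>\<^sup>2" using \<rho> by (simp add: power2_eq_square mult_ge1_I)
      then have "2 * d * 1 \<le> 2 * d * \<rho>\<^sup>2" using d by (intro mult_left_mono) auto
      moreover have "n \<le> \<rho>\<^sup>2"
      proof -
        have "n \<le> \<rho>" using d by (simp add: \<rho>_def)
        also have "\<dots> \<le> \<rho>\<^sup>2" using \<rho> by (simp add: power2_eq_square)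
        finally show ?thesis .
      qed
      moreover have "n\<^sup>2 \<le> \<rho>\<^sup>2" using n0 d by (intro power_mono) (auto simp: \<rho>_def)
      ultimately show ?thesis using fourth by (simp add: distrib_right)
    qed
    then have "(2 * d + 48 * n + 32 * ?S) / \<rho> ^ 4 \<le> (2 * d + 80) * \<rho>\<^sup>2 / \<rho> ^ 4"
      using \<rho> by (intro divide_right_mono) auto
    also have "\<dots> = (2 * d + 80) / \<rho>\<^sup>2" using \<rho> by (simp add: eval_nat_numeral)
    finally have "2 * d - d / \<rho> + (3/4 * d + 3 * n) / \<rho>\<^sup>2 + (2 * d + 48 * n + 32 * ?S) / \<rho> ^ 4
        \<le> 2 * d - d * \<rho> / \<rho>\<^sup>2 + (3/4 * d + 3 * n) / \<rho>\<^sup>2 + (2 * d + 80) / \<rho>\<^sup>2"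
      using \<rho> by (simp add: power2_eq_square)
    also have "\<dots> = 2 * d + (3/4 * d + 3 * n + (2 * d + 80) - d * \<rho>) / \<rho>\<^sup>2"
      by (simp add: add_divide_distrib diff_divide_distrib)
    also have "\<dots> \<le> 2 * d"
    proof -
      \<comment> \<open>Dimension three and the constant of the barrier meet here:
        \<open>3 * (d + 27)\<close> is \<open>3 * d + 81\<close>, which outweighs the collected
        corrections \<open>3/4 * d + 2 * d + 80\<close>.\<close>
      have "3 * \<rho> \<le> d * \<rho>" using d \<rho> by (intro mult_right_mono) auto
      then have "3/4 * d + 3 * n + (2 * d + 80) - d * \<rho> \<le> 0"
        using d unfolding \<rho>_def distrib_left by argo
      then show ?thesis using \<rho> by (simp add: divide_nonpos_pos)
    qed
    finally show "2 * d - d / \<rho> + (3/4 * d + 3 * n) / \<rho>\<^sup>2 + (2 * d + 48 * n + 32 * ?S) / \<rho> ^ 4 \<le> 2 * d" .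
  qed
  finally show ?thesis
    unfolding step_mean_def card_unit_steps using d by (simp add: d_def divide_le_eq)
qed

lemma barrier_cube_ge:
  assumes "x \<in> cube L" "1 \<le> L"
  shows "1 \<le> sqrt (2 * real CARD('d) + 27) * real L * barrier (x :: int ^ 'd)"
proof -
  have "normsq x + (real CARD('d) + 27) \<le> (2 * real CARD('d) + 27) * (real L)\<^sup>2"
  proof -
    have "1\<^sup>2 \<le> (real L)\<^sup>2" using assms(2) by (intro power_mono) auto
    then have "(real CARD('d) + 27) * 1 \<le> (real CARD('d) + 27) * (real L)\<^sup>2"
      by (intro mult_left_mono) auto
    with normsq_le_cube[OF assms(1)] show ?thesis by (simp add: distrib_right)
  qed
  then have "sqrt (normsq x + (real CARD('d) + 27)) \<le> sqrt (2 * real CARD('d) + 27) * real L"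
    by (metis abs_of_nat real_sqrt_abs real_sqrt_le_iff real_sqrt_mult)
  moreover have "0 < sqrt (normsq x + (real CARD('d) + 27))"
    by (simp add: add_nonneg_pos)
  ultimately show ?thesis by (simp add: barrier_def)
qed

lemma barrier_le:
  fixes x :: "int ^ 'd"
  assumes "\<rho> \<le> \<bar>real_of_int (x $ i)\<bar>" "0 < \<rho>" shows "barrier x \<le> 1 / \<rho>"
proof -
  have "\<rho>\<^sup>2 \<le> (real_of_int (x $ i))\<^sup>2" using assms by (simp add: abs_le_square_iff[symmetric])
  also have "\<dots> \<le> normsq x + (real CARD('d) + 27)" using coord_le_normsq[of x i] by simp
  finally have le: "\<rho> \<le> sqrt (normsq x + (real CARD('d) + 27))" by (rule real_le_rsqrt)
  then have "0 < sqrt (normsq x + (real CARD('d) + 27)) * \<rho>"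
    using assms(2) by (intro mult_pos_pos) linarith+
  with le show ?thesis unfolding barrier_def by (intro divide_left_mono) auto
qed

section \<open>Maximum principle and Dirichlet problem\<close>

lemma finite_maximum_principle:
  fixes F :: "int ^ 'd \<Rightarrow> real"
  assumes "finite A" and sub: "\<And>x. x \<in> A \<Longrightarrow> F x \<le> step_mean F x"
    and bd: "\<And>x e. x \<in> A \<Longrightarrow> e \<in> unit_steps \<Longrightarrow> x + e \<notin> A \<Longrightarrow> F (x + e) \<le> 0"
    and "x \<in> A"
  shows "F x \<le> 0"
proof (rule ccontr)
  assume "\<not> F x \<le> 0"
  define m where "m = Max (F ` A)"
  have le: "F y \<le> m" if "y \<in> A" for y using that assms(1) by (simp add: m_def)
  have m: "0 < m" using le[OF \<open>x \<in> A\<close>] \<open>\<not> F x \<le> 0\<close> by simp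
  define S where "S = {y \<in> A. F y = m}"
  have "m \<in> F ` A" unfolding m_def using assms(1) \<open>x \<in> A\<close> by (intro Max_in) auto
  then have "S \<noteq> {}" by (auto simp: S_def)
  moreover have "finite S" using assms(1) by (simp add: S_def)
  ultimately have fin: "finite ((\<lambda>y. y $ i) ` S)" "(\<lambda>y. y $ i) ` S \<noteq> {}" for i by auto
  fix i :: 'd
  \<comment> \<open>Among the maximisers one with extremal \<open>i\<close>-th coordinate is chosen:
    its neighbour in direction \<open>i\<close> is not a maximiser, so the mean at \<open>z\<close>
    is strictly below the maximum.\<close>
  obtain z where z: "z \<in> S" and zi: "z $ i = Max ((\<lambda>y. y $ i) ` S)"
    using Max_in[OF fin] by (metis (no_types, lifting) imageE)
  have zA: "z \<in> A" "F z = m" using z by (auto simp: S_def)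
  have all: "F (z + e) \<le> m" if "e \<in> unit_steps" for e
    using bd[OF zA(1) that] le[of "z + e"] m by fastforce
  have "F (z + axis i 1) < m"
  proof (cases "z + axis i 1 \<in> A")
    case True
    have "(z + axis i 1) $ i \<le> Max ((\<lambda>y. y $ i) ` S)" if "z + axis i 1 \<in> S"
      using fin(1) that by (intro Max_ge imageI)
    then have "z + axis i 1 \<notin> S" using zi by (auto simp: axis_def)
    then show ?thesis using True le[OF True] by (auto simp: S_def)
  next
    case False
    then show ?thesis using bd[OF zA(1) _ False] m by simp
  qed
  then have "(\<Sum>e\<in>unit_steps. F (z + e)) < (\<Sum>e\<in>(unit_steps :: (int ^ 'd) set). m)"
    using all by (intro sum_strict_mono_ex1) (auto intro!: bexI[of _ "axis i 1"])
  then have "step_mean F z < m"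
    using card_unit_steps_pos[where 'd='d] by (simp add: step_mean_def divide_less_eq mult.commute)
  then show False using sub[OF zA(1)] zA(2) by simp
qed

lemma tendsto_step_mean:
  assumes "\<And>y. (\<lambda>n. f n y) \<longlonglongrightarrow> g y"
  shows "(\<lambda>n. step_mean (f n) x) \<longlonglongrightarrow> step_mean g x"
  unfolding step_mean_def using card_unit_steps_pos[where 'd='a]
  by (intro tendsto_divide tendsto_sum assms tendsto_const) auto

text \<open>Monotone iteration of the mean, started from zero on \<open>A\<close>. The limit is
  harmonic because a step mean is a finite sum, so pointwise convergence passes through it. This
  yields the comparison functions without a stochastic representation.\<close>

lemma dirichlet_problem:
  fixes g :: "int ^ 'd \<Rightarrow> real"
  assumes g: "\<And>x. 0 \<le> g x" "\<And>x. g x \<le> B"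
  obtains M where "\<And>x. 0 \<le> M x" "\<And>x. M x \<le> B" "\<And>x. x \<notin> A \<Longrightarrow> M x = g x"
    "\<And>x. x \<in> A \<Longrightarrow> step_mean M x = M x"
proof -
  define f where "f = rec_nat (\<lambda>x. if x \<in> A then 0 else g x)
     (\<lambda>_ h x. if x \<in> A then step_mean h x else g x)"
  have f0: "f 0 x = (if x \<in> A then 0 else g x)" for x by (simp add: f_def)
  have fS: "f (Suc n) x = (if x \<in> A then step_mean (f n) x else g x)" for n x by (simp add: f_def)
  have B: "0 \<le> B" using g[of undefined] by linarith
  have bounds: "0 \<le> f n x \<and> f n x \<le> B" for n x
  proof (induction n arbitrary: x)
    case 0 show ?case using g B by (simp add: f0)
  next
    case (Suc n)
    have "step_mean (f n) x \<le> step_mean (\<lambda>_. B) x" using Suc by (intro step_mean_mono) auto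
    then show ?case using Suc g by (auto simp: fS intro!: step_mean_nonneg)
  qed
  have inc: "f n x \<le> f (Suc n) x" for n x
  proof (induction n arbitrary: x)
    case 0 show ?case using bounds by (auto simp: f0 fS intro!: step_mean_nonneg)
  next
    case (Suc n) then show ?case by (auto simp: fS intro!: step_mean_mono)
  qed
  have "incseq (\<lambda>n. f n x)" for x using inc by (intro incseq_SucI)
  then have "\<exists>l. (\<lambda>n. f n x) \<longlonglongrightarrow> l" for x
    using incseq_convergent[of "\<lambda>n. f n x" B] bounds by metis
  then obtain M where M: "\<And>x. (\<lambda>n. f n x) \<longlonglongrightarrow> M x" by metis
  show ?thesis
  proof (rule that[of M])
    show "0 \<le> M x" for x using M[of x] bounds by (intro LIMSEQ_le_const) auto
    show "M x \<le> B" for x using M[of x] bounds by (intro LIMSEQ_le_const2) auto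
    show "M x = g x" if "x \<notin> A" for x
    proof -
      have "f n x = g x" for n using that by (cases n) (auto simp: f0 fS)
      then have "(\<lambda>n. f n x) \<longlonglongrightarrow> g x" by simp
      with M[of x] show ?thesis by (rule LIMSEQ_unique)
    qed
    show "step_mean M x = M x" if "x \<in> A" for x
    proof -
      have "(\<lambda>n. f (Suc n) x) \<longlonglongrightarrow> M x" using M[of x] by (rule LIMSEQ_Suc)
      moreover have "(\<lambda>n. f (Suc n) x) \<longlonglongrightarrow> step_mean M x"
        using that by (simp add: fS tendsto_step_mean[OF M])
      ultimately show ?thesis using LIMSEQ_unique by blast
    qed
  qed
qed

section \<open>Avoiding a cube: recursion, limit and lower bounds\<close>

definition hit_const :: "'d::finite itself \<Rightarrow> real" where
  "hit_const _ = sqrt (2 * real CARD('d) + 27)"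

text \<open>The probability of staying off the cube up to time \<open>n\<close>, given by its
  recursion; \<open>tprob_avoid\<close> identifies it with the walk. The estimates are thus
  inductions on \<open>n\<close>, independent of any measure.\<close>

primrec avoid :: "nat \<Rightarrow> nat \<Rightarrow> int ^ 'd \<Rightarrow> real" where
  "avoid L 0 x = (if x \<in> cube L then 0 else 1)"
| "avoid L (Suc n) x = (if x \<in> cube L then 0 else step_mean (avoid L n) x)"

definition escape :: "nat \<Rightarrow> int ^ 'd \<Rightarrow> real" where
  "escape L x = lim (\<lambda>n. avoid L n x)"

lemma avoid_bounds: "0 \<le> avoid L n x \<and> avoid L n x \<le> 1"
proof (induction n arbitrary: x)
  case (Suc n)
  have "step_mean (avoid L n) x \<le> step_mean (\<lambda>_. 1) x" using Suc by (intro step_mean_mono) auto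
  then show ?case using Suc by (auto intro: step_mean_nonneg)
qed simp

lemma avoid_antimono: "avoid L (Suc n) x \<le> avoid L n x"
proof (induction n arbitrary: x)
  case 0
  have "step_mean (avoid L 0) x \<le> step_mean (\<lambda>_. 1) x"
    using avoid_bounds[of L 0] by (intro step_mean_mono) auto
  then show ?case by simp
next
  case (Suc n)
  then show ?case by (auto intro!: step_mean_mono simp del: avoid.simps(2) simp: avoid.simps(2)[of L "Suc n"] avoid.simps(2)[of L n])
qed

lemma avoid_tendsto: "(\<lambda>n. avoid L n x) \<longlonglongrightarrow> escape L x"
proof -
  have "decseq (\<lambda>n. avoid L n x)" by (intro decseq_SucI avoid_antimono)
  then have "convergent (\<lambda>n. avoid L n x)"
    using decseq_convergent[of "\<lambda>n. avoid L n x" 0] avoid_bounds by (metis convergentI)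
  then show ?thesis by (simp add: escape_def convergent_LIMSEQ_iff)
qed

lemma escape_bounds: "0 \<le> escape L x" "escape L x \<le> 1"
  using avoid_bounds LIMSEQ_le_const[OF avoid_tendsto[of L x], of 0]
    LIMSEQ_le_const2[OF avoid_tendsto[of L x], of 1] by blast+

lemma escape_in_cube: "x \<in> cube L \<Longrightarrow> escape L x = 0"
proof -
  assume "x \<in> cube L"
  then have "avoid L n x = 0" for n by (cases n) auto
  then show ?thesis using avoid_tendsto[of L x] by (simp add: LIMSEQ_const_iff)
qed

lemma escape_harmonic:
  assumes "x \<notin> cube L" shows "step_mean (escape L) x = escape L x"
proof -
  have "(\<lambda>n. avoid L (Suc n) x) \<longlonglongrightarrow> step_mean (escape L) x"
    using assms by (simp add: tendsto_step_mean[OF avoid_tendsto])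
  moreover have "(\<lambda>n. avoid L (Suc n) x) \<longlonglongrightarrow> escape L x"
    by (rule LIMSEQ_Suc[OF avoid_tendsto])
  ultimately show ?thesis by (rule LIMSEQ_unique)
qed

text \<open>Induction on time in place of optional stopping: one minus a multiple of the barrier is
  subharmonic, and the multiple is chosen to make it nonpositive on the cube.\<close>

lemma avoid_ge_barrier:
  assumes "3 \<le> CARD('d)" "1 \<le> L"
  shows "1 - hit_const TYPE('d) * real L * barrier x \<le> avoid L n (x :: int ^ 'd)"
proof (induction n arbitrary: x)
  have cube: "1 - hit_const TYPE('d) * real L * barrier x \<le> 0" if "x \<in> cube L" for x :: "int ^ 'd"
    using barrier_cube_ge[OF that assms(2)] by (simp add: hit_const_def)
  have pos: "0 \<le> hit_const TYPE('d) * real L * barrier x" for x :: "int ^ 'd"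
    by (simp add: hit_const_def barrier_def)
  {
    case 0 show ?case using cube[of x] pos[of x] by auto
  next
    case (Suc n)
    let ?c = "hit_const TYPE('d) * real L"
    have c0: "0 \<le> ?c" by (simp add: hit_const_def)
    have "1 - ?c * barrier x \<le> 1 - ?c * step_mean barrier x"
      using mult_left_mono[OF barrier_superharmonic[OF assms(1)] c0] by simp
    also have "\<dots> = step_mean (\<lambda>y. 1 - ?c * barrier y) x"
      by (simp only: step_mean_diff step_mean_mult step_mean_const)
    also have "\<dots> \<le> step_mean (avoid L n) x" using Suc by (intro step_mean_mono)
    finally show ?case using cube[of x] by auto
  }
qed

lemma avoid_far:
  fixes x :: "int ^ 'd"
  assumes "3 \<le> CARD('d)" "1 \<le> L" "\<rho> \<le> \<bar>real_of_int (x $ i)\<bar>" "0 < \<rho>"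
  shows "1 - hit_const TYPE('d) * real L / \<rho> \<le> avoid L n x"
proof -
  have "hit_const TYPE('d) * real L * barrier x \<le> hit_const TYPE('d) * real L * (1 / \<rho>)"
    using barrier_le[OF assms(3,4)] by (intro mult_left_mono) (auto simp: hit_const_def)
  then show ?thesis using avoid_ge_barrier[OF assms(1,2), of x n] by simp
qed

lemma escape_far:
  fixes x :: "int ^ 'd"
  assumes "3 \<le> CARD('d)" "1 \<le> L" "\<rho> \<le> \<bar>real_of_int (x $ i)\<bar>" "0 < \<rho>"
  shows "1 - hit_const TYPE('d) * real L / \<rho> \<le> escape L x"
  using avoid_far[OF assms] avoid_tendsto[of L x] by (intro LIMSEQ_le_const) auto

text \<open>From a coordinate of absolute value \<open>m * L\<close> the cube is hit with
  probability at most \<open>hit_const / m\<close>, which is at most one half for this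
  \<open>m\<close>; the summand 2 keeps \<open>m - 1\<close> positive.\<close>

definition ruin_width :: "'d::finite itself \<Rightarrow> nat" where
  "ruin_width _ = nat \<lceil>2 * hit_const TYPE('d)\<rceil> + 2"

lemma ruin_width: "2 * hit_const TYPE('d::finite) \<le> real (ruin_width TYPE('d))" "2 \<le> ruin_width TYPE('d)"
  unfolding ruin_width_def by linarith+

lemma step_mean_coord: "step_mean (\<lambda>y. real_of_int (y $ i)) x = real_of_int (x $ i)"
proof -
  have "(\<Sum>e\<in>unit_steps. real_of_int ((x + e) $ i))
      = (\<Sum>j\<in>UNIV. real_of_int ((x + axis j 1) $ i) + real_of_int ((x + axis j (-1)) $ i))"
    by (rule sum_unit_steps)
  also have "\<dots> = (\<Sum>j\<in>(UNIV :: 'a set). 2 * real_of_int (x $ i))"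
    by (intro sum.cong refl) (simp add: axis_def)
  finally show ?thesis by (simp add: step_mean_def card_unit_steps)
qed

text \<open>Gambler's ruin in one coordinate: the walk starting next to a face of the cube gets to
  distance of order \<open>L\<close> with probability of order \<open>1/L\<close>, and from there it escapes with
  probability at least one half.\<close>

lemma avoid_ge_linear:
  fixes x :: "int ^ 'd" and s :: int
  assumes "3 \<le> CARD('d)" "1 \<le> L" and s: "s = 1 \<or> s = -1"
  defines "m \<equiv> ruin_width TYPE('d)"
  shows "min (1/2) ((real_of_int (s * x $ i) - real L) / (2 * (real m - 1) * real L)) \<le> avoid L n x"
proof (induction n arbitrary: x)
  have m: "2 \<le> real m" "2 * hit_const TYPE('d) \<le> real m"
    using ruin_width[where 'd='d] unfolding m_def by auto
  have L: "1 \<le> real L" using assms(2) by simp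
  define lin where "lin x = (real_of_int (s * x $ i) - real L) / (2 * (real m - 1) * real L)" for x :: "int ^ 'd"
  have den: "0 < 2 * (real m - 1) * real L" using m L by simp
  have abs_s: "\<bar>s * t\<bar> = \<bar>t\<bar>" for t using s by auto
  have cube: "min (1/2) (lin x) \<le> 0" if "x \<in> cube L" for x
  proof -
    have "\<bar>s * x $ i\<bar> \<le> int L" using that unfolding abs_s mem_cube by blast
    then have "real_of_int (s * x $ i) \<le> real L" by linarith
    then have "lin x \<le> 0" unfolding lin_def using den by (intro divide_nonpos_pos) auto
    then show ?thesis by simp
  qed
  have far: "1/2 \<le> avoid L n x" if "int (m * L) \<le> s * x $ i" for n x
  proof -
    have "int (m * L) \<le> \<bar>x $ i\<bar>" using that abs_s[of "x $ i"] by linarith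
    then have "real (m * L) \<le> \<bar>real_of_int (x $ i)\<bar>" by linarith
    moreover have "0 < real (m * L)" using m L by simp
    ultimately have "1 - hit_const TYPE('d) * real L / real (m * L) \<le> avoid L n x"
      by (rule avoid_far[OF assms(1,2)])
    moreover have "hit_const TYPE('d) * real L / real (m * L) \<le> 1/2"
      using m L by (simp add: divide_le_eq)
    ultimately show ?thesis by linarith
  qed
  have mean: "step_mean lin x = lin x" for x
  proof -
    have eq: "lin = (\<lambda>y. (real_of_int s / (2 * (real m - 1) * real L)) * real_of_int (y $ i)
       - real L / (2 * (real m - 1) * real L))"
      by (auto simp: lin_def diff_divide_distrib)
    show ?thesis unfolding eq step_mean_diff step_mean_mult step_mean_coord step_mean_const ..
  qed
  {
    case 0
    show ?case using cube[of x] unfolding lin_def[symmetric] by auto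
  next
    case (Suc n)
    have "min (1/2) (lin x) \<le> avoid L (Suc n) x"
    proof (cases "x \<in> cube L")
      case True then show ?thesis using cube by simp
    next
      case out: False
      consider "int (m * L) \<le> s * x $ i" | "s * x $ i \<le> int L" | "int L < s * x $ i" "s * x $ i < int (m * L)"
        by linarith
      then show ?thesis
      proof cases
        case 1 then show ?thesis using far[of x "Suc n"] by linarith
      next
        case 2
        then have "real_of_int (s * x $ i) \<le> real L" by linarith
        then have "lin x \<le> 0" unfolding lin_def using den by (intro divide_nonpos_pos) auto
        then show ?thesis using avoid_bounds[of L "Suc n" x] by linarith
      next
        case 3
        \<comment> \<open>Strictly inside the strip no step passes \<open>m * L\<close>, where
          \<open>lin\<close> equals one half. So at all neighbours the minimum in the induction
          hypothesis is \<open>lin\<close> itself.\<close>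
        have "lin x = step_mean lin x" by (simp add: mean)
        also have "\<dots> \<le> step_mean (avoid L n) x"
        proof (rule step_mean_mono)
          fix e :: "int ^ 'd" assume e: "e \<in> unit_steps"
          have "\<bar>e $ i\<bar> \<le> 1" using unit_step_in_cube[OF e] by (simp add: mem_cube)
          then have "s * (x + e) $ i \<le> int (m * L)"
            using 3 s by (auto simp: distrib_left)
          then have "real_of_int (s * (x + e) $ i) \<le> real m * real L"
            by (metis of_int_le_iff of_int_of_nat_eq of_nat_mult)
          then have "lin (x + e) \<le> 1/2" unfolding lin_def
            using den by (simp add: divide_le_eq algebra_simps)
          then show "lin (x + e) \<le> avoid L n (x + e)"
            using Suc[of "x + e"] unfolding lin_def by linarith
        qed
        finally show ?thesis using out by simp
      qed
    qed
    then show ?case unfolding lin_def .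
  }
qed

definition escape_const :: "'d::finite itself \<Rightarrow> real" where
  "escape_const _ = 1 / (valency TYPE('d) * (2 * (real (ruin_width TYPE('d)) - 1)))"

lemma escape_const_pos: "0 < escape_const TYPE('d::finite)"
  using ruin_width[where 'd='d] card_unit_steps_pos[where 'd='d] by (simp add: escape_const_def)

text \<open>One of the steps leaves through the face and reaches height \<open>L + 1\<close>, where
  the linear bound is of order 1/L. This lower bound turns additive errors of order L/r into
  relative ones of order L^2/r.\<close>

lemma mean_escape_lower:
  fixes a :: "int ^ 'd"
  assumes "3 \<le> CARD('d)" "1 \<le> L" "\<bar>a $ i\<bar> = int L"
  shows "escape_const TYPE('d) / real L \<le> step_mean (escape L) a"
proof -
  define m where "m = ruin_width TYPE('d)"
  define s :: int where "s = (if 0 \<le> a $ i then 1 else -1)"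
  have s: "s = 1 \<or> s = -1" by (simp add: s_def)
  let ?x = "a + axis i s"
  have m: "2 \<le> real m" using ruin_width[where 'd='d] unfolding m_def by simp
  have L: "1 \<le> real L" using assms(2) by simp
  have "s * ?x $ i = int L + 1" using assms(3) by (auto simp: s_def axis_def)
  then have l: "(real_of_int (s * ?x $ i) - real L) / (2 * (real m - 1) * real L) = 1 / (2 * (real m - 1) * real L)"
    by simp
  have "1 * 1 \<le> (real m - 1) * real L" using m L by (intro mult_mono) auto
  then have half: "1 / (2 * (real m - 1) * real L) \<le> 1/2"
    by (simp add: divide_le_eq mult.assoc del: right_diff_distrib_numeral)
  have "1 / (2 * (real m - 1) * real L) \<le> avoid L n ?x" for n
    using avoid_ge_linear[OF assms(1,2) s, of ?x i n] unfolding m_def[symmetric] l using half by simp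
  then have "1 / (2 * (real m - 1) * real L) \<le> escape L ?x"
    using avoid_tendsto[of L ?x] by (intro LIMSEQ_le_const) auto
  then have "1 / (2 * (real m - 1) * real L) / valency TYPE('d) \<le> escape L ?x / valency TYPE('d)"
    by (rule divide_right_mono) simp
  also have "\<dots> \<le> step_mean (escape L) a"
    using s by (intro le_step_mean escape_bounds) auto
  finally show ?thesis by (simp add: escape_const_def m_def ac_simps)
qed

lemma mean_escape_bounds: "0 \<le> step_mean (escape L) a" "step_mean (escape L) a \<le> 1"
proof -
  show "0 \<le> step_mean (escape L) a" by (intro step_mean_nonneg escape_bounds)
  have "step_mean (escape L) a \<le> step_mean (\<lambda>_. 1) a" by (intro step_mean_mono escape_bounds)
  then show "step_mean (escape L) a \<le> 1" by simp
qed

text \<open>The additive error of the comparison below in units of L/r: twice the oscillation of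
  \<open>M\<close> on the small cube, plus the probability of hitting that cube from outside the
  large one.\<close>

definition exit_const :: "'d::finite itself \<Rightarrow> real" where
  "exit_const _ = 2 * cube_harnack_const TYPE('d) + hit_const TYPE('d)"

text \<open>A function vanishing on the small cube and harmonic up to the boundary of the large one is
  compared with the harmonic function \<open>M\<close> that has the same exterior values: \<open>M - k\<close> is then
  \<open>M\<close> averaged over the entrance point of the small cube, where \<open>M\<close> is almost constant.\<close>

lemma mean_near_cube:
  fixes k M :: "int ^ 'd \<Rightarrow> real"
  defines "c \<equiv> cube_harnack_const TYPE('d)"
  assumes d: "3 \<le> CARD('d)" and L: "1 \<le> L" and r: "c * real L \<le> real r"
    and k0: "\<And>x. x \<in> cube L \<Longrightarrow> k x = 0"
    and kh: "\<And>x. x \<in> cube r \<Longrightarrow> x \<notin> cube L \<Longrightarrow> step_mean k x = k x"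
    and M0: "\<And>x. 0 \<le> M x"
    and Mh: "\<And>x. x \<in> cube r \<Longrightarrow> step_mean M x = M x"
    and kM: "\<And>x. x \<in> cube (Suc r) \<Longrightarrow> x \<notin> cube r \<Longrightarrow> k x = M x"
    and a: "a \<in> cube L"
  shows "(1 - c * real L / real r) * M 0 \<le> M a"
    and "step_mean k a \<le> M 0 * (step_mean (escape L) a + exit_const TYPE('d) * real L / real r)"
    and "M 0 * (step_mean (escape L) a - exit_const TYPE('d) * real L / real r) \<le> step_mean k a"
proof -
  define \<eta> where "\<eta> = c * real L / real r"
  define \<theta> where "\<theta> = hit_const TYPE('d) * real L / real r"
  have c8: "8 \<le> c" unfolding c_def by (rule cube_harnack_const_ge)
  have L1: "1 \<le> real L" using L by simp
  have "8 * real L \<le> c * real L" using c8 by (intro mult_right_mono) auto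
  then have rL: "8 * real L \<le> real r" using r by linarith
  then have r0: "8 \<le> real r" using L1 by linarith
  have Lr: "Suc L \<le> r" using rL L by linarith
  have \<eta>: "0 \<le> \<eta>" "\<eta> \<le> 1" unfolding \<eta>_def using c8 r r0 by (auto simp: divide_le_eq)
  have \<theta>0: "0 \<le> \<theta>" unfolding \<theta>_def hit_const_def by simp
  have har: "M y \<le> (1 + \<eta>) * M x" if "x \<in> cube L" "y \<in> cube L" for x y
    using cube_harnack[OF M0 Mh L r[unfolded c_def] that] unfolding \<eta>_def c_def .
  have up: "M x \<le> (1 + \<eta>) * M 0" if "x \<in> cube L" for x using har[OF _ that, of 0] by simp
  have low: "(1 - \<eta>) * M 0 \<le> M x" if x: "x \<in> cube L" for x
  proof -
    have "(1 - \<eta>) * M 0 \<le> (1 - \<eta>) * ((1 + \<eta>) * M x)"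
      using har[OF x, of 0] \<eta> by (intro mult_left_mono) auto
    also have "\<dots> = (1 - \<eta>\<^sup>2) * M x" by (simp add: power2_eq_square algebra_simps)
    also have "\<dots> \<le> 1 * M x" using M0[of x] by (intro mult_right_mono) auto
    finally show ?thesis by simp
  qed
  show "(1 - c * real L / real r) * M 0 \<le> M a" using low[OF a] unfolding \<eta>_def .
  define A where "A = cube r - (cube L :: (int ^ 'd) set)"
  \<comment> \<open>\<open>\<nu>\<close> stands for the probability of reaching the small cube
    before leaving the large one.\<close>
  obtain \<nu> where \<nu>: "\<And>x. 0 \<le> \<nu> x" "\<And>x. \<nu> x \<le> 1"
      "\<And>x. x \<notin> A \<Longrightarrow> \<nu> x = (if x \<in> cube L then 1 else 0)"
      "\<And>x. x \<in> A \<Longrightarrow> step_mean \<nu> x = \<nu> x"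
    by (rule dirichlet_problem[of "\<lambda>x. if x \<in> cube L then 1 else 0" 1 A]) auto
  have esc0: "escape L x = 0" if "x \<in> cube L" for x :: "int ^ 'd" using that by (rule escape_in_cube)
  have escb: "0 \<le> escape L x" "escape L x \<le> 1" for x :: "int ^ 'd" by (rule escape_bounds)+
  have finA: "finite A" by (simp add: A_def)
  have shell: "x + e \<in> cube L \<or> (x + e \<in> cube (Suc r) \<and> x + e \<notin> cube r)"
    if "x \<in> A" "e \<in> unit_steps" "x + e \<notin> A" for x e
    using that cube_step[of x r e] by (auto simp: A_def)
  have cmp: "F x \<le> 0" if sub: "\<And>x. x \<in> A \<Longrightarrow> F x \<le> step_mean F x"
      and in_L: "\<And>x. x \<in> cube L \<Longrightarrow> F x \<le> 0"
      and out: "\<And>x. x \<in> cube (Suc r) \<Longrightarrow> x \<notin> cube r \<Longrightarrow> F x \<le> 0"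
      and x: "x \<in> cube r" for F :: "int ^ 'd \<Rightarrow> real" and x
  proof (cases "x \<in> A")
    case True
    show ?thesis
    proof (rule finite_maximum_principle[OF finA sub _ True])
      fix y e assume "y \<in> A" "e \<in> unit_steps" "y + e \<notin> A"
      then have "y + e \<in> cube L \<or> (y + e \<in> cube (Suc r) \<and> y + e \<notin> cube r)" by (rule shell)
      then show "F (y + e) \<le> 0" using in_L out by auto
    qed
  next
    case False then show ?thesis using x in_L by (auto simp: A_def)
  qed
  have L_in_r: "x \<in> cube L \<Longrightarrow> x \<notin> cube r \<Longrightarrow> False" for x
    using cube_mono[of L r x] Lr by auto
  have nb: "a + e \<in> cube r" if "e \<in> unit_steps" for e
    using cube_mono[OF Lr cube_step[OF a that]] .
  have \<nu>_shell: "\<nu> x = 0" if "x \<in> cube (Suc r)" "x \<notin> cube r" for x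
    using that L_in_r by (subst \<nu>(3)) (auto simp: A_def)
  have \<nu>_L: "\<nu> x = 1" if "x \<in> cube L" for x using that by (subst \<nu>(3)) (auto simp: A_def)
  \<comment> \<open>\<open>M - k\<close> is harmonic between the cubes, vanishes just outside the
    large one and equals \<open>M\<close> on the small one, where \<open>M\<close> is within a
    factor \<open>1 \<plusminus> \<eta>\<close> of \<open>M 0\<close>. The maximum principle pinches
    it between two multiples of \<open>\<nu>\<close>.\<close>
  have N_le: "M x - k x - (1 + \<eta>) * M 0 * \<nu> x \<le> 0" if "x \<in> cube r" for x
  proof (rule cmp[OF _ _ _ that])
    fix x assume "x \<in> A"
    then show "M x - k x - (1 + \<eta>) * M 0 * \<nu> x \<le> step_mean (\<lambda>x. M x - k x - (1 + \<eta>) * M 0 * \<nu> x) x"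
      unfolding step_mean_diff step_mean_mult using \<nu>(4) Mh kh by (simp add: A_def)
  qed (use up k0 \<nu>_L kM \<nu>_shell in auto)
  have N_ge: "(1 - \<eta>) * M 0 * \<nu> x - (M x - k x) \<le> 0" if "x \<in> cube r" for x
  proof (rule cmp[OF _ _ _ that])
    fix x assume "x \<in> A"
    then show "(1 - \<eta>) * M 0 * \<nu> x - (M x - k x) \<le> step_mean (\<lambda>x. (1 - \<eta>) * M 0 * \<nu> x - (M x - k x)) x"
      unfolding step_mean_diff step_mean_mult using \<nu>(4) Mh kh by (simp add: A_def)
  qed (use low k0 \<nu>_L kM \<nu>_shell in auto)
  \<comment> \<open>\<open>\<nu>\<close> differs from the hitting probability
    \<open>1 - escape L\<close> of the unrestricted walk only by returns after leaving the large
    cube, which have probability at most \<theta>.\<close>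
  have \<nu>_le: "\<nu> x - (1 - escape L x) \<le> 0" if "x \<in> cube r" for x
  proof (rule cmp[OF _ _ _ that])
    fix x assume "x \<in> A"
    then show "\<nu> x - (1 - escape L x) \<le> step_mean (\<lambda>x. \<nu> x - (1 - escape L x)) x"
      unfolding step_mean_diff step_mean_const using \<nu>(4)[of x] escape_harmonic[of x L] by (simp add: A_def)
  qed (use \<nu>_L esc0 \<nu>_shell escb in auto)
  have \<nu>_ge: "1 - escape L x - \<theta> - \<nu> x \<le> 0" if "x \<in> cube r" for x
  proof (rule cmp[OF _ _ _ that])
    fix x assume "x \<in> A"
    then show "1 - escape L x - \<theta> - \<nu> x \<le> step_mean (\<lambda>x. 1 - escape L x - \<theta> - \<nu> x) x"
      unfolding step_mean_diff step_mean_const using \<nu>(4)[of x] escape_harmonic[of x L] by (simp add: A_def)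
  next
    fix x :: "int ^ 'd" assume "x \<in> cube (Suc r)" and out: "x \<notin> cube r"
    from out obtain i where "int r < \<bar>x $ i\<bar>" by (auto simp: mem_cube not_le)
    then have "real r \<le> \<bar>real_of_int (x $ i)\<bar>" by linarith
    then have "1 - \<theta> \<le> escape L x" unfolding \<theta>_def using r0 by (intro escape_far[OF d L]) auto
    then show "1 - escape L x - \<theta> - \<nu> x \<le> 0" using \<nu>(1)[of x] by linarith
  qed (use \<nu>_L esc0 \<theta>0 in auto)
  let ?b = "step_mean (escape L) a"
  have mk: "step_mean k a = M a - step_mean (\<lambda>x. M x - k x) a"
    using Mh[of a] a Lr cube_mono[of L r a] by (simp add: step_mean_diff)
  have m\<nu>_le: "step_mean \<nu> a \<le> 1 - ?b"
  proof -
    have "step_mean \<nu> a \<le> step_mean (\<lambda>x. 1 - escape L x) a"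
      using \<nu>_le nb by (intro step_mean_mono) (simp add: algebra_simps)
    then show ?thesis by (simp add: step_mean_diff)
  qed
  have m\<nu>_ge: "1 - ?b - \<theta> \<le> step_mean \<nu> a"
  proof -
    have "step_mean (\<lambda>x. 1 - escape L x - \<theta>) a \<le> step_mean \<nu> a"
      using \<nu>_ge nb by (intro step_mean_mono) (simp add: algebra_simps)
    then show ?thesis by (simp add: step_mean_diff)
  qed
  have mN_le: "step_mean (\<lambda>x. M x - k x) a \<le> (1 + \<eta>) * M 0 * step_mean \<nu> a"
    unfolding step_mean_mult[symmetric] using N_le nb by (intro step_mean_mono) (simp add: algebra_simps)
  have mN_ge: "(1 - \<eta>) * M 0 * step_mean \<nu> a \<le> step_mean (\<lambda>x. M x - k x) a"
    unfolding step_mean_mult[symmetric] using N_ge nb by (intro step_mean_mono) (simp add: algebra_simps)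
  have b: "0 \<le> ?b" "?b \<le> 1" by (rule mean_escape_bounds)+
  have ec: "exit_const TYPE('d) * real L / real r = 2 * \<eta> + \<theta>"
    unfolding exit_const_def \<eta>_def \<theta>_def c_def by (simp add: add_divide_distrib distrib_right)
  have "step_mean k a \<le> (1 + \<eta>) * M 0 - (1 - \<eta>) * M 0 * (1 - ?b - \<theta>)"
  proof -
    have "(1 - \<eta>) * M 0 * (1 - ?b - \<theta>) \<le> (1 - \<eta>) * M 0 * step_mean \<nu> a"
      using m\<nu>_ge \<eta> M0[of 0] by (intro mult_left_mono) auto
    then show ?thesis using mk up[OF a] mN_ge by linarith
  qed
  also have "\<dots> = M 0 * (2 * \<eta> + (1 - \<eta>) * (?b + \<theta>))" by (simp add: algebra_simps)
  also have "\<dots> \<le> M 0 * (?b + (2 * \<eta> + \<theta>))"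
  proof (intro mult_left_mono M0)
    have "(1 - \<eta>) * (?b + \<theta>) \<le> 1 * (?b + \<theta>)" using b \<theta>0 \<eta> by (intro mult_right_mono) auto
    from add_left_mono[OF this, of "2 * \<eta>"]
    show "2 * \<eta> + (1 - \<eta>) * (?b + \<theta>) \<le> ?b + (2 * \<eta> + \<theta>)" by (simp only: ac_simps mult_1)
  qed
  finally show "step_mean k a \<le> M 0 * (?b + exit_const TYPE('d) * real L / real r)" unfolding ec .
  have "M 0 * (?b - (2 * \<eta> + \<theta>)) \<le> M 0 * (?b - 2 * \<eta> + \<eta> * ?b)"
  proof (intro mult_left_mono M0)
    have "0 \<le> \<eta> * ?b" using \<eta> b by simp
    then show "?b - (2 * \<eta> + \<theta>) \<le> ?b - 2 * \<eta> + \<eta> * ?b" using \<theta>0 by linarith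
  qed
  also have "\<dots> = (1 - \<eta>) * M 0 - (1 + \<eta>) * M 0 * (1 - ?b)" by (simp add: algebra_simps)
  also have "\<dots> \<le> step_mean k a"
  proof -
    have "(1 + \<eta>) * M 0 * step_mean \<nu> a \<le> (1 + \<eta>) * M 0 * (1 - ?b)"
      using m\<nu>_le \<eta> M0[of 0] by (intro mult_left_mono) auto
    then show ?thesis using mk low[OF a] mN_le by linarith
  qed
  finally show "M 0 * (?b - exit_const TYPE('d) * real L / real r) \<le> step_mean k a" unfolding ec .
qed

section \<open>Geometry of the torus\<close>

lemma wrap_eq_iff: "wrap N y = wrap N z \<longleftrightarrow> (\<forall>i. int N dvd y $ i - z $ i)"
  by (auto simp: wrap_def vec_eq_iff mod_eq_dvd_iff)

lemma wrap_zero [simp]: "wrap 0 z = z"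
  by (simp add: wrap_def vec_eq_iff)

lemma wrap_idem [simp]: "wrap N (wrap N z) = wrap N z"
  by (simp add: wrap_def vec_eq_iff)

lemma wrap_add_cong:
  assumes "wrap N y = wrap N y'" "wrap N z = wrap N z'"
  shows "wrap N (y + z) = wrap N (y' + z')"
  unfolding wrap_eq_iff
proof
  fix i
  have "int N dvd (y $ i - y' $ i) + (z $ i - z' $ i)"
    using assms unfolding wrap_eq_iff by (intro dvd_add) auto
  then show "int N dvd (y + z) $ i - (y' + z') $ i" by (simp add: algebra_simps)
qed

lemma wrap_diff_cong:
  assumes "wrap N y = wrap N y'" "wrap N z = wrap N z'"
  shows "wrap N (y - z) = wrap N (y' - z')"
  unfolding wrap_eq_iff
proof
  fix i
  have "int N dvd (y $ i - y' $ i) - (z $ i - z' $ i)"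
    using assms unfolding wrap_eq_iff by (blast intro: dvd_diff)
  then show "int N dvd (y - z) $ i - (y' - z') $ i" by (simp add: algebra_simps)
qed

lemma wrap_add_left_iff: "wrap N (x + y) = wrap N (x + z) \<longleftrightarrow> wrap N y = wrap N z"
  by (simp add: wrap_eq_iff)

lemma wrap_in_torus: "1 \<le> N \<Longrightarrow> wrap N z \<in> torus N"
  by (simp add: wrap_def torus_def)

lemma wrap_torus: "z \<in> torus N \<Longrightarrow> wrap N z = z"
  by (simp add: wrap_def torus_def vec_eq_iff)

lemma wrap_inj_cube:
  assumes "y \<in> cube \<rho>" "z \<in> cube \<sigma>" "\<rho> + \<sigma> < N" "wrap N y = wrap N z"
  shows "y = z"
proof (rule vec_eq_iff[THEN iffD2], rule allI)
  fix i
  have "\<bar>y $ i\<bar> \<le> int \<rho>" "\<bar>z $ i\<bar> \<le> int \<sigma>" using assms(1,2) by (auto simp: mem_cube)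
  then have "\<bar>y $ i - z $ i\<bar> < int N" using assms(3) by linarith
  moreover have "int N dvd y $ i - z $ i" using assms(4) by (simp add: wrap_eq_iff)
  ultimately have "y $ i - z $ i = 0" using dvd_imp_le_int[of "y $ i - z $ i" "int N"] by linarith
  then show "y $ i = z $ i" by simp
qed

lemma lift_wrap:
  assumes "z \<in> cube r" "2 * r < N" shows "lift N r (wrap N z) = z"
  unfolding lift_def
proof (rule the_equality)
  fix y assume "y \<in> cube r \<and> wrap N y = wrap N z"
  then show "y = z" using wrap_inj_cube[of y r z r N] assms by simp
qed (use assms in simp)

text \<open>Torus balls are handled through their periodic preimages in the lattice. Arbitrary
  representatives are allowed, so translations and the triangle inequality are those of Z^d.\<close>

definition near :: "nat \<Rightarrow> int ^ 'd \<Rightarrow> nat \<Rightarrow> int ^ 'd \<Rightarrow> bool" where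
  "near N x \<rho> y \<longleftrightarrow> (\<exists>z\<in>cube \<rho>. wrap N (x + z) = wrap N y)"

lemma near_cong: "wrap N y = wrap N y' \<Longrightarrow> near N x \<rho> y = near N x \<rho> y'"
  by (simp add: near_def)

lemma near_sym: "near N x \<rho> y \<longleftrightarrow> near N y \<rho> x"
proof -
  have "near N y \<rho> x" if "near N x \<rho> y" for x y :: "int ^ 'a"
  proof -
    from that obtain z where z: "z \<in> cube \<rho>" "wrap N (x + z) = wrap N y" by (auto simp: near_def)
    have "wrap N (y + - z) = wrap N (x + z + - z)"
      using z(2) by (intro wrap_add_cong) auto
    then show ?thesis using z(1) unfolding near_def by (intro bexI[of _ "- z"]) auto
  qed
  then show ?thesis by blast
qed

lemma near_trans:
  assumes "near N x \<rho> y" "near N y \<sigma> z" shows "near N x (\<rho> + \<sigma>) z"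
proof -
  obtain a where a: "a \<in> cube \<rho>" "wrap N (x + a) = wrap N y" using assms(1) by (auto simp: near_def)
  obtain b where b: "b \<in> cube \<sigma>" "wrap N (y + b) = wrap N z" using assms(2) by (auto simp: near_def)
  have "wrap N (x + a + b) = wrap N (y + b)" using a(2) by (intro wrap_add_cong) auto
  then show ?thesis unfolding near_def using cube_add[OF a(1) b(1)] b(2)
    by (intro bexI[of _ "a + b"]) (auto simp: add.assoc)
qed

lemma near_mono: "\<rho> \<le> \<sigma> \<Longrightarrow> near N x \<rho> y \<Longrightarrow> near N x \<sigma> y"
  unfolding near_def using cube_mono by blast

lemma near_add: "z \<in> cube \<rho> \<Longrightarrow> near N x \<rho> (x + z)"
  by (auto simp: near_def)

lemma near_step: "e \<in> unit_steps \<Longrightarrow> near N x 1 (x + e)"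
  by (intro near_add unit_step_in_cube)

text \<open>The bound on \<open>N\<close> excludes wrap-around: two points of cubes with radii
  \<open>\<rho>\<close> and \<open>\<sigma>\<close> that agree modulo \<open>N\<close> are
  equal.\<close>

lemma near_add_iff:
  assumes "z \<in> cube \<sigma>" "\<rho> + \<sigma> < N"
  shows "near N x \<rho> (x + z) \<longleftrightarrow> z \<in> cube \<rho>"
proof
  assume "near N x \<rho> (x + z)"
  then obtain y where y: "y \<in> cube \<rho>" "wrap N y = wrap N z"
    by (auto simp: near_def wrap_add_left_iff)
  then show "z \<in> cube \<rho>" using wrap_inj_cube[OF y(1) assms(1,2) y(2)] by simp
qed (rule near_add)

lemma distinf_nonneg: "0 \<le> distinf x y"
  by (simp add: infnorm_pos_le)

text \<open>Torus distances are infima, so a representative is found only up to a positive excess.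
  Integrality absorbs any excess below one, and attainment need not be discussed.\<close>

lemma distinf_less_imp:
  assumes "distinf x y < real \<rho> + 1" shows "x - y \<in> cube \<rho>"
  unfolding mem_cube
proof
  fix i
  have "\<bar>real_of_int (x $ i - y $ i)\<bar> \<le> distinf x y"
    using component_le_infnorm_cart[of "\<chi> i. real_of_int (x $ i - y $ i)" i] by simp
  then have "\<bar>real_of_int (x $ i - y $ i)\<bar> < real \<rho> + 1" using assms by linarith
  then show "\<bar>(x - y) $ i\<bar> \<le> int \<rho>" unfolding vector_minus_component by linarith
qed

lemma torus_distinf_le_iff: "torus_distinf N y x \<le> real \<rho> \<longleftrightarrow> near N x \<rho> y"
proof
  let ?S = "{z. wrap N z = wrap N y}"
  have bdd: "bdd_below ((\<lambda>z. distinf z x) ` ?S)"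
    using distinf_nonneg by (intro bdd_belowI2[of _ 0])
  {
    assume "torus_distinf N y x \<le> real \<rho>"
    then have "torus_distinf N y x < real \<rho> + 1" by simp
    then obtain z where z: "wrap N z = wrap N y" "distinf z x < real \<rho> + 1"
      unfolding torus_distinf_def using cINF_less_iff[OF _ bdd] by blast
    then show "near N x \<rho> y"
      unfolding near_def using distinf_less_imp[OF z(2)] by (intro bexI[of _ "z - x"]) auto
  next
    assume "near N x \<rho> y"
    then obtain z where z: "z \<in> cube \<rho>" "wrap N (x + z) = wrap N y" by (auto simp: near_def)
    then have "torus_distinf N y x \<le> distinf (x + z) x"
      unfolding torus_distinf_def by (intro cINF_lower bdd) auto
    also have "\<dots> \<le> real \<rho>" using z(1) by (subst distinf_le_iff) simp
    finally show "torus_distinf N y x \<le> real \<rho>" .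
  }
qed

lemma mem_torus_ball: "y \<in> torus_ball N x \<rho> \<longleftrightarrow> y \<in> torus N \<and> near N x \<rho> y"
  by (simp add: torus_ball_def torus_distinf_le_iff)

lemma wrap_mem_torus_ball: "1 \<le> N \<Longrightarrow> wrap N y \<in> torus_ball N x \<rho> \<longleftrightarrow> near N x \<rho> y"
  by (simp add: mem_torus_ball wrap_in_torus near_cong[of N "wrap N y" y])

lemma not_near_of_torus_distinf:
  assumes "real \<rho> < torus_distinf N x y" shows "\<not> near N y \<rho> x"
  using assms torus_distinf_le_iff[of N x y \<rho>] by auto

lemma dist2_eq: "dist2 x y = sqrt (normsq (x - y))"
  by (simp add: norm_vec_def L2_set_def normsq_def)

lemma normsq_less_two:
  assumes "normsq v < 2" shows "v = 0 \<or> v \<in> unit_steps"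
proof (cases "v = 0")
  case False
  then obtain i where i: "v $ i \<noteq> 0" by (auto simp: vec_eq_iff)
  have one: "1 \<le> (real_of_int t)\<^sup>2" if "t \<noteq> 0" for t :: int
  proof -
    have "1 \<le> \<bar>real_of_int t\<bar>" using that by linarith
    from power_mono[OF this, of 2] show ?thesis by simp
  qed
  have split: "normsq v = (real_of_int (v $ i))\<^sup>2 + (\<Sum>j\<in>UNIV - {i}. (real_of_int (v $ j))\<^sup>2)"
    unfolding normsq_def by (rule sum.remove) auto
  have zero: "v $ j = 0" if "j \<noteq> i" for j
  proof (rule ccontr)
    assume "v $ j \<noteq> 0"
    have "(real_of_int (v $ j))\<^sup>2 \<le> (\<Sum>j\<in>UNIV - {i}. (real_of_int (v $ j))\<^sup>2)"
      using that by (intro member_le_sum) auto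
    then show False using split one[OF i] one[OF \<open>v $ j \<noteq> 0\<close>] assms by linarith
  qed
  have "(real_of_int (v $ i))\<^sup>2 < 2\<^sup>2" using coord_le_normsq[of v i] assms by simp
  then have "\<bar>real_of_int (v $ i)\<bar>\<^sup>2 < 2\<^sup>2" by simp
  then have "\<bar>real_of_int (v $ i)\<bar> < 2" by (rule power2_less_imp_less) simp
  then have "v $ i = 1 \<or> v $ i = -1" using i by linarith
  moreover have "v = axis i (v $ i)" using zero by (auto simp: vec_eq_iff axis_def)
  ultimately show ?thesis unfolding unit_steps_def by blast
qed simp

lemma normsq_zero [simp]: "normsq 0 = 0"
  by (simp add: normsq_def)

lemma normsq_unit_step: "e \<in> unit_steps \<Longrightarrow> normsq e = 1"
  unfolding unit_steps_def by (auto simp: normsq_add_axis[of 0, simplified])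

lemma normsq_uminus [simp]: "normsq (- x) = normsq x"
  by (simp add: normsq_def)

lemma dist2_eq_1_iff: "dist2 a b = 1 \<longleftrightarrow> b - a \<in> unit_steps"
proof -
  have "dist2 a b = 1 \<longleftrightarrow> normsq (b - a) = 1"
    unfolding dist2_eq using normsq_uminus[of "a - b"] by simp
  also have "\<dots> \<longleftrightarrow> b - a \<in> unit_steps"
    using normsq_less_two[of "b - a"] normsq_unit_step[of "b - a"] by auto
  finally show ?thesis .
qed

lemma torus_boundary_ball:
  assumes "w \<in> torus_boundary N (torus_ball N x \<rho>)"
  obtains y e where "near N x \<rho> y" "e \<in> unit_steps" "wrap N (y + e) = wrap N w"
    "w \<in> torus N" "\<not> near N x \<rho> w"
proof -
  from assms obtain y where w: "w \<in> torus N" "w \<notin> torus_ball N x \<rho>"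
    and y: "y \<in> torus_ball N x \<rho>" "torus_dist2 N w y = 1"
    by (auto simp: torus_boundary_def)
  let ?S = "{z. wrap N z = wrap N w}"
  have bdd: "bdd_below ((\<lambda>z. dist2 z y) ` ?S)" by (intro bdd_belowI2[of _ 0]) simp
  \<comment> \<open>The same device for the Euclidean distance: squared lattice distances are
    integers, so a representative closer than \<open>sqrt 2\<close> is at distance zero or
    one.\<close>
  have "torus_dist2 N w y < sqrt 2" using y(2) by simp
  then obtain z where z: "wrap N z = wrap N w" "dist2 z y < sqrt 2"
    unfolding torus_dist2_def using cINF_less_iff[OF _ bdd] by blast
  have ny: "near N x \<rho> y" using y(1) by (simp add: mem_torus_ball)
  have nw: "\<not> near N x \<rho> w" using w by (simp add: mem_torus_ball)
  have "normsq (z - y) < 2" using z(2) unfolding dist2_eq by simp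
  then have "z - y = 0 \<or> z - y \<in> unit_steps" by (rule normsq_less_two)
  moreover have "z - y \<noteq> 0" using ny nw near_cong[OF z(1), of x \<rho>] by auto
  ultimately have "z - y \<in> unit_steps" by blast
  then show ?thesis using that[of y "z - y"] ny nw w z(1) by simp
qed

lemma distinf_eq_iff:
  assumes "1 \<le> L"
  shows "distinf z 0 = real L \<longleftrightarrow> z \<in> cube L \<and> (\<exists>i. \<bar>z $ i\<bar> = int L)"
proof
  assume eq: "distinf z 0 = real L"
  then have z: "z \<in> cube L" using distinf_le_iff[of z 0 L] by simp
  have "\<exists>i. \<bar>z $ i\<bar> = int L"
  proof (rule ccontr)
    assume "\<nexists>i. \<bar>z $ i\<bar> = int L"
    then have less: "\<bar>z $ i\<bar> < int L" for i
      using z unfolding mem_cube by (simp add: order.strict_iff_order)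
    have "\<bar>z $ i\<bar> \<le> int (L - 1)" for i
      using less[of i] assms by linarith
    then have "distinf z 0 \<le> real (L - 1)" by (subst distinf_le_iff) (simp add: mem_cube)
    then show False using eq assms by simp
  qed
  with z show "z \<in> cube L \<and> (\<exists>i. \<bar>z $ i\<bar> = int L)" by blast
next
  assume "z \<in> cube L \<and> (\<exists>i. \<bar>z $ i\<bar> = int L)"
  then obtain i where z: "z \<in> cube L" and i: "\<bar>z $ i\<bar> = int L" by blast
  have "real L = \<bar>real_of_int (z $ i)\<bar>" using i by linarith
  also have "\<dots> \<le> distinf z 0"
    using component_le_infnorm_cart[of "\<chi> i. real_of_int (z $ i - (0 :: int ^ 'a) $ i)" i] by simp
  finally have "real L \<le> distinf z 0" .
  moreover have "distinf z 0 \<le> real L" using z distinf_le_iff[of z 0 L] by simp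
  ultimately show "distinf z 0 = real L" by simp
qed

lemma face_of_cube_step:
  assumes "z \<in> cube L" "e \<in> unit_steps" "z + e \<notin> cube L"
  shows "\<exists>i. \<bar>z $ i\<bar> = int L"
proof -
  obtain i where i: "int L < \<bar>(z + e) $ i\<bar>" using assms(3) by (auto simp: mem_cube not_le)
  moreover have "\<bar>e $ i\<bar> \<le> 1" "\<bar>z $ i\<bar> \<le> int L"
    using assms unit_step_in_cube by (auto simp: mem_cube)
  ultimately have "\<bar>z $ i\<bar> = int L" by simp
  then show ?thesis by blast
qed

section \<open>The walk as a function of its steps\<close>

definition pos :: "int ^ 'd \<Rightarrow> (nat \<Rightarrow> int ^ 'd) \<Rightarrow> nat \<Rightarrow> int ^ 'd" where
  "pos x \<xi> n = x + (\<Sum>k<n. \<xi> k)"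

lemma pos_0 [simp]: "pos x \<xi> 0 = x"
  by (simp add: pos_def)

lemma pos_Suc [simp]: "pos x \<xi> (Suc n) = pos x \<xi> n + \<xi> n"
  by (simp add: pos_def add.assoc)

lemma pos_shift: "pos x \<xi> (n + k) = pos (pos x \<xi> n) (\<lambda>j. \<xi> (n + j)) k"
  by (induction k) (simp_all add: add.assoc)

lemma pos_cong: "(\<And>k. k < n \<Longrightarrow> \<xi> k = \<xi>' k) \<Longrightarrow> pos x \<xi> n = pos x \<xi>' n"
  by (simp add: pos_def)

lemma wrap_pos_cong: "wrap N x = wrap N y \<Longrightarrow> wrap N (pos x \<xi> n) = wrap N (pos y \<xi> n)"
  unfolding pos_def by (intro wrap_add_cong) auto

abbreviation step_pmf :: "(int ^ 'd) pmf" where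
  "step_pmf \<equiv> pmf_of_set unit_steps"

lemma step_seq_eq: "step_seq = (\<Pi>\<^sub>M n\<in>UNIV. measure_pmf (step_pmf :: (int ^ 'd) pmf))"
  by (simp add: step_seq_def)

lemma prob_space_step_seq: "prob_space (step_seq :: (nat \<Rightarrow> int ^ 'd) measure)"
  unfolding step_seq_eq by (intro prob_space_PiM prob_space_measure_pmf)

lemma space_step_seq [simp]: "space (step_seq :: (nat \<Rightarrow> int ^ 'd) measure) = UNIV"
  by (simp add: step_seq_eq space_PiM)

lemma space_trajectories [simp]: "space (trajectories :: (nat \<Rightarrow> int ^ 'd) measure) = UNIV"
  by (simp add: trajectories_def space_PiM)

lemma sets_step_seq [measurable_cong]:
  "sets (step_seq :: (nat \<Rightarrow> int ^ 'd) measure) = sets trajectories"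
  unfolding step_seq_eq trajectories_def by (intro sets_PiM_cong) auto

lemma measurable_trajectory_component [measurable]:
  "(\<lambda>X. X n) \<in> measurable (trajectories :: (nat \<Rightarrow> int ^ 'd) measure) (count_space UNIV)"
  unfolding trajectories_def by measurable

lemma measurable_count_space_pair:
  fixes f :: "'x \<Rightarrow> 'a::countable" and g :: "'x \<Rightarrow> 'b::countable"
  assumes [measurable]: "f \<in> measurable M (count_space UNIV)" "g \<in> measurable M (count_space UNIV)"
  shows "(\<lambda>x. h (f x) (g x)) \<in> measurable M (count_space UNIV)"
  by (rule measurable_compose_countable[where f="\<lambda>i x. h i (g x)" and g=f]) measurable

lemma measurable_pos [measurable]:
  "(\<lambda>\<xi>. pos x \<xi> n) \<in> measurable (step_seq :: (nat \<Rightarrow> int ^ 'd) measure) (count_space UNIV)"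
proof (induction n)
  case (Suc n)
  have "(\<lambda>\<xi>. \<xi> n) \<in> measurable (step_seq :: (nat \<Rightarrow> int ^ 'd) measure) (count_space UNIV)"
    by measurable
  from measurable_count_space_pair[OF Suc this, of "(+)"] show ?case by simp
qed simp

lemma measurable_walk [measurable]:
  "(\<lambda>\<xi> n. wrap N (pos x \<xi> n)) \<in> measurable (step_seq :: (nat \<Rightarrow> int ^ 'd) measure) trajectories"
  unfolding trajectories_def by (intro measurable_PiM_single') (auto simp: space_PiM)

lemma measurable_shift [measurable]:
  "(\<lambda>X k. X (n + k)) \<in> measurable (trajectories :: (nat \<Rightarrow> int ^ 'd) measure) trajectories"
  unfolding trajectories_def by (intro measurable_PiM_single') (auto simp: space_PiM)

section \<open>Events of the step sequence, independence and the Markov property\<close>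

definition sprob :: "((nat \<Rightarrow> int ^ 'd) \<Rightarrow> bool) \<Rightarrow> real" where
  "sprob E = measure step_seq {\<xi>. E \<xi>}"

text \<open>\<open>N = 0\<close> gives the walk on \<open>\<int>\<^sup>d\<close>, since \<open>wrap 0\<close> is the identity.\<close>

definition tprob :: "nat \<Rightarrow> int ^ 'd \<Rightarrow> ((nat \<Rightarrow> int ^ 'd) \<Rightarrow> bool) \<Rightarrow> real" where
  "tprob N x G = sprob (\<lambda>\<xi>. G (\<lambda>n. wrap N (pos x \<xi> n)))"

lemma sprob_nonneg [simp]: "0 \<le> sprob E"
  by (simp add: sprob_def)

lemma tprob_nonneg [simp]: "0 \<le> tprob N x G"
  by (simp add: tprob_def)

lemma sets_Collect_step_seq: "Measurable.pred step_seq E \<Longrightarrow> {\<xi>. E \<xi>} \<in> sets (step_seq :: (nat \<Rightarrow> int ^ 'd) measure)"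
  by (simp add: Measurable.pred_def)

lemma sprob_mono:
  assumes "\<And>\<xi>. E \<xi> \<Longrightarrow> F \<xi>" "Measurable.pred step_seq F"
  shows "sprob E \<le> sprob F"
  unfolding sprob_def
  by (intro finite_measure.finite_measure_mono prob_space.finite_measure prob_space_step_seq
      sets_Collect_step_seq assms) (use assms in auto)

definition depends_on :: "nat \<Rightarrow> ((nat \<Rightarrow> 'a) \<Rightarrow> bool) \<Rightarrow> bool" where
  "depends_on n E \<longleftrightarrow> (\<forall>\<xi> \<xi>'. (\<forall>k<n. \<xi> k = \<xi>' k) \<longrightarrow> E \<xi> = E \<xi>')"

text \<open>The law of the steps is the image of its own square under concatenation at time
  \<open>n\<close> (\<open>comb_seq\<close>), and the preimage of the event is a rectangle.\<close>

lemma sprob_independent: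
  assumes E: "Measurable.pred step_seq E" "depends_on n E" and G: "Measurable.pred step_seq G"
  shows "sprob (\<lambda>\<xi>. E \<xi> \<and> G (\<lambda>k. \<xi> (n + k))) = sprob E * sprob (G :: (nat \<Rightarrow> int ^ 'd) \<Rightarrow> bool)"
proof -
  let ?S = "step_seq :: (nat \<Rightarrow> int ^ 'd) measure"
  interpret S: prob_space ?S by (rule prob_space_step_seq)
  interpret steps: sequence_space "measure_pmf (step_pmf :: (int ^ 'd) pmf)" by unfold_locales
  let ?A = "{\<xi>. E \<xi> \<and> G (\<lambda>k. \<xi> (n + k))}"
  have shift: "(\<lambda>\<xi> k. \<xi> (n + k)) \<in> measurable ?S ?S" by measurable
  have A: "?A \<in> sets ?S"
  proof -
    have "Measurable.pred ?S (\<lambda>\<xi>. G (\<lambda>k. \<xi> (n + k)))"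
      using measurable_compose[OF shift G] .
    then have "Measurable.pred ?S (\<lambda>\<xi>. E \<xi> \<and> G (\<lambda>k. \<xi> (n + k)))" using E(1) by measurable
    then show ?thesis by (rule sets_Collect_step_seq)
  qed
  have comb: "(\<lambda>(\<omega>, \<omega>'). comb_seq n \<omega> \<omega>') \<in> measurable (?S \<Otimes>\<^sub>M ?S) ?S"
    unfolding step_seq_eq by (rule measurable_comb_seq)
  have "emeasure ?S ?A = emeasure (distr (?S \<Otimes>\<^sub>M ?S) ?S (\<lambda>(\<omega>, \<omega>'). comb_seq n \<omega> \<omega>')) ?A"
    unfolding step_seq_eq steps.PiM_comb_seq ..
  also have "\<dots> = emeasure (?S \<Otimes>\<^sub>M ?S) ((\<lambda>(\<omega>, \<omega>'). comb_seq n \<omega> \<omega>') -` ?A \<inter> space (?S \<Otimes>\<^sub>M ?S))"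
    by (rule emeasure_distr[OF comb A])
  also have "(\<lambda>(\<omega>, \<omega>'). comb_seq n \<omega> \<omega>') -` ?A \<inter> space (?S \<Otimes>\<^sub>M ?S) = {\<xi>. E \<xi>} \<times> {\<xi>. G \<xi>}"
  proof -
    have "E (comb_seq n \<omega> \<omega>') = E \<omega>" for \<omega> \<omega>'
      using E(2) unfolding depends_on_def by (metis comb_seq_less)
    moreover have "(\<lambda>k. comb_seq n \<omega> \<omega>' (n + k)) = \<omega>'" for \<omega> \<omega>' :: "nat \<Rightarrow> int ^ 'd"
      by (simp add: comb_seq_def)
    ultimately show ?thesis by (auto simp: space_pair_measure)
  qed
  also have "emeasure (?S \<Otimes>\<^sub>M ?S) ({\<xi>. E \<xi>} \<times> {\<xi>. G \<xi>}) = emeasure ?S {\<xi>. E \<xi>} * emeasure ?S {\<xi>. G \<xi>}"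
    using E(1) G by (intro S.emeasure_pair_measure_Times sets_Collect_step_seq)
  finally show ?thesis
    unfolding sprob_def measure_def by (simp add: enn2real_mult)
qed

lemma sprob_first_step:
  "sprob (\<lambda>\<xi>. \<xi> 0 = e) = (if e \<in> unit_steps then 1 / real (card (unit_steps :: (int ^ 'd) set)) else 0)"
  for e :: "int ^ 'd"
proof -
  let ?S = "step_seq :: (nat \<Rightarrow> int ^ 'd) measure"
  have d: "distr ?S (measure_pmf step_pmf) (\<lambda>\<omega>. \<omega> 0) = measure_pmf step_pmf"
    unfolding step_seq_eq by (rule distr_PiM_component) (auto intro: prob_space_measure_pmf)
  have m: "(\<lambda>\<omega>. \<omega> 0) \<in> measurable ?S (measure_pmf step_pmf)" by measurable
  have "sprob (\<lambda>\<xi>. \<xi> 0 = e) = measure (distr ?S (measure_pmf step_pmf) (\<lambda>\<omega>. \<omega> 0)) {e}"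
    unfolding sprob_def by (subst measure_distr[OF m]) (auto intro!: arg_cong[where f="measure ?S"])
  also have "\<dots> = pmf step_pmf e" unfolding d by (rule measure_pmf_single)
  finally show ?thesis by (simp add: pmf_of_set)
qed

lemma sprob_step:
  fixes e :: "int ^ 'd"
  assumes "Measurable.pred step_seq E" "depends_on n E"
  shows "sprob (\<lambda>\<xi>. E \<xi> \<and> \<xi> n = e)
    = (if e \<in> unit_steps then sprob E / real (card (unit_steps :: (int ^ 'd) set)) else 0)"
proof -
  have "Measurable.pred step_seq (\<lambda>\<xi> :: nat \<Rightarrow> int ^ 'd. \<xi> 0 = e)" by measurable
  from sprob_independent[OF assms this] show ?thesis by (simp add: sprob_first_step)
qed

lemma AE_unit_steps: "AE \<xi> in step_seq. \<forall>n. \<xi> n \<in> (unit_steps :: (int ^ 'd) set)"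
proof -
  have "AE \<xi> in step_seq. \<xi> n \<in> (unit_steps :: (int ^ 'd) set)" for n
    unfolding step_seq_eq
    by (rule AE_PiM_component[where P="\<lambda>x. x \<in> unit_steps"])
       (auto intro: prob_space_measure_pmf simp: AE_measure_pmf_iff)
  then show ?thesis by (simp add: AE_all_countable)
qed

lemma sprob_eq_AE:
  assumes "\<And>\<xi>. (\<And>n. \<xi> n \<in> unit_steps) \<Longrightarrow> E \<xi> \<longleftrightarrow> F \<xi>"
    and "Measurable.pred step_seq E" "Measurable.pred step_seq F"
  shows "sprob E = sprob (F :: (nat \<Rightarrow> int ^ 'd) \<Rightarrow> bool)"
  unfolding sprob_def
proof (rule measure_eq_AE)
  show "AE \<xi> in step_seq. (\<xi> \<in> {\<xi>. E \<xi>}) = (\<xi> \<in> {\<xi>. F \<xi>})"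
    using AE_unit_steps by (rule AE_mp) (use assms(1) in auto)
qed (use assms in \<open>auto intro: sets_Collect_step_seq\<close>)

lemma sprob_sum_finite:
  assumes "finite I" "\<And>i. i \<in> I \<Longrightarrow> Measurable.pred step_seq (E i)"
    and "\<And>i j \<xi>. i \<in> I \<Longrightarrow> j \<in> I \<Longrightarrow> E i \<xi> \<Longrightarrow> E j \<xi> \<Longrightarrow> i = j"
  shows "sprob (\<lambda>\<xi>. \<exists>i\<in>I. E i \<xi>) = (\<Sum>i\<in>I. sprob (E i :: (nat \<Rightarrow> int ^ 'd) \<Rightarrow> bool))"
proof -
  interpret prob_space "step_seq :: (nat \<Rightarrow> int ^ 'd) measure" by (rule prob_space_step_seq)
  have "{\<xi>. \<exists>i\<in>I. E i \<xi>} = (\<Union>i\<in>I. {\<xi>. E i \<xi>})" by auto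
  then have "sprob (\<lambda>\<xi>. \<exists>i\<in>I. E i \<xi>) = measure step_seq (\<Union>i\<in>I. {\<xi>. E i \<xi>})"
    by (simp add: sprob_def)
  also have "\<dots> = (\<Sum>i\<in>I. measure step_seq {\<xi>. E i \<xi>})"
    using assms by (intro finite_measure_finite_Union)
      (auto simp: disjoint_family_on_def intro: sets_Collect_step_seq)
  finally show ?thesis by (simp add: sprob_def)
qed

lemma sprob_sums:
  assumes "\<And>i::nat. Measurable.pred step_seq (E i)"
    and "\<And>i j \<xi>. E i \<xi> \<Longrightarrow> E j \<xi> \<Longrightarrow> i = j"
  shows "(\<lambda>i. sprob (E i)) sums sprob (\<lambda>\<xi> :: nat \<Rightarrow> int ^ 'd. \<exists>i. E i \<xi>)"
proof -
  interpret prob_space "step_seq :: (nat \<Rightarrow> int ^ 'd) measure" by (rule prob_space_step_seq)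
  have "(\<lambda>i. measure step_seq {\<xi>. E i \<xi>}) sums measure step_seq (\<Union>i. {\<xi>. E i \<xi>})"
    using assms by (intro finite_measure_UNION)
      (auto simp: disjoint_family_on_def intro: sets_Collect_step_seq)
  moreover have "(\<Union>i. {\<xi>. E i \<xi>}) = {\<xi>. \<exists>i. E i \<xi>}" by auto
  ultimately show ?thesis by (simp add: sprob_def)
qed

text \<open>Decomposition by the last step, where \<open>tprob_step\<close> uses the first one. The
  symmetry of the steps turns the predecessors \<open>y - e\<close> into the neighbours
  \<open>y + e\<close>, hence a mean in the end point.\<close>

lemma forward_step:
  fixes u y :: "int ^ 'd"
  assumes E: "Measurable.pred step_seq E" "depends_on n E"
  shows "sprob (\<lambda>\<xi>. E \<xi> \<and> wrap N (pos u \<xi> (Suc n)) = wrap N y)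
    = step_mean (\<lambda>y. sprob (\<lambda>\<xi>. E \<xi> \<and> wrap N (pos u \<xi> n) = wrap N y)) y"
proof -
  let ?F = "\<lambda>e \<xi>. (E \<xi> \<and> wrap N (pos u \<xi> n) = wrap N (y - e)) \<and> \<xi> n = e"
  have eq: "wrap N (p + e) = wrap N y \<longleftrightarrow> wrap N p = wrap N (y - e)" for p e :: "int ^ 'd"
    by (simp add: wrap_eq_iff algebra_simps)
  have mF: "Measurable.pred step_seq (?F e)" for e
    using E(1) by measurable
  have m: "Measurable.pred step_seq (\<lambda>\<xi>. E \<xi> \<and> wrap N (pos u \<xi> n) = wrap N y)" for y
    using E(1) by measurable
  have dep: "depends_on n (\<lambda>\<xi>. E \<xi> \<and> wrap N (pos u \<xi> n) = wrap N y)" for y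
    unfolding depends_on_def
  proof (intro allI impI)
    fix \<xi> \<xi>' :: "nat \<Rightarrow> int ^ 'd" assume a: "\<forall>k<n. \<xi> k = \<xi>' k"
    then have "E \<xi> = E \<xi>'" "pos u \<xi> n = pos u \<xi>' n"
      using E(2) unfolding depends_on_def by (blast, intro pos_cong, auto)
    then show "(E \<xi> \<and> wrap N (pos u \<xi> n) = wrap N y) = (E \<xi>' \<and> wrap N (pos u \<xi>' n) = wrap N y)"
      by simp
  qed
  have "sprob (\<lambda>\<xi>. E \<xi> \<and> wrap N (pos u \<xi> (Suc n)) = wrap N y) = sprob (\<lambda>\<xi>. \<exists>e\<in>unit_steps. ?F e \<xi>)"
  proof (rule sprob_eq_AE)
    show "Measurable.pred step_seq (\<lambda>\<xi>. E \<xi> \<and> wrap N (pos u \<xi> (Suc n)) = wrap N y)"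
      using E(1) by measurable
    show "Measurable.pred step_seq (\<lambda>\<xi>. \<exists>e\<in>unit_steps. ?F e \<xi>)"
      using mF by (intro pred_intros_finite) auto
  qed (auto simp: eq)
  also have "\<dots> = (\<Sum>e\<in>unit_steps. sprob (?F e))"
    by (rule sprob_sum_finite[OF finite_unit_steps mF]) auto
  also have "\<dots> = (\<Sum>e\<in>unit_steps. sprob (\<lambda>\<xi>. E \<xi> \<and> wrap N (pos u \<xi> n) = wrap N (y - e)) / valency TYPE('d))"
    by (intro sum.cong refl) (simp only: sprob_step[OF m dep] if_True)
  also have "\<dots> = (\<Sum>e\<in>unit_steps. sprob (\<lambda>\<xi>. E \<xi> \<and> wrap N (pos u \<xi> n) = wrap N (y + e)) / valency TYPE('d))"
    by (subst sum_unit_steps_uminus[symmetric]) simp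
  finally show ?thesis by (simp add: step_mean_def sum_divide_distrib)
qed

lemma pred_bex_unit_steps:
  assumes "\<And>e. Measurable.pred M (H e)"
  shows "Measurable.pred M (\<lambda>\<xi>. \<exists>e\<in>unit_steps. H e \<xi>)"
  using assms by (intro pred_intros_finite) auto

lemma tprob_step:
  fixes y :: "int ^ 'd"
  assumes G: "Measurable.pred trajectories G"
  shows "tprob N y (\<lambda>X. G (\<lambda>n. X (Suc n))) = step_mean (\<lambda>y. tprob N y G) y"
proof -
  let ?G = "\<lambda>z \<xi>. G (\<lambda>n. wrap N (pos z \<xi> n))"
  have mG: "Measurable.pred step_seq (?G z)" for z
    using measurable_compose[OF measurable_walk G] .
  have path: "(\<lambda>n. wrap N (pos y \<xi> (Suc n))) = (\<lambda>n. wrap N (pos (y + \<xi> 0) (\<lambda>k. \<xi> (1 + k)) n))" for \<xi>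
    using pos_shift[of y \<xi> 1] by simp
  have mH: "Measurable.pred step_seq (\<lambda>\<xi>. \<xi> 0 = e \<and> ?G (y + e) (\<lambda>k. \<xi> (1 + k)))" for e
  proof -
    have "Measurable.pred step_seq (\<lambda>\<xi>. ?G (y + e) (\<lambda>k. \<xi> (1 + k)))"
      by (rule measurable_compose[OF _ mG]) measurable
    then show ?thesis by measurable
  qed
  have mS: "Measurable.pred step_seq (\<lambda>\<xi>. G (\<lambda>n. wrap N (pos y \<xi> (Suc n))))"
  proof -
    have "(\<lambda>\<xi> n. wrap N (pos y \<xi> (Suc n))) \<in> measurable step_seq trajectories"
      using measurable_compose[OF measurable_walk[of N y] measurable_shift[of 1]] by (simp del: pos_Suc)
    from measurable_compose[OF this G] show ?thesis .
  qed
  have "tprob N y (\<lambda>X. G (\<lambda>n. X (Suc n)))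
      = sprob (\<lambda>\<xi>. \<exists>e\<in>unit_steps. \<xi> 0 = e \<and> ?G (y + e) (\<lambda>k. \<xi> (1 + k)))"
    unfolding tprob_def
  proof (rule sprob_eq_AE)
    show "Measurable.pred step_seq (\<lambda>\<xi>. \<exists>e\<in>unit_steps. \<xi> 0 = e \<and> ?G (y + e) (\<lambda>k. \<xi> (1 + k)))"
      by (rule pred_bex_unit_steps[OF mH])
    show "G (\<lambda>n. wrap N (pos y \<xi> (Suc n))) \<longleftrightarrow> (\<exists>e\<in>unit_steps. \<xi> 0 = e \<and> ?G (y + e) (\<lambda>k. \<xi> (1 + k)))"
      if "\<And>n. \<xi> n \<in> unit_steps" for \<xi>
      unfolding path using that by blast
  qed (rule mS)
  also have "\<dots> = (\<Sum>e\<in>unit_steps. sprob (\<lambda>\<xi>. \<xi> 0 = e \<and> ?G (y + e) (\<lambda>k. \<xi> (1 + k))))"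
    by (rule sprob_sum_finite[OF finite_unit_steps mH]) auto
  also have "\<dots> = (\<Sum>e\<in>unit_steps. tprob N (y + e) G / valency TYPE('d))"
  proof (intro sum.cong refl)
    fix e :: "int ^ 'd" assume e: "e \<in> unit_steps"
    have "Measurable.pred step_seq (\<lambda>\<xi> :: nat \<Rightarrow> int ^ 'd. \<xi> 0 = e)" by measurable
    moreover have "depends_on 1 (\<lambda>\<xi>. \<xi> 0 = e)" by (simp add: depends_on_def)
    ultimately have "sprob (\<lambda>\<xi>. \<xi> 0 = e \<and> ?G (y + e) (\<lambda>k. \<xi> (1 + k)))
        = sprob (\<lambda>\<xi>. \<xi> 0 = e) * sprob (?G (y + e))"
      using mG by (rule sprob_independent)
    then show "sprob (\<lambda>\<xi>. \<xi> 0 = e \<and> ?G (y + e) (\<lambda>k. \<xi> (1 + k))) = tprob N (y + e) G / valency TYPE('d)"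
      using e by (simp add: sprob_first_step tprob_def)
  qed
  finally show ?thesis by (simp add: step_mean_def sum_divide_distrib)
qed

text \<open>\<open>E\<close> has to fix the position at time \<open>n\<close> only modulo
  \<open>N\<close>: representatives of one class generate the same torus walk.\<close>

lemma markov_property:
  fixes u y :: "int ^ 'd"
  assumes E: "Measurable.pred step_seq E" "depends_on n E" and G: "Measurable.pred trajectories G"
    and y: "\<And>\<xi>. E \<xi> \<Longrightarrow> wrap N (pos u \<xi> n) = wrap N y"
  shows "sprob (\<lambda>\<xi>. E \<xi> \<and> G (\<lambda>k. wrap N (pos u \<xi> (n + k)))) = sprob E * tprob N y G"
proof -
  have eq: "(\<lambda>\<xi>. E \<xi> \<and> G (\<lambda>k. wrap N (pos u \<xi> (n + k))))
      = (\<lambda>\<xi>. E \<xi> \<and> G (\<lambda>k. wrap N (pos y (\<lambda>j. \<xi> (n + j)) k)))"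
  proof (intro ext conj_cong refl)
    fix \<xi> :: "nat \<Rightarrow> int ^ 'd" assume "E \<xi>"
    then have "wrap N (pos u \<xi> (n + k)) = wrap N (pos y (\<lambda>j. \<xi> (n + j)) k)" for k
      unfolding pos_shift by (intro wrap_pos_cong y)
    then show "G (\<lambda>k. wrap N (pos u \<xi> (n + k))) = G (\<lambda>k. wrap N (pos y (\<lambda>j. \<xi> (n + j)) k))"
      by simp
  qed
  show ?thesis unfolding eq tprob_def
    by (rule sprob_independent[OF E, where G="\<lambda>\<xi>. G (\<lambda>k. wrap N (pos y \<xi> k))"])
       (rule measurable_compose[OF measurable_walk G])
qed

lemma torus_srw_eq: "torus_srw N x = distr step_seq trajectories (\<lambda>\<xi> n. wrap N (pos x \<xi> n))"
  by (simp add: torus_srw_def pos_def)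

lemma srw_eq: "srw x = torus_srw 0 x"
  by (simp add: srw_def torus_srw_def)

lemma measure_torus_srw:
  assumes "Measurable.pred trajectories G"
  shows "\<P>(X in torus_srw N x. G X) = tprob N x G"
proof -
  have "{X. G X} \<in> sets trajectories" using assms by (simp add: Measurable.pred_def)
  then show ?thesis
    unfolding torus_srw_eq tprob_def sprob_def
    by (simp add: measure_distr vimage_def)
qed

lemma prob_space_torus_srw: "prob_space (torus_srw N x)"
  unfolding torus_srw_eq by (intro prob_space.prob_space_distr prob_space_step_seq measurable_walk)

lemma sets_torus_srw [simp]: "sets (torus_srw N x) = sets trajectories"
  by (simp add: torus_srw_eq)

lemma space_torus_srw [simp]: "space (torus_srw N x) = (UNIV :: (nat \<Rightarrow> int ^ 'd) set)"
  by (simp add: torus_srw_eq)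

lemma tprob_avoid:
  fixes y :: "int ^ 'd"
  shows "tprob 0 y (\<lambda>X. \<forall>k\<le>n. X k \<notin> cube L) = avoid L n y"
proof (induction n arbitrary: y)
  case 0
  interpret prob_space "step_seq :: (nat \<Rightarrow> int ^ 'd) measure" by (rule prob_space_step_seq)
  show ?case using prob_space by (simp add: tprob_def sprob_def)
next
  case (Suc n)
  have split: "(\<forall>k\<le>Suc n. X k \<notin> cube L) \<longleftrightarrow> X 0 \<notin> cube L \<and> (\<forall>k\<le>n. X (Suc k) \<notin> cube L)" for X :: "nat \<Rightarrow> int ^ 'd"
    by (simp only: less_Suc_eq_le[symmetric] All_less_Suc2)
  show ?case
  proof (cases "y \<in> cube L")
    case True
    then show ?thesis by (simp add: tprob_def sprob_def split)
  next
    case False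
    then have "tprob 0 y (\<lambda>X. \<forall>k\<le>Suc n. X k \<notin> cube L) = tprob 0 y (\<lambda>X. \<forall>k\<le>n. X (Suc k) \<notin> cube L)"
      unfolding tprob_def split by (simp del: pos_Suc)
    also have "\<dots> = step_mean (\<lambda>y. tprob 0 y (\<lambda>X. \<forall>k\<le>n. X k \<notin> cube L)) y"
      by (rule tprob_step) measurable
    finally show ?thesis using False by (simp add: Suc)
  qed
qed

lemma tprob_escape:
  fixes y :: "int ^ 'd"
  shows "tprob 0 y (\<lambda>X. \<forall>k. X k \<notin> cube L) = escape L y"
proof (rule LIMSEQ_unique)
  interpret prob_space "step_seq :: (nat \<Rightarrow> int ^ 'd) measure" by (rule prob_space_step_seq)
  let ?A = "\<lambda>n. {\<xi>. \<forall>k\<le>n. pos y \<xi> k \<notin> cube L}"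
  have "(\<lambda>n. measure step_seq (?A n)) \<longlonglongrightarrow> measure step_seq (\<Inter>n. ?A n)"
  proof (rule finite_Lim_measure_decseq)
    have "Measurable.pred trajectories (\<lambda>X :: nat \<Rightarrow> int ^ 'd. \<forall>k\<le>n. X k \<notin> cube L)" for n by measurable
    from measurable_compose[OF measurable_walk[of 0 y] this]
    have "Measurable.pred step_seq (\<lambda>\<xi>. \<forall>k\<le>n. pos y \<xi> k \<notin> cube L)" for n
      unfolding wrap_zero .
    then have "?A n \<in> sets step_seq" for n by (rule sets_Collect_step_seq)
    then show "range ?A \<subseteq> sets step_seq" by blast
  qed (auto simp: decseq_def)
  moreover have "(\<Inter>n. ?A n) = {\<xi>. \<forall>k. pos y \<xi> k \<notin> cube L}" by auto
  ultimately have "(\<lambda>n. tprob 0 y (\<lambda>X. \<forall>k\<le>n. X k \<notin> cube L)) \<longlonglongrightarrow> tprob 0 y (\<lambda>X. \<forall>k. X k \<notin> cube L)"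
    by (simp add: tprob_def sprob_def)
  then show "(\<lambda>n. avoid L n y) \<longlonglongrightarrow> tprob 0 y (\<lambda>X. \<forall>k. X k \<notin> cube L)"
    by (simp add: tprob_avoid)
qed (rule avoid_tendsto)

lemma tprob_escape_after:
  "tprob 0 a (\<lambda>X. \<forall>k. X (Suc k) \<notin> cube L) = step_mean (escape L) a"
proof -
  have "tprob 0 a (\<lambda>X. \<forall>k. X (Suc k) \<notin> cube L)
      = step_mean (\<lambda>y. tprob 0 y (\<lambda>X. \<forall>k. X k \<notin> cube L)) a"
    by (rule tprob_step) measurable
  then show ?thesis by (simp add: tprob_escape)
qed

lemma escape_prob_eq:
  assumes "a \<in> cube L" shows "escape_prob L a = step_mean (escape L) a"
proof -
  have "(\<forall>n\<ge>1. X n \<notin> cube L) \<longleftrightarrow> (\<forall>k. X (Suc k) \<notin> cube L)" for X :: "nat \<Rightarrow> int ^ 'a"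
    by (metis One_nat_def Suc_le_D le_add1 plus_1_eq_Suc)
  then have "escape_prob L a = \<P>(X in torus_srw 0 a. \<forall>k. X (Suc k) \<notin> cube L)"
    using assms by (simp add: escape_prob_def srw_eq)
  also have "\<dots> = tprob 0 a (\<lambda>X. \<forall>k. X (Suc k) \<notin> cube L)"
    by (rule measure_torus_srw) measurable
  finally show ?thesis by (simp add: tprob_escape_after)
qed

lemma pred_pos:
  assumes "Measurable.pred trajectories G"
  shows "Measurable.pred step_seq (\<lambda>\<xi>. G (pos x \<xi>))"
  using measurable_compose[OF measurable_walk[of 0 x] assms] unfolding wrap_zero .

lemma tprob_cong:
  assumes "\<And>X. X 0 = wrap N y \<Longrightarrow> G X \<longleftrightarrow> G' X"
  shows "tprob N y G = tprob N y G'"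
proof -
  have "G (\<lambda>n. wrap N (pos y \<xi> n)) \<longleftrightarrow> G' (\<lambda>n. wrap N (pos y \<xi> n))" for \<xi>
    by (rule assms) (simp only: pos_0)
  then show ?thesis by (simp only: tprob_def)
qed

lemma tprob_False: "tprob N y (\<lambda>_. False) = 0"
  by (simp add: tprob_def sprob_def)

lemma tprob_True: "tprob N y (\<lambda>_. True) = 1"
  using prob_space.prob_space[OF prob_space_step_seq] by (simp add: tprob_def sprob_def)

section \<open>The excursion between the two boxes\<close>

text \<open>Here \<open>x\<close> is the centre whose large box has \<open>w\<close> in its boundary and \<open>xo\<close> the other centre.
  All sets are described by their periodic preimages in \<open>\<int>\<^sup>d\<close>.\<close>

locale two_boxes =
  fixes N L r :: nat and x xo u w :: "int ^ 'd"
  assumes dim: "3 \<le> CARD('d)"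
    and L1: "1 \<le> L" and rL: "10 * L \<le> r" and Nr: "4 * r + 6 \<le> N"
    and sep: "\<not> near N x (2 * r + 2) xo"
    and u_out: "\<not> near N x r u" "\<not> near N xo r u"
    and w_out: "\<not> near N x r w" and w_wrap: "wrap N w = w"
    and w_boundary: "\<exists>y e. near N x r y \<and> e \<in> unit_steps \<and> wrap N (y + e) = wrap N w"
begin

definition inA :: "int ^ 'd \<Rightarrow> bool" where
  "inA y \<longleftrightarrow> near N x L y \<or> near N xo L y"

definition inB :: "int ^ 'd \<Rightarrow> bool" where
  "inB y \<longleftrightarrow> near N x r y \<or> near N xo r y"

lemma inA_wrap [simp]: "inA (wrap N y) = inA y"
  unfolding inA_def using near_cong[of N "wrap N y" y] by simp

lemma inB_wrap [simp]: "inB (wrap N y) = inB y"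
  unfolding inB_def using near_cong[of N "wrap N y" y] by simp

lemma inA_cong: "wrap N y = wrap N z \<Longrightarrow> inA y = inA z"
  using inA_wrap by metis

lemma inB_cong: "wrap N y = wrap N z \<Longrightarrow> inB y = inB z"
  using inB_wrap by metis

lemma L_le_r: "L \<le> r"
  using rL by simp

lemma inA_imp_inB: "inA y \<Longrightarrow> inB y"
  unfolding inA_def inB_def using near_mono[OF L_le_r] by blast

lemma u_not_inB: "\<not> inB u"
  using u_out by (simp add: inB_def)

text \<open>The separation leaves two spare layers around the box at \<open>x\<close>: one for the
  exit point \<open>w\<close>, and one for a step back from a point of the first layer.\<close>

lemma not_near_other:
  assumes "near N x (Suc (Suc r)) y" shows "\<not> near N xo r y"
proof
  assume "near N xo r y"
  then have "near N y r xo" by (simp add: near_sym)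
  from near_trans[OF assms this] have "near N x (Suc (Suc r) + r) xo" .
  then show False using sep by (simp add: mult_2)
qed

lemma inB_add_iff: "z \<in> cube (Suc r) \<Longrightarrow> inB (x + z) \<longleftrightarrow> z \<in> cube r"
  unfolding inB_def using near_add_iff[of z "Suc r" r N x] Nr
    not_near_other[of "x + z"] near_mono[of "Suc r" "Suc (Suc r)" N x "x + z"] near_add[of z "Suc r" N x]
  by auto

lemma inA_add_iff:
  assumes z: "z \<in> cube (Suc r)" shows "inA (x + z) \<longleftrightarrow> z \<in> cube L"
proof -
  have "near N x (Suc (Suc r)) (x + z)"
    by (rule near_add) (rule cube_mono[OF _ z], simp)
  then have "\<not> near N xo L (x + z)"
    using not_near_other near_mono[OF L_le_r] by blast
  moreover have "near N x L (x + z) \<longleftrightarrow> z \<in> cube L"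
    using Nr L_le_r by (intro near_add_iff[OF z]) simp
  ultimately show ?thesis by (simp add: inA_def)
qed

lemma near_w: "near N x (Suc r) w"
proof -
  obtain y e where ye: "near N x r y" "e \<in> unit_steps" "wrap N (y + e) = wrap N w"
    using w_boundary by blast
  have "near N x (r + 1) (y + e)" using near_trans[OF ye(1) near_step[OF ye(2)]] .
  then show ?thesis using near_cong[OF ye(3), of x "Suc r"] by simp
qed

lemma w_not_inB: "\<not> inB w"
proof -
  have "near N x (Suc (Suc r)) w" by (rule near_mono[OF _ near_w]) simp
  then show ?thesis using not_near_other w_out by (simp add: inB_def)
qed

text \<open>As \<open>w\<close> is outside the large boxes, \<open>m\<close> is automatically the
  first exit time.\<close>

definition exits_at_w :: "(nat \<Rightarrow> int ^ 'd) \<Rightarrow> bool" where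
  "exits_at_w X \<longleftrightarrow> (\<exists>m. (\<forall>j<m. inB (X j)) \<and> X m = w)"

definition exits_avoiding :: "(nat \<Rightarrow> int ^ 'd) \<Rightarrow> bool" where
  "exits_avoiding X \<longleftrightarrow> (\<exists>m. (\<forall>j<m. inB (X j) \<and> \<not> inA (X j)) \<and> X m = w)"

lemma pred_exits [measurable]:
  "Measurable.pred trajectories exits_at_w" "Measurable.pred trajectories exits_avoiding"
  unfolding exits_at_w_def[abs_def] exits_avoiding_def[abs_def] by measurable

text \<open>In coordinates centred at \<open>x\<close>, this is the function \<open>M\<close> of
  \<open>mean_near_cube\<close> for the exit, and \<open>exit_avoid_prob\<close> is the
  corresponding \<open>k\<close>.\<close>

definition exit_prob :: "int ^ 'd \<Rightarrow> real" where
  "exit_prob z = tprob N (x + z) exits_at_w"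

definition exit_avoid_prob :: "int ^ 'd \<Rightarrow> real" where
  "exit_avoid_prob z = tprob N (x + z) exits_avoiding"

lemma ex_first_step:
  "(\<exists>m. (\<forall>j<m. P (X j)) \<and> X m = c) \<longleftrightarrow> X 0 = c \<or> (P (X 0) \<and> (\<exists>m. (\<forall>j<m. P (X (Suc j))) \<and> X (Suc m) = c))"
  (is "?l \<longleftrightarrow> ?r")
proof
  assume ?l
  then obtain m where "(\<forall>j<m. P (X j)) \<and> X m = c" ..
  then show ?r by (cases m) (auto simp: All_less_Suc2)
next
  assume ?r
  then show ?l
  proof
    assume "X 0 = c" then show ?l by (intro exI[of _ 0]) simp
  next
    assume "P (X 0) \<and> (\<exists>m. (\<forall>j<m. P (X (Suc j))) \<and> X (Suc m) = c)"
    then obtain m where "P (X 0)" "\<forall>j<m. P (X (Suc j))" "X (Suc m) = c" by blast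
    then show ?l by (intro exI[of _ "Suc m"]) (simp add: All_less_Suc2)
  qed
qed

lemma exits_at_w_step: "exits_at_w X \<longleftrightarrow> X 0 = w \<or> (inB (X 0) \<and> exits_at_w (\<lambda>n. X (Suc n)))"
  unfolding exits_at_w_def by (rule ex_first_step)

lemma exits_avoiding_step:
  "exits_avoiding X \<longleftrightarrow> X 0 = w \<or> (inB (X 0) \<and> \<not> inA (X 0) \<and> exits_avoiding (\<lambda>n. X (Suc n)))"
  unfolding exits_avoiding_def using ex_first_step[of "\<lambda>y. inB y \<and> \<not> inA y" X w] by simp

lemma exit_prob_harmonic:
  assumes "z \<in> cube r" shows "step_mean exit_prob z = exit_prob z"
proof -
  have B: "inB (x + z)" using inB_add_iff[of z] assms cube_mono[of r "Suc r" z] by simp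
  have "exit_prob z = tprob N (x + z) (\<lambda>X. exits_at_w (\<lambda>n. X (Suc n)))"
    unfolding exit_prob_def
  proof (rule tprob_cong)
    fix X :: "nat \<Rightarrow> int ^ 'd" assume X: "X 0 = wrap N (x + z)"
    then have "inB (X 0)" using B by simp
    moreover have "X 0 \<noteq> w" using w_not_inB \<open>inB (X 0)\<close> by auto
    ultimately show "exits_at_w X = exits_at_w (\<lambda>n. X (Suc n))" by (subst exits_at_w_step) simp
  qed
  also have "\<dots> = step_mean (\<lambda>y. tprob N y exits_at_w) (x + z)" by (rule tprob_step[OF pred_exits(1)])
  also have "\<dots> = step_mean exit_prob z"
    unfolding exit_prob_def[abs_def] by (rule step_mean_translate[symmetric])
  finally show ?thesis ..
qed

lemma exit_avoid_prob_harmonic: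
  assumes "z \<in> cube r" "z \<notin> cube L" shows "step_mean exit_avoid_prob z = exit_avoid_prob z"
proof -
  have z: "z \<in> cube (Suc r)" using assms cube_mono[of r "Suc r" z] by simp
  have B: "inB (x + z)" "\<not> inA (x + z)" using inB_add_iff[OF z] inA_add_iff[OF z] assms by auto
  have "exit_avoid_prob z = tprob N (x + z) (\<lambda>X. exits_avoiding (\<lambda>n. X (Suc n)))"
    unfolding exit_avoid_prob_def
  proof (rule tprob_cong)
    fix X :: "nat \<Rightarrow> int ^ 'd" assume X: "X 0 = wrap N (x + z)"
    then have "inB (X 0)" "\<not> inA (X 0)" using B by simp_all
    moreover have "X 0 \<noteq> w" using w_not_inB \<open>inB (X 0)\<close> by auto
    ultimately show "exits_avoiding X = exits_avoiding (\<lambda>n. X (Suc n))"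
      by (subst exits_avoiding_step) simp
  qed
  also have "\<dots> = step_mean (\<lambda>y. tprob N y exits_avoiding) (x + z)" by (rule tprob_step[OF pred_exits(2)])
  also have "\<dots> = step_mean exit_avoid_prob z"
    unfolding exit_avoid_prob_def[abs_def] by (rule step_mean_translate[symmetric])
  finally show ?thesis ..
qed

lemma exit_avoid_prob_inner: "z \<in> cube L \<Longrightarrow> exit_avoid_prob z = 0"
proof -
  assume "z \<in> cube L"
  then have A: "inA (x + z)" using near_add by (auto simp: inA_def)
  have "exit_avoid_prob z = tprob N (x + z) (\<lambda>_. False)"
    unfolding exit_avoid_prob_def
  proof (rule tprob_cong)
    fix X :: "nat \<Rightarrow> int ^ 'd" assume X: "X 0 = wrap N (x + z)"
    then have "inA (X 0)" using A by simp
    moreover have "X 0 \<noteq> w" using w_not_inB inA_imp_inB \<open>inA (X 0)\<close> by auto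
    ultimately show "exits_avoiding X = False" by (subst exits_avoiding_step) simp
  qed
  then show ?thesis by (simp only: tprob_False)
qed

lemma exit_avoid_prob_outer:
  assumes "z \<in> cube (Suc r)" "z \<notin> cube r" shows "exit_avoid_prob z = exit_prob z"
proof -
  have B: "\<not> inB (x + z)" using inB_add_iff assms by simp
  show ?thesis unfolding exit_avoid_prob_def exit_prob_def
  proof (rule tprob_cong)
    fix X :: "nat \<Rightarrow> int ^ 'd" assume X: "X 0 = wrap N (x + z)"
    then have "\<not> inB (X 0)" using B by simp
    then show "exits_avoiding X = exits_at_w X"
      by (subst exits_avoiding_step, subst exits_at_w_step) simp
  qed
qed

lemma exit_prob_nonneg: "0 \<le> exit_prob z"
  by (simp add: exit_prob_def)

text \<open>A nonnegative harmonic function with a zero inside the cube vanishes on the cube and next to it.\<close>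

lemma exit_prob_pos: "0 < exit_prob 0"
proof (rule ccontr)
  assume "\<not> 0 < exit_prob 0"
  then have z0: "exit_prob 0 = 0" using exit_prob_nonneg[of 0] by simp
  have nbr: "exit_prob (z + e) = 0" if "z \<in> cube r" "exit_prob z = 0" "e \<in> unit_steps" for z e
  proof -
    have "exit_prob (z + e) / valency TYPE('d) \<le> step_mean exit_prob z"
      using that(3) by (intro le_step_mean exit_prob_nonneg)
    also have "\<dots> = 0" using exit_prob_harmonic[OF that(1)] that(2) by simp
    finally show ?thesis
      using exit_prob_nonneg[of "z + e"] card_unit_steps_pos[where 'd='d] by (simp add: divide_le_0_iff)
  qed
  have all: "exit_prob z = 0" if zr: "z \<in> cube r" for z
  proof -
    have "n = (\<Sum>i\<in>UNIV. nat \<bar>y $ i - z $ i\<bar>) \<Longrightarrow> y \<in> cube r \<Longrightarrow> exit_prob y = 0 \<Longrightarrow> exit_prob z = 0" for n y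
    proof (induction n arbitrary: y)
      case 0
      then have "y = z" by (auto simp: vec_eq_iff)
      then show ?case using 0 by simp
    next
      case (Suc n)
      then have "y \<noteq> z" by auto
      then obtain e where e: "e \<in> unit_steps" "y + e \<in> cube r"
        "(\<Sum>i\<in>UNIV. nat \<bar>y $ i - z $ i\<bar>) = Suc (\<Sum>i\<in>UNIV. nat \<bar>(y + e) $ i - z $ i\<bar>)"
        using cube_geodesic_step[OF Suc.prems(2) zr] by blast
      show ?case
        using e Suc.prems nbr[OF Suc.prems(2,3) e(1)] by (intro Suc.IH[of "y + e"]) auto
    qed
    from this[of _ 0] show ?thesis using z0 by simp
  qed
  obtain y e where ye: "near N x r y" "e \<in> unit_steps" "wrap N (y + e) = wrap N w"
    using w_boundary by blast
  obtain z where z: "z \<in> cube r" "wrap N (x + z) = wrap N y" using ye(1) by (auto simp: near_def)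
  have "wrap N (x + (z + e)) = wrap N (y + e)"
    unfolding add.assoc[symmetric] by (rule wrap_add_cong) (use z in auto)
  then have we: "wrap N (x + (z + e)) = w" using ye(3) w_wrap by simp
  have "exit_prob (z + e) = tprob N (x + (z + e)) (\<lambda>_. True)"
    unfolding exit_prob_def by (rule tprob_cong) (subst exits_at_w_step, simp add: we)
  then have "exit_prob (z + e) = 1" by (simp only: tprob_True)
  then show False using nbr[OF z(1) all[OF z(1)] ye(2)] by simp
qed

section \<open>The walk before its first entrance\<close>

definition fresh :: "nat \<Rightarrow> (nat \<Rightarrow> int ^ 'd) \<Rightarrow> bool" where
  "fresh n \<xi> \<longleftrightarrow> (\<forall>k\<le>n. \<not> inA (pos u \<xi> k))"

lemma pred_fresh [measurable]: "Measurable.pred step_seq (fresh n)"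
proof -
  have "Measurable.pred trajectories (\<lambda>X. \<forall>k\<le>n. \<not> inA (X k))" by measurable
  from pred_pos[OF this] show ?thesis unfolding fresh_def[abs_def] .
qed

lemma depends_on_fresh: "depends_on n (fresh n)"
  unfolding depends_on_def fresh_def
proof (intro allI impI)
  fix \<xi> \<xi>' :: "nat \<Rightarrow> int ^ 'd" assume "\<forall>k<n. \<xi> k = \<xi>' k"
  then have "pos u \<xi> k = pos u \<xi>' k" if "k \<le> n" for k using that by (intro pos_cong) auto
  then show "(\<forall>k\<le>n. \<not> inA (pos u \<xi> k)) = (\<forall>k\<le>n. \<not> inA (pos u \<xi>' k))" by simp
qed

text \<open>By symmetry of the step distribution these forward weights, as functions of the end point, obey
  the same recursion as killed hitting probabilities; no time reversal is needed.\<close>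

definition fwd :: "nat \<Rightarrow> int ^ 'd \<Rightarrow> real" where
  "fwd n y = sprob (\<lambda>\<xi>. fresh n \<xi> \<and> wrap N (pos u \<xi> n) = wrap N y)"

definition hit :: "nat \<Rightarrow> int ^ 'd \<Rightarrow> real" where
  "hit n y = sprob (\<lambda>\<xi>. fresh n \<xi> \<and> wrap N (pos u \<xi> (Suc n)) = wrap N y)"

lemma hit_eq: "hit n y = step_mean (fwd n) y"
  unfolding hit_def fwd_def[abs_def] by (rule forward_step[OF pred_fresh depends_on_fresh])

lemma fwd_nonneg [simp]: "0 \<le> fwd n y" by (simp add: fwd_def)
lemma hit_nonneg [simp]: "0 \<le> hit n y" by (simp add: hit_def)

lemma fwd_0: "fwd 0 y = (if wrap N u = wrap N y then 1 else 0)"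
proof -
  have "\<not> inA u" using u_not_inB inA_imp_inB by blast
  then show ?thesis
    using prob_space.prob_space[OF prob_space_step_seq[where 'd='d]]
    by (simp add: fwd_def fresh_def sprob_def)
qed

lemma fwd_inA: "inA y \<Longrightarrow> fwd n y = 0"
proof -
  assume A: "inA y"
  have "(\<lambda>\<xi>. fresh n \<xi> \<and> wrap N (pos u \<xi> n) = wrap N y) = (\<lambda>_. False)"
    unfolding fresh_def using A inA_cong by (metis order_refl)
  then show ?thesis by (simp add: fwd_def sprob_def)
qed

lemma fwd_Suc: "\<not> inA y \<Longrightarrow> fwd (Suc n) y = step_mean (fwd n) y"
proof -
  assume A: "\<not> inA y"
  have "(fresh (Suc n) \<xi> \<and> wrap N (pos u \<xi> (Suc n)) = wrap N y)
      = (fresh n \<xi> \<and> wrap N (pos u \<xi> (Suc n)) = wrap N y)" for \<xi>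
    unfolding fresh_def using A inA_cong by (metis le_Suc_eq)
  then have "fwd (Suc n) y = hit n y" unfolding fwd_def hit_def by presburger
  then show ?thesis by (simp add: hit_eq)
qed

text \<open>At a point of a small box \<open>n + 1\<close> is the entrance time, so the events are
  disjoint for different \<open>n\<close>.\<close>

lemma hit_summable:
  assumes "inA y"
  shows "summable (\<lambda>n. hit n y)"
proof -
  have "(\<lambda>n. hit n y) sums sprob (\<lambda>\<xi>. \<exists>n. fresh n \<xi> \<and> wrap N (pos u \<xi> (Suc n)) = wrap N y)"
    unfolding hit_def
  proof (rule sprob_sums)
    show "Measurable.pred step_seq (\<lambda>\<xi>. fresh i \<xi> \<and> wrap N (pos u \<xi> (Suc i)) = wrap N y)" for i
      by measurable
    fix i j \<xi>
    assume a: "fresh i \<xi> \<and> wrap N (pos u \<xi> (Suc i)) = wrap N y"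
      "fresh j \<xi> \<and> wrap N (pos u \<xi> (Suc j)) = wrap N y"
    then have "inA (pos u \<xi> (Suc i))" "inA (pos u \<xi> (Suc j))" using assms inA_cong by blast+
    then have "\<not> Suc i \<le> j" "\<not> Suc j \<le> i" using a unfolding fresh_def by blast+
    then show "i = j" by linarith
  qed
  then show ?thesis by (rule sums_summable)
qed

lemma fwd_le_mean:
  assumes "e \<in> unit_steps"
  shows "fwd n y \<le> valency TYPE('d) * step_mean (fwd n) (y + e)"
proof -
  have "fwd n (y + e + - e) / valency TYPE('d) \<le> step_mean (fwd n) (y + e)"
    using assms by (intro le_step_mean) auto
  then show ?thesis using card_unit_steps_pos[where 'd='d] by (simp add: divide_le_eq mult.commute)
qed

text \<open>Finiteness of the expected occupation before the first entrance: a visit to a point close to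
  the box is followed, along a fixed path, by an entrance at a fixed point.\<close>

lemma fwd_summable:
  assumes "z \<in> cube (Suc r)" shows "summable (\<lambda>n. fwd n (x + z))"
proof -
  have "n = (\<Sum>i\<in>UNIV. nat \<bar>z $ i - (0 :: int ^ 'd) $ i\<bar>) \<Longrightarrow> z \<in> cube (Suc r) \<Longrightarrow> summable (\<lambda>n. fwd n (x + z))" for n
  proof (induction n arbitrary: z)
    case 0
    then have "z = 0" by (auto simp: vec_eq_iff)
    then have "inA (x + z)" using near_add[of 0 L N x] by (simp add: inA_def)
    then show ?case by (simp add: fwd_inA)
  next
    case (Suc n)
    then have "z \<noteq> 0" by auto
    then obtain e where e: "e \<in> unit_steps" "z + e \<in> cube (Suc r)"
      "(\<Sum>i\<in>UNIV. nat \<bar>z $ i - (0 :: int ^ 'd) $ i\<bar>) = Suc (\<Sum>i\<in>UNIV. nat \<bar>(z + e) $ i - (0 :: int ^ 'd) $ i\<bar>)"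
      using cube_geodesic_step[OF Suc.prems(2) zero_in_cube] by blast
    have "summable (\<lambda>n. step_mean (fwd n) (x + (z + e)))"
    proof (cases "inA (x + (z + e))")
      case True
      then show ?thesis using hit_summable unfolding hit_eq by blast
    next
      case False
      have "summable (\<lambda>n. fwd n (x + (z + e)))"
        using e Suc.prems by (intro Suc.IH) auto
      then have "summable (\<lambda>n. fwd (Suc n) (x + (z + e)))"
        by (rule summable_Suc_iff[where f="\<lambda>n. fwd n (x + (z + e))", THEN iffD2])
      then show ?thesis using fwd_Suc[OF False] by simp
    qed
    then have "summable (\<lambda>n. valency TYPE('d) * step_mean (fwd n) (x + (z + e)))"
      by (rule summable_mult)
    then show ?case
    proof (rule summable_comparison_test')
      show "norm (fwd n (x + z)) \<le> valency TYPE('d) * step_mean (fwd n) (x + (z + e))" for n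
        using fwd_le_mean[OF e(1), of n "x + z"] by (simp add: add.assoc)
    qed
  qed
  then show ?thesis using assms by blast
qed

text \<open>The function \<open>k\<close> of \<open>mean_near_cube\<close> for the entrance:
  expected visits before it. The cut-off keeps the one layer around the large cube that the
  comparison looks at; summability is proved only up to there, and finite support provides the bound
  that \<open>dirichlet_problem\<close> asks for.\<close>

definition occupation :: "int ^ 'd \<Rightarrow> real" where
  "occupation z = (if z \<in> cube (Suc r) then \<Sum>n. fwd n (x + z) else 0)"

definition entrance :: "int ^ 'd \<Rightarrow> real" where
  "entrance a = (\<Sum>n. hit n (x + a))"

lemma occupation_nonneg: "0 \<le> occupation z"
  by (simp add: occupation_def suminf_nonneg fwd_summable)

lemma mean_occupation:
  assumes "z \<in> cube r" shows "step_mean occupation z = (\<Sum>n. step_mean (fwd n) (x + z))"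
proof -
  have nb: "z + e \<in> cube (Suc r)" if "e \<in> unit_steps" for e using cube_step[OF assms that] .
  have "(\<lambda>n. (\<Sum>e\<in>unit_steps. fwd n (x + (z + e))) / valency TYPE('d)) sums
      ((\<Sum>e\<in>unit_steps. \<Sum>n. fwd n (x + (z + e))) / valency TYPE('d))"
    by (intro sums_divide sums_sum summable_sums fwd_summable nb)
  then have "(\<lambda>n. step_mean (fwd n) (x + z)) sums step_mean occupation z"
    unfolding step_mean_def using nb by (simp add: occupation_def add.assoc)
  then show ?thesis by (simp add: sums_iff)
qed

lemma occupation_harmonic:
  assumes "z \<in> cube r" "z \<notin> cube L" shows "step_mean occupation z = occupation z"
proof -
  have z: "z \<in> cube (Suc r)" using cube_mono[OF _ assms(1), of "Suc r"] by simp
  have A: "\<not> inA (x + z)" "inB (x + z)" using inA_add_iff[OF z] inB_add_iff[OF z] assms by auto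
  \<comment> \<open>The walk starts outside the large boxes, so there is no source term at
    \<open>z\<close>, and shifting the time index leaves the sum unchanged.\<close>
  have "wrap N u \<noteq> wrap N (x + z)" using A(2) u_not_inB inB_cong by blast
  then have "fwd 0 (x + z) = 0" by (simp add: fwd_0)
  moreover have "(\<Sum>n. fwd (Suc n) (x + z)) = (\<Sum>n. fwd n (x + z)) - fwd 0 (x + z)"
    by (rule suminf_split_head[OF fwd_summable[OF z]])
  ultimately show ?thesis
    unfolding mean_occupation[OF assms(1)] using fwd_Suc[OF A(1)] z by (simp add: occupation_def)
qed

lemma occupation_inner: "z \<in> cube L \<Longrightarrow> occupation z = 0"
  using inA_add_iff[of z] cube_mono[of L "Suc r" z] L_le_r by (simp add: occupation_def fwd_inA)

lemma entrance_eq: "a \<in> cube L \<Longrightarrow> entrance a = step_mean occupation a"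
  using mean_occupation[of a] cube_mono[OF L_le_r, of a] by (simp add: entrance_def hit_eq)

end

lemma pred_shifted_walk:
  assumes "Measurable.pred trajectories G"
  shows "Measurable.pred step_seq (\<lambda>\<xi>. G (\<lambda>k. wrap N (pos y \<xi> (m + k))))"
  using measurable_compose[OF measurable_compose[OF measurable_walk[of N y] measurable_shift[of m]] assms] .

lemma ex_common_cube: "\<exists>\<rho>. y \<in> cube \<rho> \<and> (z :: int ^ 'd) \<in> cube \<rho>"
  for y :: "int ^ 'd"
proof -
  define \<rho> where "\<rho> = (\<Sum>i\<in>UNIV. nat \<bar>y $ i\<bar> + nat \<bar>z $ i\<bar>)"
  have le: "nat \<bar>y $ i\<bar> + nat \<bar>z $ i\<bar> \<le> \<rho>" for i
    unfolding \<rho>_def by (rule member_le_sum[where f="\<lambda>i. nat \<bar>y $ i\<bar> + nat \<bar>z $ i\<bar>"]) auto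
  have "\<bar>y $ i\<bar> \<le> int \<rho> \<and> \<bar>z $ i\<bar> \<le> int \<rho>" for i
  proof -
    have "int (nat \<bar>y $ i\<bar> + nat \<bar>z $ i\<bar>) \<le> int \<rho>" using le by (simp only: of_nat_le_iff)
    then have "\<bar>y $ i\<bar> + \<bar>z $ i\<bar> \<le> int \<rho>" by simp
    then show ?thesis by linarith
  qed
  then show ?thesis unfolding mem_cube by blast
qed

lemma near_imp_coord:
  assumes "near N xo \<rho> y" shows "\<exists>k. \<bar>y $ i - xo $ i - int N * k\<bar> \<le> int \<rho>"
proof -
  obtain z where z: "z \<in> cube \<rho>" "wrap N y = wrap N (xo + z)" using assms by (auto simp: near_def)
  then have "int N dvd y $ i - (xo + z) $ i" unfolding wrap_eq_iff by blast
  then obtain k where "y $ i - (xo + z) $ i = int N * k" by (auto elim: dvdE)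
  then have "y $ i - xo $ i - int N * k = z $ i" by simp
  then show ?thesis using z(1) unfolding mem_cube by metis
qed

lemma coord_imp_near:
  assumes "\<And>i. \<exists>k. \<bar>y $ i - xo $ i - int N * k\<bar> \<le> int \<rho>" shows "near N xo \<rho> y"
proof -
  obtain k where k: "\<And>i. \<bar>y $ i - xo $ i - int N * k i\<bar> \<le> int \<rho>" using assms by metis
  define z where "z = (\<chi> i. y $ i - xo $ i - int N * k i)"
  have "z \<in> cube \<rho>" using k by (simp add: z_def mem_cube)
  moreover have "wrap N (xo + z) = wrap N y" by (simp add: wrap_eq_iff z_def)
  ultimately show ?thesis by (auto simp: near_def)
qed

section \<open>Accessibility of the box and two-sided bounds on the entrance weights\<close>

context two_boxes
begin

lemma inA_cube: "a \<in> cube L \<Longrightarrow> inA (x + a)"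
  unfolding inA_def using near_add by blast

lemma entrance_nonneg: "a \<in> cube L \<Longrightarrow> 0 \<le> entrance a"
  unfolding entrance_def using hit_summable[OF inA_cube] by (intro suminf_nonneg) auto

text \<open>Coordinate \<open>j\<close> alone keeps \<open>y\<close> and all its periodic copies off
  the small box around \<open>xo\<close>, whatever the other coordinates are.\<close>

definition guarded :: "'d \<Rightarrow> int ^ 'd \<Rightarrow> bool" where
  "guarded j y \<longleftrightarrow> (\<forall>k. int L < \<bar>y $ j - xo $ j - int N * k\<bar>)"

lemma guarded_not_near: "guarded j y \<Longrightarrow> \<not> near N xo L y"
  using near_imp_coord[of N xo L y j] unfolding guarded_def by (meson not_le)

lemma ex_guarded:
  assumes "\<not> near N xo \<rho> y" "L \<le> \<rho>" shows "\<exists>j. guarded j y"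
proof -
  obtain j where j: "\<And>k. int \<rho> < \<bar>y $ j - xo $ j - int N * k\<bar>"
    using coord_imp_near[of y xo N \<rho>] assms(1) by (meson not_le)
  have "int L < \<bar>y $ j - xo $ j - int N * k\<bar>" for k using j[of k] assms(2) by linarith
  then show ?thesis unfolding guarded_def by blast
qed

text \<open>While one coordinate stays away from the other box, the remaining ones can be changed freely;
  a third coordinate serves as guard between the starting point and the centre \<open>x\<close>.\<close>

lemma ex_entrance_pos: "\<exists>a\<in>cube L. 0 < entrance a"
proof (rule ccontr)
  assume "\<not> (\<exists>a\<in>cube L. 0 < entrance a)"
  then have none: "\<not> 0 < entrance a" if "a \<in> cube L" for a using that by blast
  have hit0: "hit n (x + a) = 0" if "a \<in> cube L" for n a
  proof -
    have "inA (x + a)" using that by (rule inA_cube)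
    then have "summable (\<lambda>n. hit n (x + a))" by (rule hit_summable)
    then have "\<not> 0 < (\<Sum>n. hit n (x + a)) \<Longrightarrow> hit n (x + a) = 0"
      using suminf_pos2[of "\<lambda>n. hit n (x + a)" n] hit_nonneg by (metis order_le_less)
    then show ?thesis using none[OF that] by (simp add: entrance_def)
  qed
  have hit_cong: "hit n y = hit n z" if "wrap N y = wrap N z" for n y z
    using that by (simp add: hit_def)
  \<comment> \<open>If the box around \<open>x\<close> is never entered, positivity of the forward
    weight spreads to every neighbour off the other small box. It is led to \<open>x\<close> itself,
    where the weight vanishes by definition.\<close>
  define P where "P y \<longleftrightarrow> (\<exists>n. 0 < fwd n y)" for y
  have step: "P (y + e)" if Py: "P y" and that: "e \<in> unit_steps" "\<not> near N xo L (y + e)" for y e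
  proof -
    obtain n where n: "0 < fwd n y" using Py by (auto simp: P_def)
    have h: "0 < step_mean (fwd n) (y + e)"
    proof -
      have "0 < valency TYPE('d) * step_mean (fwd n) (y + e)"
        using fwd_le_mean[OF that(1), of n y] n by linarith
      moreover have "0 < valency TYPE('d)" using card_unit_steps_pos[where 'd='d] by linarith
      ultimately show ?thesis by (rule zero_less_mult_pos)
    qed
    have "\<not> inA (y + e)"
    proof
      assume "inA (y + e)"
      then have "near N x L (y + e)" using that(2) by (simp add: inA_def)
      then obtain a where a: "a \<in> cube L" "wrap N (x + a) = wrap N (y + e)" by (auto simp: near_def)
      then have "hit n (y + e) = 0" using hit0[OF a(1)] hit_cong[OF a(2)] by simp
      then show False using h by (simp add: hit_eq)
    qed
    then have "0 < fwd (Suc n) (y + e)" using h by (simp add: fwd_Suc)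
    then show ?thesis by (auto simp: P_def)
  qed
  have move: "P z" if "P y" "guarded j y" "z $ j = y $ j" for y z :: "int ^ 'd" and j
  proof -
    obtain \<rho> where \<rho>: "y \<in> cube \<rho>" "z \<in> cube \<rho>" using ex_common_cube[of y z] by blast
    have "n = (\<Sum>i\<in>UNIV. nat \<bar>y $ i - z $ i\<bar>) \<Longrightarrow> y \<in> cube \<rho> \<Longrightarrow> P y \<Longrightarrow> guarded j y \<Longrightarrow> z $ j = y $ j \<Longrightarrow> P z" for n y
    proof (induction n arbitrary: y)
      case 0
      then have "y = z" by (auto simp: vec_eq_iff)
      then show ?case using 0 by simp
    next
      case (Suc n)
      then have "y \<noteq> z" by auto
      then obtain e where e: "e \<in> unit_steps" "y + e \<in> cube \<rho>"
        "(\<Sum>i\<in>UNIV. nat \<bar>y $ i - z $ i\<bar>) = Suc (\<Sum>i\<in>UNIV. nat \<bar>(y + e) $ i - z $ i\<bar>)"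
        and keep: "\<And>i. y $ i = z $ i \<Longrightarrow> (y + e) $ i = y $ i"
        using cube_geodesic_step[OF Suc.prems(2) \<rho>(2)] by blast
      have same: "(y + e) $ j = y $ j" using Suc.prems(5) by (intro keep) simp
      have g: "guarded j (y + e)" using Suc.prems(4) unfolding guarded_def same .
      show ?case
      proof (rule Suc.IH[of "y + e"])
        show "P (y + e)" by (rule step[OF Suc.prems(3) e(1) guarded_not_near[OF g]])
        show "n = (\<Sum>i\<in>UNIV. nat \<bar>(y + e) $ i - z $ i\<bar>)" using e(3) Suc.prems(1) by simp
        show "z $ j = (y + e) $ j" unfolding same by (rule Suc.prems(5))
      qed (use e g in auto)
    qed
    then show ?thesis using \<rho>(1) that by blast
  qed
  obtain j where j: "guarded j u" using ex_guarded[OF u_out(2) L_le_r] by blast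
  have "\<not> near N xo (2 * r + 2) x" using sep by (simp add: near_sym)
  then obtain k where k: "guarded k x" using ex_guarded[of "2 * r + 2" x] L_le_r by auto
  obtain i where i: "i \<noteq> j" "i \<noteq> k"
  proof -
    have "card {j, k} \<le> 2" by (simp add: card_insert_if)
    then have "{j, k} \<noteq> UNIV" using dim by (metis not_less_eq_eq numeral_2_eq_2 numeral_3_eq_3 order_trans)
    then show ?thesis using that by blast
  qed
  \<comment> \<open>A value at distance \<open>r + 1\<close> from the coordinate of
    \<open>xo\<close>; as \<open>N\<close> is at least \<open>4 * r + 6\<close>, its periodic copies
    are farther away. The route from \<open>u\<close> over \<open>z1\<close> and \<open>z2\<close>
    to \<open>x\<close> is guarded by \<open>j\<close>, \<open>i\<close> and \<open>k\<close> in
    turn.\<close>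
  define away where "away = xo $ i + int r + 1"
  define z1 where "z1 = (\<chi> m. if m = i then away else u $ m)"
  define z2 where "z2 = (\<chi> m. if m = i then away else x $ m)"
  have gi: "guarded i z" if "z $ i = away" for z
    unfolding guarded_def
  proof
    fix k' :: int
    have *: "z $ i - xo $ i - int N * k' = int r + 1 - int N * k'" by (simp add: that away_def)
    consider "k' = 0" | "1 \<le> k'" | "k' \<le> -1" by linarith
    then show "int L < \<bar>z $ i - xo $ i - int N * k'\<bar>"
    proof cases
      case 1 then show ?thesis unfolding * using L_le_r by simp
    next
      case 2
      then have "int N * 1 \<le> int N * k'" by (intro mult_left_mono) auto
      then show ?thesis unfolding * using Nr L_le_r by linarith
    next
      case 3
      then have "int N * k' \<le> int N * (-1)" by (intro mult_left_mono) auto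
      then show ?thesis unfolding * using Nr L_le_r by linarith
    qed
  qed
  have "P u" unfolding P_def by (intro exI[of _ 0]) (simp add: fwd_0)
  then have "P z1" by (rule move[OF _ j]) (use i in \<open>simp add: z1_def\<close>)
  then have "P z2" by (rule move[OF _ gi]) (simp_all add: z1_def z2_def)
  moreover have "guarded k z2" using k i unfolding guarded_def by (simp add: z2_def)
  ultimately have "P x" by (rule move) (use i in \<open>simp add: z2_def\<close>)
  then obtain n where "0 < fwd n x" by (auto simp: P_def)
  moreover have "inA x" using near_add[of 0 L N x] by (simp add: inA_def)
  ultimately show False by (simp add: fwd_inA)
qed

text \<open>The scalar \<open>\<kappa>\<close> is never computed, since it cancels in the
  conditional probability. Its positivity follows from the upper bound at a point with positive
  entrance weight.\<close>

lemma entrance_bounds: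
  assumes "cube_harnack_const TYPE('d) * real L \<le> real r"
  obtains \<kappa> where "0 < \<kappa>"
    "\<And>a. a \<in> cube L \<Longrightarrow> entrance a \<le> \<kappa> * (step_mean (escape L) a + exit_const TYPE('d) * real L / real r)"
    "\<And>a. a \<in> cube L \<Longrightarrow> \<kappa> * (step_mean (escape L) a - exit_const TYPE('d) * real L / real r) \<le> entrance a"
proof -
  define B where "B = (\<Sum>z\<in>cube (Suc r). occupation z)"
  have B: "occupation z \<le> B" for z
  proof (cases "z \<in> cube (Suc r)")
    case True
    then show ?thesis unfolding B_def using occupation_nonneg by (intro member_le_sum) auto
  next
    case False
    then have "occupation z = 0" by (simp add: occupation_def)
    also have "0 \<le> B" unfolding B_def using occupation_nonneg by (intro sum_nonneg)
    finally show ?thesis .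
  qed
  \<comment> \<open>Unlike on the exit side, no probability is at hand to serve as \<open>M\<close>;
    it is solved for with the occupation as exterior values.\<close>
  obtain M where M: "\<And>z. 0 \<le> M z" "\<And>z. M z \<le> B" "\<And>z. z \<notin> cube r \<Longrightarrow> M z = occupation z"
    "\<And>z. z \<in> cube r \<Longrightarrow> step_mean M z = M z"
    using dirichlet_problem[of occupation B "cube r"] occupation_nonneg B by metis
  have b: "entrance a \<le> M 0 * (step_mean (escape L) a + exit_const TYPE('d) * real L / real r)"
    "M 0 * (step_mean (escape L) a - exit_const TYPE('d) * real L / real r) \<le> entrance a"
    if "a \<in> cube L" for a
    unfolding entrance_eq[OF that]
    using mean_near_cube(2,3)[OF dim L1 assms occupation_inner occupation_harmonic M(1) M(4) _ that] M(3)
    by auto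
  obtain a where a: "a \<in> cube L" "0 < entrance a" using ex_entrance_pos by blast
  have "M 0 \<noteq> 0" using b(1)[OF a(1)] a(2) by auto
  then have "0 < M 0" using M(1)[of 0] by simp
  then show ?thesis using that b by blast
qed

lemma exit_bounds:
  assumes "cube_harnack_const TYPE('d) * real L \<le> real r" "a \<in> cube L"
  shows "(1 - cube_harnack_const TYPE('d) * real L / real r) * exit_prob 0 \<le> exit_prob a"
    and "step_mean exit_avoid_prob a
      \<le> exit_prob 0 * (step_mean (escape L) a + exit_const TYPE('d) * real L / real r)"
  using mean_near_cube(1,2)[OF dim L1 assms(1) exit_avoid_prob_inner exit_avoid_prob_harmonic
      exit_prob_nonneg exit_prob_harmonic exit_avoid_prob_outer assms(2)] by auto

section \<open>Probabilities of an excursion and of the conditioning event\<close>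

definition follows :: "nat \<Rightarrow> (int ^ 'd) list \<Rightarrow> (nat \<Rightarrow> int ^ 'd) \<Rightarrow> bool" where
  "follows n ws \<xi> \<longleftrightarrow> fresh n \<xi> \<and> (\<forall>j<length ws. wrap N (pos u \<xi> (Suc n + j)) = wrap N (x + ws ! j))"

lemma pred_follows [measurable]: "Measurable.pred step_seq (follows n ws)"
proof -
  have "Measurable.pred trajectories (\<lambda>X. (\<forall>k\<le>n. \<not> inA (X k)) \<and>
      (\<forall>j<length ws. wrap N (X (Suc n + j)) = wrap N (x + ws ! j)))" by measurable
  from pred_pos[OF this] show ?thesis unfolding follows_def[abs_def] fresh_def .
qed

lemma depends_on_follows: "depends_on (n + length ws) (follows n ws)"
  unfolding depends_on_def follows_def
proof (intro allI impI)
  fix \<xi> \<xi>' :: "nat \<Rightarrow> int ^ 'd" assume a: "\<forall>k<n + length ws. \<xi> k = \<xi>' k"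
  then have "fresh n \<xi> = fresh n \<xi>'" using depends_on_fresh[of n] unfolding depends_on_def by simp
  moreover have "pos u \<xi> (Suc n + j) = pos u \<xi>' (Suc n + j)" if "j < length ws" for j
    using a that by (intro pos_cong) auto
  ultimately show "(fresh n \<xi> \<and> (\<forall>j<length ws. wrap N (pos u \<xi> (Suc n + j)) = wrap N (x + ws ! j)))
     = (fresh n \<xi>' \<and> (\<forall>j<length ws. wrap N (pos u \<xi>' (Suc n + j)) = wrap N (x + ws ! j)))"
    by simp
qed

text \<open>In \<open>follows\<close> the time \<open>n\<close> is the last one before the entrance,
  so \<open>ws\<close> occupies the times from \<open>Suc n\<close> to
  \<open>n + length ws\<close>.\<close>

lemma follows_last:
  assumes "ws \<noteq> []" "follows n ws \<xi>"
  shows "wrap N (pos u \<xi> (n + length ws)) = wrap N (x + last ws)"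
proof -
  have "wrap N (pos u \<xi> (Suc n + (length ws - 1))) = wrap N (x + ws ! (length ws - 1))"
    using assms unfolding follows_def by simp
  moreover have "Suc n + (length ws - 1) = n + length ws" using assms(1) by (cases ws) auto
  ultimately show ?thesis using assms(1) by (simp add: last_conv_nth del: pos_Suc)
qed

text \<open>Each further vertex costs a factor of at most \<open>1 / valency\<close>: two different
  unit steps remain different modulo \<open>N\<close>, so at most one step leads from the previous
  vertex to the new one.\<close>

lemma follows_prob:
  assumes "ws \<noteq> []"
  shows "sprob (follows n ws) \<le> hit n (x + hd ws) / valency TYPE('d) ^ (length ws - 1)"
  using assms
proof (induction ws rule: rev_induct)
  case (snoc v vs)
  show ?case
  proof (cases "vs = []")
    case True
    then show ?thesis by (simp add: hit_def follows_def[abs_def])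
  next
    case False
    let ?D = "valency TYPE('d)"
    have D: "1 \<le> ?D" by (rule card_unit_steps_pos)
    have "follows n (vs @ [v]) \<xi> \<longleftrightarrow> follows n vs \<xi> \<and> wrap N (pos u \<xi> (Suc (n + length vs))) = wrap N (x + v)" for \<xi>
      unfolding follows_def by (auto simp: nth_append less_Suc_eq simp del: pos_Suc)
    then have "sprob (follows n (vs @ [v]))
        = sprob (\<lambda>\<xi>. follows n vs \<xi> \<and> wrap N (pos u \<xi> (Suc (n + length vs))) = wrap N (x + v))"
      by presburger
    also have "\<dots> = step_mean (\<lambda>y. sprob (\<lambda>\<xi>. follows n vs \<xi> \<and> wrap N (pos u \<xi> (n + length vs)) = wrap N y)) (x + v)"
      by (rule forward_step[OF pred_follows depends_on_follows])
    also have "\<dots> \<le> sprob (follows n vs) / ?D"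
      unfolding step_mean_def
    proof (rule divide_right_mono)
      let ?I = "{e \<in> unit_steps. wrap N (x + last vs) = wrap N (x + v + e)}"
      have "(\<Sum>e\<in>unit_steps. sprob (\<lambda>\<xi>. follows n vs \<xi> \<and> wrap N (pos u \<xi> (n + length vs)) = wrap N (x + v + e)))
          = (\<Sum>e\<in>?I. sprob (\<lambda>\<xi>. follows n vs \<xi> \<and> wrap N (pos u \<xi> (n + length vs)) = wrap N (x + v + e)))"
      proof (rule sum.mono_neutral_right)
        show "\<forall>e\<in>unit_steps - ?I. sprob (\<lambda>\<xi>. follows n vs \<xi> \<and> wrap N (pos u \<xi> (n + length vs)) = wrap N (x + v + e)) = 0"
        proof
          fix e assume e: "e \<in> unit_steps - ?I"
          have "(\<lambda>\<xi>. follows n vs \<xi> \<and> wrap N (pos u \<xi> (n + length vs)) = wrap N (x + v + e)) = (\<lambda>_. False)"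
            using follows_last[OF False] e by fastforce
          then show "sprob (\<lambda>\<xi>. follows n vs \<xi> \<and> wrap N (pos u \<xi> (n + length vs)) = wrap N (x + v + e)) = 0"
            by (simp add: sprob_def)
        qed
      qed auto
      also have "\<dots> \<le> (\<Sum>e\<in>?I. sprob (follows n vs))"
        by (intro sum_mono sprob_mono pred_follows) auto
      also have "\<dots> = real (card ?I) * sprob (follows n vs)" by simp
      also have "\<dots> \<le> 1 * sprob (follows n vs)"
      proof (intro mult_right_mono)
        have "e = e'" if "e \<in> ?I" "e' \<in> ?I" for e e'
        proof -
          have "wrap N (x + v + e) = wrap N (x + v + e')" using that by auto
          then have "wrap N e = wrap N e'" by (simp only: wrap_add_left_iff)
          then show ?thesis using that unit_step_in_cube Nr
            by (intro wrap_inj_cube[of e 1 e' 1 N]) auto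
        qed
        then have "card ?I \<le> 1" using card_le_Suc0_iff_eq[of ?I] by auto
        then show "real (card ?I) \<le> 1" by simp
      qed simp
      finally show "(\<Sum>e\<in>unit_steps. sprob (\<lambda>\<xi>. follows n vs \<xi> \<and> wrap N (pos u \<xi> (n + length vs)) = wrap N (x + v + e)))
          \<le> sprob (follows n vs)" by simp
    qed simp
    also have "\<dots> \<le> hit n (x + hd vs) / ?D ^ (length vs - 1) / ?D"
      using snoc.IH[OF False] by (intro divide_right_mono) auto
    also have "\<dots> = hit n (x + hd (vs @ [v])) / ?D ^ (length (vs @ [v]) - 1)"
    proof -
      obtain m where "length vs = Suc m" using False by (cases vs) auto
      then have "length vs - 1 = m" "length (vs @ [v]) - 1 = Suc m" by simp_all
      then show ?thesis using False
        by (simp only: hd_append2[OF False] power_Suc divide_divide_eq_left mult.commute[of _ ?D])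
    qed
    finally show ?thesis .
  qed
qed simp

lemma follows_unique:
  assumes "ws \<noteq> []" "inA (x + hd ws)" "follows n ws \<xi>" "follows n' ws \<xi>"
  shows "n = n'"
proof -
  have hit: "inA (pos u \<xi> (Suc m))" if "follows m ws \<xi>" for m
  proof -
    have "wrap N (pos u \<xi> (Suc m + 0)) = wrap N (x + ws ! 0)"
      using that assms(1) unfolding follows_def by blast
    then show ?thesis using assms(1,2) inA_cong by (metis add.right_neutral hd_conv_nth)
  qed
  have "\<not> Suc m \<le> m'" if "follows m ws \<xi>" "follows m' ws \<xi>" for m m'
    using hit[OF that(1)] that(2) unfolding follows_def fresh_def by blast
  from this[of n n'] this[of n' n] show ?thesis using assms(3,4) by linarith
qed

text \<open>The exit is observed from the time after the last vertex, because
  \<open>exits_avoiding\<close> fails for a path that starts in a small box.\<close>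

definition excursion_event :: "(int ^ 'd) list \<Rightarrow> (nat \<Rightarrow> int ^ 'd) \<Rightarrow> bool" where
  "excursion_event ws \<xi> \<longleftrightarrow>
     (\<exists>n. follows n ws \<xi> \<and> exits_avoiding (\<lambda>k. wrap N (pos u \<xi> (n + length ws + Suc k))))"

lemma pred_excursion_summand:
  "Measurable.pred step_seq (\<lambda>\<xi>. follows n ws \<xi> \<and> exits_avoiding (\<lambda>k. wrap N (pos u \<xi> (n + length ws + Suc k))))"
proof -
  have "Measurable.pred step_seq (\<lambda>\<xi>. exits_avoiding (\<lambda>k. wrap N (pos u \<xi> (Suc (n + length ws) + k))))"
    by (rule pred_shifted_walk[OF pred_exits(2)])
  then have e: "Measurable.pred step_seq (\<lambda>\<xi>. exits_avoiding (\<lambda>k. wrap N (pos u \<xi> (n + length ws + Suc k))))"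
    unfolding add_Suc add_Suc_right .
  show ?thesis by (rule pred_intros_logic(3)[OF pred_follows e])
qed

lemma pred_excursion_event: "Measurable.pred step_seq (excursion_event ws)"
  unfolding excursion_event_def[abs_def] by (intro pred_intros_countable(2) pred_excursion_summand)

lemma excursion_prob:
  assumes "ws \<noteq> []" "hd ws \<in> cube L"
  shows "sprob (excursion_event ws)
    \<le> entrance (hd ws) / valency TYPE('d) ^ (length ws - 1) * step_mean exit_avoid_prob (last ws)"
proof -
  let ?D = "valency TYPE('d) ^ (length ws - 1)"
  let ?F = "step_mean exit_avoid_prob (last ws)"
  let ?E = "\<lambda>n \<xi>. follows n ws \<xi> \<and> exits_avoiding (\<lambda>k. wrap N (pos u \<xi> (n + length ws + Suc k)))"
  have A: "inA (x + hd ws)" using assms(2) by (rule inA_cube)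
  have F0: "0 \<le> ?F" by (intro step_mean_nonneg) (simp add: exit_avoid_prob_def)
  have sums: "(\<lambda>n. sprob (?E n)) sums sprob (excursion_event ws)"
    unfolding excursion_event_def[abs_def]
    by (rule sprob_sums[OF pred_excursion_summand]) (use follows_unique[OF assms(1) A] in blast)
  have each: "sprob (?E n) = sprob (follows n ws) * ?F" for n
  proof -
    have G: "Measurable.pred trajectories (\<lambda>X. exits_avoiding (\<lambda>k. X (Suc k)))"
      using measurable_compose[OF measurable_shift[of 1] pred_exits(2)] by (simp only: plus_1_eq_Suc)
    have "sprob (?E n) = sprob (follows n ws) * tprob N (x + last ws) (\<lambda>X. exits_avoiding (\<lambda>k. X (Suc k)))"
      by (rule markov_property[OF pred_follows depends_on_follows G follows_last[OF assms(1)]])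
    also have "tprob N (x + last ws) (\<lambda>X. exits_avoiding (\<lambda>k. X (Suc k)))
        = step_mean (\<lambda>y. tprob N y exits_avoiding) (x + last ws)"
      by (rule tprob_step[OF pred_exits(2)])
    also have "\<dots> = ?F" unfolding exit_avoid_prob_def[abs_def] by (rule step_mean_translate[symmetric])
    finally show ?thesis .
  qed
  have "(\<lambda>n. hit n (x + hd ws) / ?D * ?F) sums (entrance (hd ws) / ?D * ?F)"
    unfolding entrance_def by (intro sums_mult2 sums_divide summable_sums hit_summable A)
  from sums_le[OF _ sums this] show ?thesis
    unfolding each using mult_right_mono[OF follows_prob[OF assms(1)] F0] by blast
qed

definition departs :: "(nat \<Rightarrow> int ^ 'd) \<Rightarrow> bool" where
  "departs X \<longleftrightarrow> (\<exists>s. (\<forall>k<s. \<not> inA (X k)) \<and> inA (X s) \<and> exits_at_w (\<lambda>k. X (s + k)))"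

lemma pred_departs [measurable]: "Measurable.pred trajectories departs"
proof -
  have [measurable]: "Measurable.pred trajectories (\<lambda>X. exits_at_w (\<lambda>k. X (s + k)))" for s
    by (rule measurable_compose[OF measurable_shift pred_exits(1)])
  show ?thesis unfolding departs_def[abs_def] by measurable
qed

text \<open>This probability is going to be a denominator, so it suffices to count disjoint
  contributions: entrances at points of \<open>S\<close>, split by entrance time and place.\<close>

lemma depart_prob_ge:
  assumes "S \<subseteq> cube L"
  shows "(\<Sum>a\<in>S. entrance a * exit_prob a) \<le> tprob N u departs"
proof -
  let ?H = "\<lambda>n a \<xi>. fresh n \<xi> \<and> wrap N (pos u \<xi> (Suc n)) = wrap N (x + a)"
  let ?E = "\<lambda>n a \<xi>. ?H n a \<xi> \<and> exits_at_w (\<lambda>k. wrap N (pos u \<xi> (Suc n + k)))"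
  have fin: "finite S" using assms finite_subset finite_cube by blast
  have A: "inA (x + a)" if "a \<in> S" for a using assms that by (intro inA_cube) blast
  have mH: "Measurable.pred step_seq (?H n a)" for n a by measurable
  have mE: "Measurable.pred step_seq (?E n a)" for n a
    by (rule pred_intros_logic(3)[OF mH pred_shifted_walk[OF pred_exits(1)]])
  have depH: "depends_on (Suc n) (?H n a)" for n a
    using depends_on_follows[of n "[a]"] by (simp add: follows_def[abs_def])
  have each: "sprob (?E n a) = hit n (x + a) * exit_prob a" for n a
    unfolding hit_def exit_prob_def
    by (rule markov_property[OF mH depH pred_exits(1)]) blast
  have Sn: "sprob (\<lambda>\<xi>. \<exists>a\<in>S. ?E n a \<xi>) = (\<Sum>a\<in>S. hit n (x + a) * exit_prob a)" for n
  proof -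
    have "a = b" if "a \<in> S" "b \<in> S" "wrap N (x + a) = wrap N (x + b)" for a b
      using that assms Nr L_le_r by (intro wrap_inj_cube[of a L b L N]) (auto simp: wrap_add_left_iff)
    then have "sprob (\<lambda>\<xi>. \<exists>a\<in>S. ?E n a \<xi>) = (\<Sum>a\<in>S. sprob (?E n a))"
      by (intro sprob_sum_finite fin mE) metis
    then show ?thesis by (simp only: each)
  qed
  have mS: "Measurable.pred step_seq (\<lambda>\<xi>. \<exists>a\<in>S. ?E n a \<xi>)" for n
    by (rule pred_intros_finite(4)[OF fin mE])
  have "(\<lambda>n. sprob (\<lambda>\<xi>. \<exists>a\<in>S. ?E n a \<xi>)) sums sprob (\<lambda>\<xi>. \<exists>n. \<exists>a\<in>S. ?E n a \<xi>)"
  proof (rule sprob_sums[OF mS])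
    fix i j \<xi>
    assume "\<exists>a\<in>S. ?E i a \<xi>" "\<exists>a\<in>S. ?E j a \<xi>"
    then have a: "fresh i \<xi>" "fresh j \<xi>" "inA (pos u \<xi> (Suc i))" "inA (pos u \<xi> (Suc j))"
      using A inA_cong by blast+
    then have "\<not> Suc i \<le> j" "\<not> Suc j \<le> i" unfolding fresh_def by blast+
    then show "i = j" by linarith
  qed
  moreover have "(\<lambda>n. sprob (\<lambda>\<xi>. \<exists>a\<in>S. ?E n a \<xi>)) sums (\<Sum>a\<in>S. entrance a * exit_prob a)"
    unfolding Sn entrance_def by (intro sums_sum sums_mult2 summable_sums hit_summable A)
  ultimately have "(\<Sum>a\<in>S. entrance a * exit_prob a) = sprob (\<lambda>\<xi>. \<exists>n. \<exists>a\<in>S. ?E n a \<xi>)"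
    by (rule sums_unique2[symmetric])
  also have "\<dots> \<le> tprob N u departs"
    unfolding tprob_def
  proof (rule sprob_mono)
    show "Measurable.pred step_seq (\<lambda>\<xi>. departs (\<lambda>n. wrap N (pos u \<xi> n)))"
      by (rule measurable_compose[OF measurable_walk pred_departs])
    fix \<xi> assume "\<exists>n. \<exists>a\<in>S. ?E n a \<xi>"
    then obtain n a where na: "a \<in> S" "?E n a \<xi>" by blast
    then have "inA (pos u \<xi> (Suc n))" using A inA_cong by blast
    moreover have "\<forall>k<Suc n. \<not> inA (pos u \<xi> k)" using na(2) unfolding fresh_def by (simp add: less_Suc_eq_le)
    ultimately show "departs (\<lambda>n. wrap N (pos u \<xi> n))"
      unfolding departs_def inA_wrap using na(2) by blast
  qed
  finally show ?thesis .
qed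

section \<open>Cancellation of the unknown scalars in the density\<close>

definition face :: "(int ^ 'd) set" where
  "face = {a \<in> cube L. \<exists>i. \<bar>a $ i\<bar> = int L}"

lemma capacity_face: "capacity TYPE('d) L = (\<Sum>a\<in>face. step_mean (escape L) a)"
proof -
  have "capacity TYPE('d) L = (\<Sum>a\<in>cube L. step_mean (escape L) (a :: int ^ 'd))"
    unfolding capacity_def by (intro sum.cong refl escape_prob_eq)
  also have "\<dots> = (\<Sum>a\<in>face. step_mean (escape L) a)"
  proof (rule sum.mono_neutral_right)
    show "\<forall>a\<in>cube L - face. step_mean (escape L) a = 0"
    proof
      fix a assume a: "a \<in> cube L - face"
      have "a + e \<in> cube L" if "e \<in> unit_steps" for e
        using face_of_cube_step[of a L e] a that by (auto simp: face_def)
      then have "step_mean (escape L) a = step_mean (\<lambda>_. 0) a"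
        by (intro step_mean_cong escape_in_cube)
      then show "step_mean (escape L) a = 0" by simp
    qed
  qed (auto simp: face_def)
  finally show ?thesis .
qed

text \<open>The additive error \<open>exit_const * L / r\<close> divided by the lower bound
  \<open>escape_const / L\<close> for the equilibrium weights on the face.\<close>

definition rate :: real where
  "rate = exit_const TYPE('d) / escape_const TYPE('d) * (real L)\<^sup>2 / real r"

lemma excursion_ratio:
  assumes small: "rate \<le> 1 / 2" and ws: "ws \<noteq> []" "hd ws \<in> face" "last ws \<in> face"
  shows "0 < tprob N u departs"
    and "sprob (excursion_event ws) / tprob N u departs
      \<le> (1 + 16 * rate) * (step_mean (escape L) (hd ws) / capacity TYPE('d) L
          * (step_mean (escape L) (last ws) / valency TYPE('d) ^ (length ws - 1)))"
proof -
  let ?b = "step_mean (escape L) :: int ^ 'd \<Rightarrow> real"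
  let ?c = "cube_harnack_const TYPE('d)"
  let ?C = "exit_const TYPE('d)"
  let ?k = "escape_const TYPE('d)"
  let ?D = "valency TYPE('d) ^ (length ws - 1)"
  define \<epsilon> where "\<epsilon> = rate"
  have r0: "0 < real r" and L0: "1 \<le> real L" using L1 rL by auto
  have D: "1 \<le> valency TYPE('d)" by (rule card_unit_steps_pos)
  have D0: "0 < ?D" using D by simp
  have k: "0 < ?k" by (rule escape_const_pos)
  have c8: "8 \<le> ?c" by (rule cube_harnack_const_ge)
  have cC: "?c \<le> ?C" using c8 by (simp add: exit_const_def hit_const_def)
  have face_ge: "?k / real L \<le> ?b a" if "a \<in> face" for a
    using that mean_escape_lower[OF dim L1, of a] by (auto simp: face_def)
  have k1: "?k / real L \<le> 1"
    using face_ge[OF ws(2)] mean_escape_bounds(2)[of L "hd ws"] by linarith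
  have \<epsilon>: "?C * real L / real r = \<epsilon> * (?k / real L)"
    unfolding \<epsilon>_def rate_def using k L0 r0 by (simp add: power2_eq_square)
  have \<epsilon>0: "0 \<le> \<epsilon>" unfolding \<epsilon>_def rate_def using k cC c8 by simp
  have C\<epsilon>: "?C * real L / real r \<le> \<epsilon>" unfolding \<epsilon> using k1 \<epsilon>0 by (rule mult_left_le)
  have c\<epsilon>: "?c * real L / real r \<le> \<epsilon>"
  proof -
    have "?c * real L / real r \<le> ?C * real L / real r"
      using cC by (intro divide_right_mono mult_right_mono) auto
    then show ?thesis using C\<epsilon> by linarith
  qed
  have \<epsilon>2: "\<epsilon> \<le> 1 / 2" using small by (simp add: \<epsilon>_def)
  have cL: "?c * real L \<le> real r"
  proof -
    have "?c * real L / real r \<le> 1" using c\<epsilon> \<epsilon>2 by linarith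
    then show ?thesis using r0 by (simp add: divide_le_eq)
  qed
  have face_cube: "a \<in> cube L" if "a \<in> face" for a using that by (simp add: face_def)
  \<comment> \<open>The additive error becomes relative here, which is the source of the second
    factor \<open>L\<close> in the final bound.\<close>
  have err: "?C * real L / real r \<le> \<epsilon> * ?b a" if "a \<in> face" for a
    unfolding \<epsilon> using face_ge[OF that] \<epsilon>0 by (rule mult_left_mono)
  obtain \<kappa> where \<kappa>: "0 < \<kappa>"
    and \<kappa>up: "\<And>a. a \<in> cube L \<Longrightarrow> entrance a \<le> \<kappa> * (?b a + ?C * real L / real r)"
    and \<kappa>low: "\<And>a. a \<in> cube L \<Longrightarrow> \<kappa> * (?b a - ?C * real L / real r) \<le> entrance a"
    using entrance_bounds[OF cL] by metis
  define \<mu> where "\<mu> = exit_prob 0"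
  have \<mu>: "0 < \<mu>" unfolding \<mu>_def by (rule exit_prob_pos)
  have ent_up: "entrance a \<le> \<kappa> * ((1 + \<epsilon>) * ?b a)" if "a \<in> face" for a
  proof -
    have "\<kappa> * (?b a + ?C * real L / real r) \<le> \<kappa> * ((1 + \<epsilon>) * ?b a)"
      using err[OF that] \<kappa> by (intro mult_left_mono) (auto simp: distrib_right)
    then show ?thesis using \<kappa>up[OF face_cube[OF that]] by linarith
  qed
  have ent_low: "\<kappa> * ((1 - \<epsilon>) * ?b a) \<le> entrance a" if "a \<in> face" for a
  proof -
    have "\<kappa> * ((1 - \<epsilon>) * ?b a) \<le> \<kappa> * (?b a - ?C * real L / real r)"
      using err[OF that] \<kappa> by (intro mult_left_mono) (auto simp: left_diff_distrib)
    then show ?thesis using \<kappa>low[OF face_cube[OF that]] by linarith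
  qed
  have exit_low: "(1 - \<epsilon>) * \<mu> \<le> exit_prob a" if "a \<in> face" for a
  proof -
    have "(1 - \<epsilon>) * \<mu> \<le> (1 - ?c * real L / real r) * \<mu>"
      using c\<epsilon> \<mu> by (intro mult_right_mono) auto
    then show ?thesis using exit_bounds(1)[OF cL face_cube[OF that]] unfolding \<mu>_def by linarith
  qed
  have exit_up: "step_mean exit_avoid_prob a \<le> \<mu> * ((1 + \<epsilon>) * ?b a)" if "a \<in> face" for a
  proof -
    have "\<mu> * (?b a + ?C * real L / real r) \<le> \<mu> * ((1 + \<epsilon>) * ?b a)"
      using err[OF that] \<mu> by (intro mult_left_mono) (auto simp: distrib_right)
    then show ?thesis using exit_bounds(2)[OF cL face_cube[OF that]] unfolding \<mu>_def by linarith
  qed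
  define cap where "cap = capacity TYPE('d) L"
  have cap: "cap = (\<Sum>a\<in>face. ?b a)" unfolding cap_def by (rule capacity_face)
  have finF: "finite face" unfolding face_def using finite_cube by simp
  have b0: "0 \<le> ?b a" for a by (rule mean_escape_bounds)
  have bpos: "0 < ?b a" if "a \<in> face" for a
  proof -
    have "0 < ?k / real L" using k L0 by simp
    then show ?thesis using face_ge[OF that] by linarith
  qed
  have cap0: "0 < cap" unfolding cap using bpos ws(2) finF by (intro sum_pos) auto
  \<comment> \<open>\<open>\<kappa>\<close> and \<open>\<mu>\<close> appear here in the same product
    as in the bound for the numerator, while the sum over the face produces the capacity that
    normalises the equilibrium measure.\<close>
  have den: "\<kappa> * \<mu> * (1 - \<epsilon>)\<^sup>2 * cap \<le> tprob N u departs"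
  proof -
    have "\<kappa> * \<mu> * (1 - \<epsilon>)\<^sup>2 * cap = (\<Sum>a\<in>face. (\<kappa> * ((1 - \<epsilon>) * ?b a)) * ((1 - \<epsilon>) * \<mu>))"
      unfolding cap by (simp add: sum_distrib_left power2_eq_square ac_simps)
    also have "\<dots> \<le> (\<Sum>a\<in>face. entrance a * exit_prob a)"
      using \<epsilon>2 \<mu> by (intro sum_mono mult_mono ent_low exit_low entrance_nonneg face_cube) auto
    also have "\<dots> \<le> tprob N u departs" by (rule depart_prob_ge) (auto simp: face_def)
    finally show ?thesis .
  qed
  have e1: "0 < (1 - \<epsilon>)\<^sup>2" using \<epsilon>2 by simp
  have den0: "0 < \<kappa> * \<mu> * (1 - \<epsilon>)\<^sup>2 * cap" using \<kappa> \<mu> e1 cap0 by simp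
  show "0 < tprob N u departs" using den den0 by linarith
  have num: "sprob (excursion_event ws)
      \<le> \<kappa> * ((1 + \<epsilon>) * ?b (hd ws)) / ?D * (\<mu> * ((1 + \<epsilon>) * ?b (last ws)))"
  proof -
    have "sprob (excursion_event ws) \<le> entrance (hd ws) / ?D * step_mean exit_avoid_prob (last ws)"
      by (rule excursion_prob[OF ws(1) face_cube[OF ws(2)]])
    also have "\<dots> \<le> \<kappa> * ((1 + \<epsilon>) * ?b (hd ws)) / ?D * (\<mu> * ((1 + \<epsilon>) * ?b (last ws)))"
    proof (intro mult_mono divide_right_mono ent_up exit_up ws)
      show "0 \<le> \<kappa> * ((1 + \<epsilon>) * ?b (hd ws)) / ?D"
        using \<kappa> \<epsilon>0 b0 D0 by (intro divide_nonneg_pos mult_nonneg_nonneg) auto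
      show "0 \<le> step_mean exit_avoid_prob (last ws)"
        by (intro step_mean_nonneg) (simp add: exit_avoid_prob_def)
    qed (use D0 in simp)
    finally show ?thesis .
  qed
  let ?P = "?b (hd ws) * ?b (last ws)"
  have P0: "0 \<le> ?P" using b0 by simp
  have "sprob (excursion_event ws) / tprob N u departs
      \<le> (\<kappa> * ((1 + \<epsilon>) * ?b (hd ws)) / ?D * (\<mu> * ((1 + \<epsilon>) * ?b (last ws)))) / (\<kappa> * \<mu> * (1 - \<epsilon>)\<^sup>2 * cap)"
    using num den den0 by (intro frac_le) (auto intro: order_trans[OF sprob_nonneg])
  also have "\<dots> = ((1 + \<epsilon>) / (1 - \<epsilon>))\<^sup>2 * (?P / (cap * ?D))"
    using \<kappa> \<mu> by (simp add: power2_eq_square ac_simps)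
  \<comment> \<open>For \<epsilon> up to one half,
    \<open>(1 + \<epsilon>) / (1 - \<epsilon>)\<close> is at most \<open>1 + 4 * \<epsilon>\<close>,
    and the square of the latter at most \<open>1 + 16 * \<epsilon>\<close>.\<close>
  also have "\<dots> \<le> (1 + 16 * \<epsilon>) * (?P / (cap * ?D))"
  proof (rule mult_right_mono)
    have "1 + \<epsilon> \<le> (1 + 4 * \<epsilon>) * (1 - \<epsilon>)"
    proof -
      have "0 \<le> \<epsilon> * (2 - 4 * \<epsilon>)" using \<epsilon>0 \<epsilon>2 by (intro mult_nonneg_nonneg) auto
      then show ?thesis by (simp add: algebra_simps)
    qed
    then have "(1 + \<epsilon>) / (1 - \<epsilon>) \<le> 1 + 4 * \<epsilon>" using \<epsilon>2 by (simp add: divide_le_eq)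
    then have "((1 + \<epsilon>) / (1 - \<epsilon>))\<^sup>2 \<le> (1 + 4 * \<epsilon>)\<^sup>2" using \<epsilon>0 \<epsilon>2 by (intro power_mono) auto
    also have "(1 + 4 * \<epsilon>)\<^sup>2 \<le> 1 + 16 * \<epsilon>"
    proof -
      have "0 \<le> \<epsilon> * (8 - 16 * \<epsilon>)" using \<epsilon>0 \<epsilon>2 by (intro mult_nonneg_nonneg) auto
      then show ?thesis by (simp add: power2_eq_square algebra_simps)
    qed
    finally show "((1 + \<epsilon>) / (1 - \<epsilon>))\<^sup>2 \<le> 1 + 16 * \<epsilon>" .
    show "0 \<le> ?P / (cap * ?D)" using P0 cap0 D0 by simp
  qed
  finally show "sprob (excursion_event ws) / tprob N u departs
      \<le> (1 + 16 * rate) * (?b (hd ws) / capacity TYPE('d) L * (?b (last ws) / ?D))"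
    unfolding \<epsilon>_def cap_def by simp
qed

end

section \<open>Excursion laws and total variation\<close>

lemma Inf_enat_eq_iff: "Inf {enat n |n. P n} = enat m \<longleftrightarrow> P m \<and> (\<forall>k<m. \<not> P k)"
proof
  assume eq: "Inf {enat n |n. P n} = enat m"
  then have ne: "{enat n |n. P n} \<noteq> {}" by (metis Inf_enat_def enat.distinct(2))
  then have "Inf {enat n |n. P n} \<in> {enat n |n. P n}"
    unfolding Inf_enat_def by (simp only: if_False) (metis (mono_tags) LeastI ex_in_conv)
  then have "P m" unfolding eq by simp
  moreover have "\<not> P k" if "k < m" for k
  proof
    assume "P k"
    then have "Inf {enat n |n. P n} \<le> enat k" by (intro Inf_lower) blast
    then show False using that unfolding eq by simp
  qed
  ultimately show "P m \<and> (\<forall>k<m. \<not> P k)" by blast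
next
  assume a: "P m \<and> (\<forall>k<m. \<not> P k)"
  show "Inf {enat n |n. P n} = enat m"
  proof (rule antisym)
    show "Inf {enat n |n. P n} \<le> enat m" using a by (intro Inf_lower) blast
    show "enat m \<le> Inf {enat n |n. P n}"
      using a by (intro Inf_greatest) (auto simp: not_less[symmetric])
  qed
qed

text \<open>The premise matters because the supremum of the empty set is \<open>0\<close>, a finite
  time that would be mistaken for a visit.\<close>

lemma Sup_enat_eq_iff:
  assumes "P n"
  shows "Sup {enat n |n. P n} = enat m \<longleftrightarrow> P m \<and> (\<forall>k>m. \<not> P k)"
proof
  assume eq: "Sup {enat n |n. P n} = enat m"
  have up: "k \<le> m" if "P k" for k
  proof -
    have "enat k \<le> Sup {enat n |n. P n}" using that by (intro Sup_upper) blast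
    then show ?thesis unfolding eq by simp
  qed
  have fin: "finite {enat n |n. P n}"
    by (rule finite_subset[of _ "enat ` {..m}"]) (use up in auto)
  have ne: "{enat n |n. P n} \<noteq> {}" using assms by blast
  have "Sup {enat n |n. P n} = Max {enat n |n. P n}" unfolding Sup_enat_def by (simp only: fin ne if_False if_True)
  then have "enat m \<in> {enat n |n. P n}" using Max_in[OF fin ne] unfolding eq by simp
  then show "P m \<and> (\<forall>k>m. \<not> P k)" using up by (auto simp: not_le[symmetric])
next
  assume a: "P m \<and> (\<forall>k>m. \<not> P k)"
  show "Sup {enat n |n. P n} = enat m"
  proof (rule antisym)
    show "Sup {enat n |n. P n} \<le> enat m" using a by (intro Sup_least) (auto simp: not_less[symmetric])
    show "enat m \<le> Sup {enat n |n. P n}" using a by (intro Sup_upper) blast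
  qed
qed

lemma entry_time_eq_iff: "entry_time A X = enat s \<longleftrightarrow> X s \<in> A \<and> (\<forall>k<s. X k \<notin> A)"
  unfolding entry_time_def by (rule Inf_enat_eq_iff)

lemma departure_time_eq_iff:
  assumes s: "entry_time A X = enat s"
  shows "departure_time A B X = enat m \<longleftrightarrow> s \<le> m \<and> X m \<notin> B \<and> (\<forall>k. s \<le> k \<and> k < m \<longrightarrow> X k \<in> B)"
  unfolding departure_time_def Inf_enat_eq_iff s by auto

lemma departure_time_finite:
  assumes "departure_time A B X = enat m" shows "\<exists>s. entry_time A X = enat s"
  using assms unfolding departure_time_def Inf_enat_eq_iff by (cases "entry_time A X") auto

lemma last_visit_before_departure_eq_iff:
  assumes s: "entry_time A X = enat s" and m: "departure_time A B X = enat m" and "A \<subseteq> B"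
  shows "last_visit_before_departure A B X = enat t
    \<longleftrightarrow> s \<le> t \<and> t < m \<and> X t \<in> A \<and> (\<forall>k. t < k \<and> k < m \<longrightarrow> X k \<notin> A)"
proof -
  have "X s \<in> A" using s by (simp add: entry_time_eq_iff)
  moreover have sm: "s \<le> m" "X m \<notin> B" using m departure_time_eq_iff[OF s] by auto
  ultimately have "s < m" using \<open>A \<subseteq> B\<close> by (metis le_neq_implies_less subsetD)
  have eq: "last_visit_before_departure A B X = Sup {enat n |n. s \<le> n \<and> n < m \<and> X n \<in> A}"
    by (simp add: last_visit_before_departure_def s m)
  show ?thesis unfolding eq
    using Sup_enat_eq_iff[of "\<lambda>n. s \<le> n \<and> n < m \<and> X n \<in> A" s t] \<open>X s \<in> A\<close> \<open>s < m\<close> by auto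
qed

lemma last_visit_eq:
  assumes "X t \<in> A" "\<And>k. t < k \<Longrightarrow> X k \<notin> A" shows "last_visit A X = enat t"
  unfolding last_visit_def using Sup_enat_eq_iff[of "\<lambda>n. X n \<in> A" t t] assms by simp

text \<open>Countable additivity, carried along \<open>to_nat\<close> from a series to the unordered
  sums in which the total variation norm is expressed.\<close>

lemma has_sum_measure_countable:
  fixes E :: "'c::countable \<Rightarrow> 'a \<Rightarrow> bool"
  assumes "finite_measure M" and m: "\<And>w. w \<in> W \<Longrightarrow> {X\<in>space M. E w X} \<in> sets M"
    and disj: "\<And>w w' X. E w X \<Longrightarrow> E w' X \<Longrightarrow> w = w'"
  shows "((\<lambda>w. measure M {X\<in>space M. E w X}) has_sum measure M {X\<in>space M. \<exists>w\<in>W. E w X}) W"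
proof -
  interpret finite_measure M by fact
  define F where "F n = {X\<in>space M. \<exists>w\<in>W. to_nat w = n \<and> E w X}" for n
  have F1: "F (to_nat w) = {X\<in>space M. E w X}" if "w \<in> W" for w
    using that by (auto simp: F_def)
  have F2: "F n = {}" if "n \<notin> to_nat ` W" for n
    using that by (auto simp: F_def)
  have sF: "F n \<in> sets M" for n
    using F1 F2 m by (cases "n \<in> to_nat ` W") auto
  have "(\<lambda>n. measure M (F n)) sums measure M (\<Union>n. F n)"
  proof (rule finite_measure_UNION)
    show "range F \<subseteq> sets M" using sF by blast
    have "n = m" if "X \<in> F n" "X \<in> F m" for n m X
      using that disj unfolding F_def by blast
    then show "disjoint_family F" unfolding disjoint_family_on_def by blast
  qed
  then have "((\<lambda>n. measure M (F n)) has_sum measure M (\<Union>n. F n)) UNIV"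
    by (rule sums_nonneg_imp_has_sum) simp
  then have "((\<lambda>n. measure M (F n)) has_sum measure M (\<Union>n. F n)) (to_nat ` W)"
    by (subst has_sum_cong_neutral[where g="\<lambda>n. measure M (F n)" and T=UNIV]) (auto simp: F2)
  then have "((\<lambda>w. measure M (F (to_nat w))) has_sum measure M (\<Union>n. F n)) W"
    by (subst (asm) has_sum_reindex) (auto simp: comp_def)
  moreover have "(\<Union>n. F n) = {X\<in>space M. \<exists>w\<in>W. E w X}" by (auto simp: F_def)
  ultimately show ?thesis
    by (subst has_sum_cong[where g="\<lambda>w. measure M (F (to_nat w))"]) (auto simp: F1)
qed

lemma tv_norm_le:
  assumes "\<And>F. finite F \<Longrightarrow> F \<subseteq> W \<Longrightarrow> (\<Sum>w\<in>F. \<bar>\<nu> w\<bar>) \<le> b"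
  shows "tv_norm W \<nu> \<le> ennreal b"
  unfolding tv_norm_def
proof (rule infsum_le_finite_sums)
  show "(\<lambda>w. ennreal \<bar>\<nu> w\<bar>) summable_on W" by (rule nonneg_summable_on_complete) simp
  fix F assume "finite F" "F \<subseteq> W"
  then show "(\<Sum>w\<in>F. ennreal \<bar>\<nu> w\<bar>) \<le> ennreal b"
    using assms by (subst sum_ennreal) (auto intro: ennreal_leI)
qed

lemma tv_norm_le_two:
  assumes f: "(f has_sum F) W" "F \<le> 1" "\<And>w. 0 \<le> f w" and g: "(g has_sum G) W" "G \<le> 1" "\<And>w. 0 \<le> g w"
  shows "tv_norm W (\<lambda>w. f w - g w) \<le> ennreal 2"
proof (rule tv_norm_le)
  fix A assume A: "finite A" "A \<subseteq> W"
  have "(\<Sum>w\<in>A. \<bar>f w - g w\<bar>) \<le> (\<Sum>w\<in>A. f w + g w)"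
    using f(3) g(3) by (intro sum_mono) (auto simp: abs_le_iff add_increasing add_increasing2)
  also have "\<dots> = sum f A + sum g A" by (rule sum.distrib)
  also have "\<dots> \<le> F + G"
    using finite_sum_le_has_sum[OF f(1) A] finite_sum_le_has_sum[OF g(1) A] f(3) g(3) by (intro add_mono) auto
  finally show "(\<Sum>w\<in>A. \<bar>f w - g w\<bar>) \<le> 2" using f(2) g(2) by linarith
qed

text \<open>As \<open>f\<close> has total mass one, an upper bound on its density with respect to \<open>g\<close> suffices.\<close>

lemma tv_norm_le_of_density:
  assumes f: "(f has_sum 1) W" and g: "(g has_sum G) W" "G \<le> 1" "\<And>w. 0 \<le> g w"
    and \<delta>: "0 \<le> \<delta>" and le: "\<And>w. w \<in> W \<Longrightarrow> f w \<le> (1 + \<delta>) * g w"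
  shows "tv_norm W (\<lambda>w. f w - g w) \<le> ennreal (2 * \<delta>)"
proof (rule tv_norm_le)
  fix A assume A: "finite A" "A \<subseteq> W"
  let ?h = "\<lambda>w. (1 + 2 * \<delta>) * g w - f w"
  have h: "\<bar>f w - g w\<bar> \<le> ?h w" if "w \<in> W" for w
  proof -
    have "0 \<le> \<delta> * g w" using \<delta> g(3) by simp
    then show ?thesis using le[OF that] by (simp add: abs_le_iff algebra_simps)
  qed
  have "(\<Sum>w\<in>A. \<bar>f w - g w\<bar>) \<le> sum ?h A" using h A by (intro sum_mono) auto
  also have "\<dots> \<le> (1 + 2 * \<delta>) * G - 1"
  proof (rule finite_sum_le_has_sum[OF _ A])
    have "((\<lambda>w. (1 + 2 * \<delta>) * g w + (-1) * f w) has_sum (1 + 2 * \<delta>) * G + (-1) * 1) W"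
      by (intro has_sum_add has_sum_cmult_right f g)
    then show "(?h has_sum (1 + 2 * \<delta>) * G - 1) W" by simp
    show "0 \<le> ?h w" if "w \<in> W - A" for w using h[of w] that by auto
  qed
  also have "\<dots> \<le> (1 + 2 * \<delta>) * 1 - 1" using g(2) \<delta> by (intro diff_right_mono mult_left_mono) auto
  finally show "(\<Sum>w\<in>A. \<bar>f w - g w\<bar>) \<le> 2 * \<delta>" by simp
qed

section \<open>The limit law\<close>

lemma sprob_path:
  fixes ws :: "(int ^ 'd) list"
  assumes "ws \<noteq> []" "successively (\<lambda>a b. b - a \<in> unit_steps) ws"
  shows "sprob (\<lambda>\<xi>. \<forall>j<length ws. pos (hd ws) \<xi> j = ws ! j) = 1 / valency TYPE('d) ^ (length ws - 1)"
  using assms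
proof (induction ws rule: rev_induct)
  case (snoc v vs)
  show ?case
  proof (cases "vs = []")
    case True
    have "(\<lambda>\<xi>. \<forall>j<length (vs @ [v]). pos (hd (vs @ [v])) \<xi> j = (vs @ [v]) ! j) = (\<lambda>_. True)"
      using True by auto
    moreover have "sprob (\<lambda>_ :: nat \<Rightarrow> int ^ 'd. True) = 1"
      using prob_space.prob_space[OF prob_space_step_seq[where 'd='d]] by (simp add: sprob_def)
    ultimately show ?thesis using True by simp
  next
    case False
    then obtain m where m: "length vs = Suc m" by (cases vs) auto
    let ?E = "\<lambda>\<xi>. \<forall>j<length vs. pos (hd vs) \<xi> j = vs ! j"
    have last: "last vs = vs ! m" using False m by (simp add: last_conv_nth)
    have step: "v - last vs \<in> unit_steps" and succ: "successively (\<lambda>a b. b - a \<in> unit_steps) vs"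
      using snoc.prems False by (auto simp: successively_append_iff)
    have mE: "Measurable.pred step_seq ?E"
    proof -
      have "Measurable.pred trajectories (\<lambda>X. \<forall>j<length vs. X j = vs ! j)" by measurable
      from pred_pos[OF this] show ?thesis .
    qed
    have dep: "depends_on m ?E"
      unfolding depends_on_def
    proof (intro allI impI)
      fix \<xi> \<xi>' :: "nat \<Rightarrow> int ^ 'd" assume a: "\<forall>k<m. \<xi> k = \<xi>' k"
      then have "pos (hd vs) \<xi> j = pos (hd vs) \<xi>' j" if "j < length vs" for j
        using that m by (intro pos_cong) auto
      then show "?E \<xi> = ?E \<xi>'" by simp
    qed
    have "(\<forall>j<length (vs @ [v]). pos (hd (vs @ [v])) \<xi> j = (vs @ [v]) ! j) \<longleftrightarrow> ?E \<xi> \<and> \<xi> m = v - last vs" for \<xi>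
    proof -
      have "(\<forall>j<length (vs @ [v]). pos (hd (vs @ [v])) \<xi> j = (vs @ [v]) ! j)
          \<longleftrightarrow> ?E \<xi> \<and> pos (hd vs) \<xi> (Suc m) = v"
        using False m by (auto simp: nth_append less_Suc_eq simp del: pos_Suc)
      also have "\<dots> \<longleftrightarrow> ?E \<xi> \<and> \<xi> m = v - last vs"
        unfolding last using m by (auto simp: algebra_simps)
      finally show ?thesis .
    qed
    then have "sprob (\<lambda>\<xi>. \<forall>j<length (vs @ [v]). pos (hd (vs @ [v])) \<xi> j = (vs @ [v]) ! j)
        = sprob (\<lambda>\<xi>. ?E \<xi> \<and> \<xi> m = v - last vs)" by presburger
    also have "\<dots> = sprob ?E / valency TYPE('d)"
      using step by (simp only: sprob_step[OF mE dep] if_True)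
    also have "sprob ?E = 1 / valency TYPE('d) ^ m" using snoc.IH[OF False succ] m by simp
    finally show ?thesis using m by (simp add: mult.commute)
  qed
qed simp

lemma excursion_paths_iff:
  assumes "1 \<le> L"
  shows "ws \<in> excursion_paths L \<longleftrightarrow> ws \<noteq> [] \<and> successively (\<lambda>a b. b - a \<in> unit_steps) ws \<and>
    (hd ws \<in> cube L \<and> (\<exists>i. \<bar>hd ws $ i\<bar> = int L)) \<and> (last ws \<in> cube L \<and> (\<exists>i. \<bar>last ws $ i\<bar> = int L))"
  unfolding excursion_paths_def mem_Collect_eq dist2_eq_1_iff distinf_eq_iff[OF assms] by (rule refl)

definition last_excursion :: "nat \<Rightarrow> (int ^ 'd) list \<Rightarrow> (nat \<Rightarrow> int ^ 'd) \<Rightarrow> bool" where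
  "last_excursion L ws X \<longleftrightarrow> (\<exists>t. last_visit (cube L) X = enat t \<and> map X [0..<Suc t] = ws)"

lemma map_upt_eq_iff: "map f [s..<t] = ws \<longleftrightarrow> length ws = t - s \<and> (\<forall>j<length ws. f (s + j) = ws ! j)"
  by (auto simp: list_eq_iff_nth_eq)

text \<open>Separates the event into one of the path up to the last vertex and one of its future, as
  the Markov property requires. With the last vertex in the cube, the supremum in
  \<open>last_visit\<close> is over a nonempty set.\<close>

lemma last_excursion_iff:
  assumes "ws \<noteq> []" "last ws \<in> cube L"
  shows "last_excursion L ws X
    \<longleftrightarrow> (\<forall>j<length ws. X j = ws ! j) \<and> (\<forall>k. X (length ws + k) \<notin> cube L)"
proof -
  obtain m where m: "length ws = Suc m" using assms(1) by (cases ws) auto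
  have last: "last ws = ws ! m" using assms(1) m by (simp add: last_conv_nth)
  have shift: "(\<forall>k. X (length ws + k) \<notin> cube L) \<longleftrightarrow> (\<forall>k>m. X k \<notin> cube L)"
    unfolding m by (metis Suc_le_eq le_Suc_ex le_add1 less_eq_Suc_le)
  show ?thesis
  proof
    assume "last_excursion L ws X"
    then obtain t where t: "last_visit (cube L) X = enat t" "map X [0..<Suc t] = ws"
      by (auto simp: last_excursion_def)
    then have "length ws = Suc t" "\<forall>j<length ws. X j = ws ! j" by (simp_all only: map_upt_eq_iff) auto
    moreover then have "t = m" using m by simp
    moreover have "\<forall>k>m. X k \<notin> cube L"
    proof -
      have "X m \<in> cube L" using calculation(2) m last assms(2) by auto
      from Sup_enat_eq_iff[of "\<lambda>n. X n \<in> cube L" m t, OF this]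
      show ?thesis using t(1) \<open>t = m\<close> unfolding last_visit_def by blast
    qed
    ultimately show "(\<forall>j<length ws. X j = ws ! j) \<and> (\<forall>k. X (length ws + k) \<notin> cube L)"
      using shift by blast
  next
    assume a: "(\<forall>j<length ws. X j = ws ! j) \<and> (\<forall>k. X (length ws + k) \<notin> cube L)"
    then have "X m \<in> cube L" using m last assms(2) by simp
    then have "last_visit (cube L) X = enat m" using a shift by (intro last_visit_eq) blast+
    moreover have "map X [0..<Suc m] = ws" unfolding map_upt_eq_iff using a m by simp
    ultimately show "last_excursion L ws X" unfolding last_excursion_def by blast
  qed
qed

lemma pred_last_excursion:
  assumes "ws \<noteq> []" "last ws \<in> cube L"
  shows "Measurable.pred trajectories (last_excursion L ws)"
proof -
  have "Measurable.pred trajectories (\<lambda>X. (\<forall>j<length ws. X j = ws ! j) \<and> (\<forall>k. X (length ws + k) \<notin> cube L))"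
    by measurable
  then show ?thesis using last_excursion_iff[OF assms] by presburger
qed

lemma tprob_last_excursion:
  fixes ws :: "(int ^ 'd) list"
  assumes "ws \<noteq> []" "successively (\<lambda>a b. b - a \<in> unit_steps) ws" "last ws \<in> cube L"
  shows "tprob 0 (hd ws) (last_excursion L ws)
    = step_mean (escape L) (last ws) / valency TYPE('d) ^ (length ws - 1)"
proof -
  obtain m where m: "length ws = Suc m" using assms(1) by (cases ws) auto
  have last: "last ws = ws ! m" using assms(1) m by (simp add: last_conv_nth)
  let ?E = "\<lambda>\<xi>. \<forall>j<length ws. pos (hd ws) \<xi> j = ws ! j"
  let ?G = "\<lambda>X. \<forall>k. X (Suc k) \<notin> cube L"
  have mE: "Measurable.pred step_seq ?E"
  proof -
    have "Measurable.pred trajectories (\<lambda>X. \<forall>j<length ws. X j = ws ! j)" by measurable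
    from pred_pos[OF this] show ?thesis .
  qed
  have dep: "depends_on m ?E"
    unfolding depends_on_def
  proof (intro allI impI)
    fix \<xi> \<xi>' :: "nat \<Rightarrow> int ^ 'd" assume a: "\<forall>k<m. \<xi> k = \<xi>' k"
    then have "pos (hd ws) \<xi> j = pos (hd ws) \<xi>' j" if "j < length ws" for j
      using that m by (intro pos_cong) auto
    then show "?E \<xi> = ?E \<xi>'" by simp
  qed
  have mG: "Measurable.pred trajectories ?G" by measurable
  have "tprob 0 (hd ws) (last_excursion L ws)
      = sprob (\<lambda>\<xi>. ?E \<xi> \<and> ?G (\<lambda>k. wrap 0 (pos (hd ws) \<xi> (m + k))))"
    unfolding tprob_def last_excursion_iff[OF assms(1,3)] wrap_zero by (simp add: m del: pos_Suc)
  also have "\<dots> = sprob ?E * tprob 0 (last ws) ?G"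
    by (rule markov_property[OF mE dep mG]) (simp add: last m)
  finally show ?thesis by (simp add: sprob_path[OF assms(1,2)] tprob_escape_after)
qed

lemma capacity_eq: "capacity TYPE('d::finite) L = (\<Sum>a\<in>cube L. step_mean (escape L) (a :: int ^ 'd))"
  unfolding capacity_def by (intro sum.cong refl escape_prob_eq)

lemma capacity_pos:
  assumes "3 \<le> CARD('d::finite)" "1 \<le> L"
  shows "0 < capacity TYPE('d) L"
proof -
  fix i :: 'd
  define a where "a = (axis i (int L) :: int ^ 'd)"
  have a: "a \<in> cube L" "\<bar>a $ i\<bar> = int L" by (auto simp: a_def mem_cube axis_def)
  have "0 < escape_const TYPE('d) / real L" using assms(2) escape_const_pos[where 'd='d] by simp
  also have "\<dots> \<le> step_mean (escape L) a" by (rule mean_escape_lower[OF assms a(2)])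
  also have "\<dots> \<le> capacity TYPE('d) L"
    unfolding capacity_eq using a(1) by (intro member_le_sum mean_escape_bounds) auto
  finally show ?thesis .
qed

lemma equilibrium_nonneg:
  assumes "3 \<le> CARD('d)" "1 \<le> L" shows "0 \<le> equilibrium L (z :: int ^ 'd)"
  using capacity_pos[OF assms] by (simp add: equilibrium_def escape_prob_def)

lemma nn_integral_equilibrium:
  assumes "3 \<le> CARD('d)" "1 \<le> L"
  shows "(\<integral>\<^sup>+z. ennreal (equilibrium L (z :: int ^ 'd)) \<partial>count_space UNIV) = 1"
proof -
  have "(\<integral>\<^sup>+z. ennreal (equilibrium L (z :: int ^ 'd)) \<partial>count_space UNIV)
      = (\<Sum>z\<in>cube L. ennreal (equilibrium L (z :: int ^ 'd)))"
    by (intro nn_integral_count_space') (auto simp: equilibrium_def escape_prob_def)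
  also have "\<dots> = ennreal (\<Sum>z\<in>cube L. equilibrium L (z :: int ^ 'd))"
    by (intro sum_ennreal equilibrium_nonneg assms)
  also have "(\<Sum>z\<in>cube L. equilibrium L (z :: int ^ 'd)) = 1"
    unfolding equilibrium_def sum_divide_distrib[symmetric]
    using capacity_pos[OF assms] by (simp add: capacity_def)
  finally show ?thesis by simp
qed

lemma measurable_srw:
  "srw \<in> measurable (point_measure UNIV f) (subprob_algebra (trajectories :: (nat \<Rightarrow> int ^ 'd) measure))"
  unfolding measurable_point_measure_eq1 space_subprob_algebra srw_eq
  by (auto intro: prob_space_imp_subprob_space prob_space_torus_srw)

lemma prob_space_srw_equilibrium:
  assumes "3 \<le> CARD('d)" "1 \<le> L"
  shows "prob_space (srw_equilibrium L :: (nat \<Rightarrow> int ^ 'd) measure)"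
proof -
  interpret prob_space "point_measure UNIV (\<lambda>z :: int ^ 'd. ennreal (equilibrium L z))"
  proof
    show "emeasure (point_measure UNIV (\<lambda>z :: int ^ 'd. ennreal (equilibrium L z)))
        (space (point_measure UNIV (\<lambda>z :: int ^ 'd. ennreal (equilibrium L z)))) = 1"
      unfolding space_point_measure point_measure_def
      by (subst emeasure_density) (simp_all add: nn_integral_equilibrium[OF assms])
  qed
  show ?thesis unfolding srw_equilibrium_def
    by (rule prob_space_bind[OF _ measurable_srw]) (simp add: srw_eq prob_space_torus_srw)
qed

lemma sets_srw_equilibrium [simp]:
  "sets (srw_equilibrium L :: (nat \<Rightarrow> int ^ 'd) measure) = sets trajectories"
  unfolding srw_equilibrium_def by (rule sets_bind) (auto simp: srw_eq space_point_measure)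

lemma space_srw_equilibrium [simp]:
  "space (srw_equilibrium L :: (nat \<Rightarrow> int ^ 'd) measure) = UNIV"
  using sets_eq_imp_space_eq[OF sets_srw_equilibrium] by simp

lemma Q_limit_eq: "Q_limit L ws = \<P>(X in srw_equilibrium L. last_excursion L ws X)"
  by (simp add: Q_limit_def last_excursion_def)

text \<open>The mixture over starting points is estimated from below by its single term at
  \<open>hd ws\<close>; this is the direction that the density bound uses.\<close>

lemma Q_limit_ge:
  fixes ws :: "(int ^ 'd) list"
  assumes d: "3 \<le> CARD('d)" and L: "1 \<le> L" and ws: "ws \<in> excursion_paths L"
  shows "step_mean (escape L) (hd ws) / capacity TYPE('d) L
    * (step_mean (escape L) (last ws) / valency TYPE('d) ^ (length ws - 1)) \<le> Q_limit L ws"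
proof -
  let ?M = "srw_equilibrium L :: (nat \<Rightarrow> int ^ 'd) measure"
  let ?A = "{X. last_excursion L ws X}"
  interpret prob_space ?M by (rule prob_space_srw_equilibrium[OF d L])
  have w: "ws \<noteq> []" "successively (\<lambda>a b. b - a \<in> unit_steps) ws" "hd ws \<in> cube L" "last ws \<in> cube L"
    using ws unfolding excursion_paths_iff[OF L] by auto
  have pA: "Measurable.pred trajectories (last_excursion L ws)" by (rule pred_last_excursion[OF w(1,4)])
  then have A: "?A \<in> sets trajectories" by (simp add: Measurable.pred_def)
  let ?p = "\<lambda>z. ennreal (equilibrium L z) * emeasure (srw z) ?A"
  have "emeasure (srw (hd ws)) ?A = ennreal (tprob 0 (hd ws) (last_excursion L ws))"
  proof -
    interpret S: prob_space "srw (hd ws)" unfolding srw_eq by (rule prob_space_torus_srw)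
    have "emeasure (srw (hd ws)) ?A = ennreal (measure (srw (hd ws)) ?A)" by (rule S.emeasure_eq_measure)
    then show ?thesis using measure_torus_srw[OF pA, of 0 "hd ws"] by (simp add: srw_eq)
  qed
  then have "ennreal (equilibrium L (hd ws) * tprob 0 (hd ws) (last_excursion L ws)) = ?p (hd ws)"
    using equilibrium_nonneg[OF d L] by (simp add: ennreal_mult)
  also have "\<dots> \<le> (\<integral>\<^sup>+z. ?p z \<partial>count_space UNIV)" by (rule nn_integral_ge_point) simp
  also have "\<dots> = (\<integral>\<^sup>+z. emeasure (srw z) ?A \<partial>point_measure UNIV (\<lambda>z. ennreal (equilibrium L z)))"
    unfolding point_measure_def by (subst nn_integral_density) auto
  also have "\<dots> = emeasure ?M ?A"
    unfolding srw_equilibrium_def by (rule emeasure_bind[OF _ measurable_srw A, symmetric]) (simp add: space_point_measure)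
  also have "\<dots> = ennreal (measure ?M ?A)" by (rule emeasure_eq_measure)
  finally have "equilibrium L (hd ws) * tprob 0 (hd ws) (last_excursion L ws) \<le> measure ?M ?A"
    by simp
  moreover have "Q_limit L ws = measure ?M ?A" by (simp add: Q_limit_eq)
  ultimately show ?thesis
    by (simp add: equilibrium_def escape_prob_eq[OF w(3)] tprob_last_excursion[OF w(1,2,4)])
qed

lemma Q_limit_has_sum:
  assumes d: "3 \<le> CARD('d)" and L: "1 \<le> L"
  obtains G where "(Q_limit L has_sum G) (excursion_paths L :: (int ^ 'd) list set)" "G \<le> 1"
proof -
  let ?M = "srw_equilibrium L :: (nat \<Rightarrow> int ^ 'd) measure"
  interpret prob_space ?M by (rule prob_space_srw_equilibrium[OF d L])
  have "((\<lambda>ws. measure ?M {X\<in>space ?M. last_excursion L ws X})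
      has_sum measure ?M {X\<in>space ?M. \<exists>ws\<in>excursion_paths L. last_excursion L ws X}) (excursion_paths L)"
  proof (rule has_sum_measure_countable)
    show "{X\<in>space ?M. last_excursion L ws X} \<in> sets ?M" if "ws \<in> excursion_paths L" for ws
      using that pred_last_excursion[of ws L] unfolding excursion_paths_iff[OF L]
      by (simp add: Measurable.pred_def)
    show "ws = ws'" if "last_excursion L ws X" "last_excursion L ws' X" for ws ws' X
      using that by (auto simp: last_excursion_def)
  qed (rule finite_measure_axioms)
  then have "(Q_limit L has_sum measure ?M {X\<in>space ?M. \<exists>ws\<in>excursion_paths L. last_excursion L ws X})
      (excursion_paths L :: (int ^ 'd) list set)"
    unfolding Q_limit_eq[abs_def] .
  then show ?thesis using that prob_le_1 by blast
qed

lemma sprob_mono_AE: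
  assumes "\<And>\<xi>. (\<And>n. \<xi> n \<in> unit_steps) \<Longrightarrow> E \<xi> \<Longrightarrow> F \<xi>"
    and E: "Measurable.pred step_seq E" and F: "Measurable.pred step_seq F"
  shows "sprob E \<le> sprob (F :: (nat \<Rightarrow> int ^ 'd) \<Rightarrow> bool)"
proof -
  have EF: "Measurable.pred step_seq (\<lambda>\<xi>. E \<xi> \<or> F \<xi>)" by (rule pred_intros_logic(5)[OF E F])
  have "sprob E \<le> sprob (\<lambda>\<xi>. E \<xi> \<or> F \<xi>)" by (rule sprob_mono[OF _ EF]) blast
  also have "\<dots> = sprob F" by (rule sprob_eq_AE[OF _ EF F]) (use assms(1) in blast)
  finally show ?thesis .
qed

section \<open>The conditioned law as a law of lattice excursions\<close>

context two_boxes
begin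

definition smallA :: "(int ^ 'd) set" where
  "smallA = torus_ball N x L \<union> torus_ball N xo L"

definition largeB :: "(int ^ 'd) set" where
  "largeB = torus_ball N x r \<union> torus_ball N xo r"

lemma N1: "1 \<le> N"
  using Nr by simp

lemma wrap_in_smallA [simp]: "wrap N p \<in> smallA \<longleftrightarrow> inA p"
  by (simp add: smallA_def inA_def wrap_mem_torus_ball[OF N1])

lemma wrap_in_largeB [simp]: "wrap N p \<in> largeB \<longleftrightarrow> inB p"
  by (simp add: largeB_def inB_def wrap_mem_torus_ball[OF N1])

lemma w_not_in_largeB: "w \<notin> largeB"
  using wrap_in_largeB[of w] w_not_inB unfolding w_wrap by blast

lemma smallA_subset: "smallA \<subseteq> largeB"
  unfolding smallA_def largeB_def using near_mono[OF L_le_r, of N x] near_mono[OF L_le_r, of N xo] by (auto simp: mem_torus_ball)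

definition centred :: "(nat \<Rightarrow> int ^ 'd) \<Rightarrow> nat \<Rightarrow> int ^ 'd" where
  "centred X k = lift N r (wrap N (X k - x))"

text \<open>The extended times made explicit: \<open>s\<close> is the entry time and
  \<open>m\<close> the departure time. Only countable conditions on single positions remain, so
  measurability is automatic.\<close>

definition enters_and_departs :: "nat \<Rightarrow> nat \<Rightarrow> (nat \<Rightarrow> int ^ 'd) \<Rightarrow> bool" where
  "enters_and_departs s m X \<longleftrightarrow> X s \<in> smallA \<and> (\<forall>k<s. X k \<notin> smallA) \<and> s \<le> m \<and> X m \<notin> largeB
     \<and> (\<forall>k. s \<le> k \<and> k < m \<longrightarrow> X k \<in> largeB) \<and> X m = w"

definition last_at :: "nat \<Rightarrow> nat \<Rightarrow> nat \<Rightarrow> (nat \<Rightarrow> int ^ 'd) \<Rightarrow> bool" where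
  "last_at s m t X \<longleftrightarrow> s \<le> t \<and> t < m \<and> X t \<in> smallA \<and> (\<forall>k. t < k \<and> k < m \<longrightarrow> X k \<notin> smallA)"

definition departs_at_w :: "(nat \<Rightarrow> int ^ 'd) \<Rightarrow> bool" where
  "departs_at_w X \<longleftrightarrow> (\<exists>m. departure_time smallA largeB X = enat m \<and> X m = w)"

definition excursion_is :: "(int ^ 'd) list \<Rightarrow> (nat \<Rightarrow> int ^ 'd) \<Rightarrow> bool" where
  "excursion_is ws X \<longleftrightarrow> (\<exists>s t. entry_time smallA X = enat s \<and>
     last_visit_before_departure smallA largeB X = enat t \<and> map (centred X) [s..<Suc t] = ws)"

lemma departs_at_w_iff: "departs_at_w X \<longleftrightarrow> (\<exists>s m. enters_and_departs s m X)"
proof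
  assume "departs_at_w X"
  then obtain m where m: "departure_time smallA largeB X = enat m" "X m = w" by (auto simp: departs_at_w_def)
  obtain s where s: "entry_time smallA X = enat s" using departure_time_finite[OF m(1)] by blast
  have "enters_and_departs s m X"
    using s m departure_time_eq_iff[OF s, of largeB m] unfolding enters_and_departs_def entry_time_eq_iff by blast
  then show "\<exists>s m. enters_and_departs s m X" by blast
next
  assume "\<exists>s m. enters_and_departs s m X"
  then obtain s m where sm: "enters_and_departs s m X" by blast
  then have s: "entry_time smallA X = enat s" unfolding enters_and_departs_def entry_time_eq_iff by blast
  then show "departs_at_w X"
    using sm departure_time_eq_iff[OF s, of largeB m] unfolding departs_at_w_def enters_and_departs_def by blast
qed

lemma excursion_is_iff:
  "excursion_is ws X \<and> departs_at_w X
    \<longleftrightarrow> (\<exists>s m t. enters_and_departs s m X \<and> last_at s m t X \<and> map (centred X) [s..<Suc t] = ws)"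
proof
  assume a: "excursion_is ws X \<and> departs_at_w X"
  then obtain m where m: "departure_time smallA largeB X = enat m" "X m = w" by (auto simp: departs_at_w_def)
  from a obtain s t where s: "entry_time smallA X = enat s"
    and t: "last_visit_before_departure smallA largeB X = enat t" "map (centred X) [s..<Suc t] = ws"
    unfolding excursion_is_def by blast
  have "enters_and_departs s m X"
    using s m departure_time_eq_iff[OF s, of largeB m] unfolding enters_and_departs_def entry_time_eq_iff by blast
  moreover have "last_at s m t X"
    using t(1) last_visit_before_departure_eq_iff[OF s m(1) smallA_subset] unfolding last_at_def by blast
  ultimately show "\<exists>s m t. enters_and_departs s m X \<and> last_at s m t X \<and> map (centred X) [s..<Suc t] = ws"
    using t(2) by blast
next
  assume "\<exists>s m t. enters_and_departs s m X \<and> last_at s m t X \<and> map (centred X) [s..<Suc t] = ws"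
  then obtain s m t where sm: "enters_and_departs s m X" and t: "last_at s m t X" "map (centred X) [s..<Suc t] = ws"
    by blast
  have s: "entry_time smallA X = enat s" using sm unfolding enters_and_departs_def entry_time_eq_iff by blast
  have m: "departure_time smallA largeB X = enat m"
    using sm departure_time_eq_iff[OF s, of largeB m] unfolding enters_and_departs_def by blast
  have "last_visit_before_departure smallA largeB X = enat t"
    using t(1) last_visit_before_departure_eq_iff[OF s m smallA_subset] unfolding last_at_def by blast
  then have "excursion_is ws X" unfolding excursion_is_def using s t(2) by blast
  moreover have "departs_at_w X" using sm departs_at_w_iff by blast
  ultimately show "excursion_is ws X \<and> departs_at_w X" by blast
qed

lemma pred_departs_at_w: "Measurable.pred trajectories departs_at_w"
proof -
  have "Measurable.pred trajectories (\<lambda>X. \<exists>s m. enters_and_departs s m X)"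
    unfolding enters_and_departs_def by measurable
  then show ?thesis unfolding departs_at_w_iff[abs_def] .
qed

lemma pred_excursion_is: "Measurable.pred trajectories (\<lambda>X. excursion_is ws X \<and> departs_at_w X)"
  unfolding excursion_is_iff enters_and_departs_def last_at_def map_upt_eq_iff centred_def by measurable

context
  fixes \<xi> :: "nat \<Rightarrow> int ^ 'd" and s m :: nat
  assumes unit: "\<And>n. \<xi> n \<in> unit_steps"
    and sm: "enters_and_departs s m (\<lambda>n. wrap N (pos u \<xi> n))"
begin

abbreviation (input) "X \<equiv> \<lambda>n. wrap N (pos u \<xi> n)"

lemma walk_s: "inA (pos u \<xi> s)" "\<And>k. k < s \<Longrightarrow> \<not> inA (pos u \<xi> k)"
  using sm unfolding enters_and_departs_def by auto

lemma walk_m: "s \<le> m" "\<not> inB (pos u \<xi> m)" "wrap N (pos u \<xi> m) = w"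
  using sm unfolding enters_and_departs_def by auto

lemma walk_inB: "s \<le> k \<Longrightarrow> k < m \<Longrightarrow> inB (pos u \<xi> k)"
  using sm unfolding enters_and_departs_def by auto

lemma s_less_m: "s < m"
  using walk_s(1) walk_m(1,2) inA_imp_inB le_neq_implies_less by blast

lemma s_pos: "0 < s"
proof (rule ccontr)
  assume "\<not> 0 < s"
  then have "inA u" using walk_s(1) by simp
  then show False using inA_imp_inB u_not_inB by blast
qed

text \<open>The walk is traced backwards from \<open>w\<close>. A step back stays within two layers
  of the box at \<open>x\<close>, hence off the other large box; being in one of the large boxes, it
  is in the one at \<open>x\<close>. So an excursion ending at \<open>w\<close> never visits the
  other box.\<close>

lemma walk_near_Suc: "j \<le> m - s \<Longrightarrow> near N x (Suc r) (pos u \<xi> (m - j))"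
proof (induction j)
  case 0
  then show ?case using near_w near_cong[of N w "pos u \<xi> m" x "Suc r"] walk_m(3) w_wrap by simp
next
  case (Suc j)
  let ?k = "m - Suc j"
  have k: "Suc ?k = m - j" "s \<le> ?k" "?k < m" using Suc.prems by auto
  have "near N x (Suc r) (pos u \<xi> (Suc ?k))" using Suc unfolding k(1) by simp
  from near_trans[OF this near_step[of "- \<xi> ?k"]]
  have "near N x (Suc r + 1) (pos u \<xi> (Suc ?k) + - \<xi> ?k)" using unit by simp
  then have "near N x (Suc (Suc r)) (pos u \<xi> ?k)" by simp
  then have "near N x r (pos u \<xi> ?k)"
    using not_near_other walk_inB[OF k(2,3)] unfolding inB_def by blast
  then show ?case by (rule near_mono[rotated]) simp
qed

lemma walk_near: "s \<le> k \<Longrightarrow> k < m \<Longrightarrow> near N x r (pos u \<xi> k)"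
proof -
  assume k: "s \<le> k" "k < m"
  have "near N x (Suc r) (pos u \<xi> (m - (m - k)))" using k by (intro walk_near_Suc) simp
  then have "near N x (Suc r) (pos u \<xi> k)" using k by simp
  then have "near N x (Suc (Suc r)) (pos u \<xi> k)" by (rule near_mono[rotated]) simp
  then show ?thesis using not_near_other walk_inB[OF k] unfolding inB_def by blast
qed

lemma centred_props:
  assumes "s \<le> k" "k < m"
  shows "centred X k \<in> cube r" "wrap N (x + centred X k) = wrap N (pos u \<xi> k)"
proof -
  obtain z where z: "z \<in> cube r" "wrap N (x + z) = wrap N (pos u \<xi> k)"
    using walk_near[OF assms] by (auto simp: near_def)
  have "wrap N (wrap N (pos u \<xi> k) - x) = wrap N (x + z - x)"
    using z(2) by (intro wrap_diff_cong) auto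
  then have "centred X k = z" unfolding centred_def using lift_wrap[OF z(1)] Nr by simp
  then show "centred X k \<in> cube r" "wrap N (x + centred X k) = wrap N (pos u \<xi> k)" using z by auto
qed

text \<open>Both sides agree modulo \<open>N\<close> and lie in cubes of radii \<open>r\<close> and
  \<open>r + 1\<close>, too small for wrap-around. Torus steps thus lift to the same lattice
  steps.\<close>

lemma centred_Suc:
  assumes "s \<le> k" "Suc k < m"
  shows "centred X (Suc k) = centred X k + \<xi> k"
proof -
  have k: "k < m" "s \<le> Suc k" using assms by auto
  have "wrap N (x + centred X (Suc k)) = wrap N (pos u \<xi> k + \<xi> k)"
    using centred_props(2)[OF k(2) assms(2)] by simp
  also have "\<dots> = wrap N (x + centred X k + \<xi> k)"
    using centred_props(2)[OF assms(1) k(1)] by (intro wrap_add_cong) auto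
  finally have "wrap N (centred X (Suc k)) = wrap N (centred X k + \<xi> k)"
    by (simp only: add.assoc wrap_add_left_iff)
  moreover have "centred X k + \<xi> k \<in> cube (Suc r)"
    using centred_props(1)[OF assms(1) k(1)] unit by (rule cube_step)
  ultimately show ?thesis
    using wrap_inj_cube[OF centred_props(1)[OF k(2) assms(2)], of "centred X k + \<xi> k" "Suc r" N] Nr by simp
qed

lemma centred_in_cube:
  assumes "s \<le> k" "k < m" "inA (pos u \<xi> k)" shows "centred X k \<in> cube L"
proof -
  have "inA (x + centred X k)" using inA_cong[OF centred_props(2)[OF assms(1,2)]] assms(3) by blast
  moreover have "centred X k \<in> cube (Suc r)" by (rule cube_mono[OF _ centred_props(1)[OF assms(1,2)]]) simp
  ultimately show ?thesis using inA_add_iff by blast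
qed

lemma neighbour_outside:
  assumes "s \<le> k" "k < m" "e \<in> unit_steps" "\<not> inA (pos u \<xi> k + e)"
  shows "centred X k + e \<notin> cube L"
proof
  assume "centred X k + e \<in> cube L"
  then have "inA (x + (centred X k + e))" by (rule inA_cube)
  moreover have "wrap N (x + (centred X k + e)) = wrap N (pos u \<xi> k + e)"
    unfolding add.assoc[symmetric] using centred_props(2)[OF assms(1,2)] by (intro wrap_add_cong) auto
  ultimately show False using assms(4) inA_cong by blast
qed

lemma excursion_path:
  assumes t: "last_at s m t X"
  defines "ws \<equiv> map (centred X) [s..<Suc t]"
  shows "ws \<in> excursion_paths L" "excursion_event ws \<xi>"
proof -
  have st: "s \<le> t" "t < m" "inA (pos u \<xi> t)" and later: "\<And>k. t < k \<Longrightarrow> k < m \<Longrightarrow> \<not> inA (pos u \<xi> k)"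
    using t unfolding last_at_def by auto
  have len: "length ws = Suc t - s" and nth: "\<And>j. j < length ws \<Longrightarrow> ws ! j = centred X (s + j)"
    using st(1) unfolding ws_def by (auto simp del: upt_Suc)
  have ne: "ws \<noteq> []" using len st(1) by auto
  have hd: "hd ws = centred X s" using nth[of 0] ne by (simp add: hd_conv_nth)
  have last: "last ws = centred X t" using nth[of "length ws - 1"] ne len st(1) by (simp add: last_conv_nth)
  have "successively (\<lambda>a b. b - a \<in> unit_steps) ws"
    unfolding successively_conv_nth
  proof (intro allI impI)
    fix i assume i: "Suc i < length ws"
    then have "ws ! Suc i - ws ! i = \<xi> (s + i)"
      using centred_Suc[of "s + i"] nth[of i] nth[of "Suc i"] len st by simp
    then show "ws ! Suc i - ws ! i \<in> unit_steps" using unit by simp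
  qed
  moreover have "hd ws \<in> cube L" unfolding hd using s_less_m walk_s(1) by (intro centred_in_cube) auto
  \<comment> \<open>As \<open>u\<close> is outside the boxes, there is a time before the entrance,
    and the position then is a neighbour off the small box. This forces the first vertex onto the
    face.\<close>
  moreover have "\<exists>i. \<bar>hd ws $ i\<bar> = int L"
  proof -
    obtain s' where s': "s = Suc s'" using s_pos by (cases s) auto
    have e: "- \<xi> s' \<in> unit_steps" using unit by simp
    then have "hd ws + - \<xi> s' \<notin> cube L"
      unfolding hd using s_less_m walk_s(2)[of s'] s' by (intro neighbour_outside) auto
    with \<open>hd ws \<in> cube L\<close> e show ?thesis by (rule face_of_cube_step)
  qed
  moreover have "last ws \<in> cube L" unfolding last using st by (intro centred_in_cube) auto
  moreover have "\<exists>i. \<bar>last ws $ i\<bar> = int L"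
  proof (rule face_of_cube_step[OF \<open>last ws \<in> cube L\<close> unit])
    have "\<not> inA (pos u \<xi> (Suc t))"
    proof (cases "Suc t = m")
      case True
      then show ?thesis using walk_m(2) inA_imp_inB by blast
    next
      case False
      then show ?thesis using later[of "Suc t"] st(2) by simp
    qed
    then show "last ws + \<xi> t \<notin> cube L"
      unfolding last using st unit by (intro neighbour_outside) auto
  qed
  ultimately show "ws \<in> excursion_paths L" unfolding excursion_paths_iff[OF L1] using ne by blast
  define n where "n = s - 1"
  have n: "Suc n = s" using s_pos by (simp add: n_def)
  have "follows n ws \<xi>"
    unfolding follows_def
  proof (intro conjI allI impI)
    show "fresh n \<xi>" unfolding fresh_def using walk_s(2) n by auto
    fix j assume j: "j < length ws"
    show "wrap N (pos u \<xi> (Suc n + j)) = wrap N (x + ws ! j)"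
      unfolding n nth[OF j] using j len st by (intro centred_props(2)[symmetric]) auto
  qed
  moreover have "exits_avoiding (\<lambda>k. wrap N (pos u \<xi> (n + length ws + Suc k)))"
    unfolding exits_avoiding_def
  proof (intro exI[of _ "m - Suc t"] conjI allI impI)
    have idx: "n + length ws + Suc j = Suc t + j" for j using n len st(1) by simp
    show "wrap N (pos u \<xi> (n + length ws + Suc (m - Suc t))) = w"
      unfolding idx using walk_m(3) st(2) by simp
    fix j assume j: "j < m - Suc t"
    show "inB (wrap N (pos u \<xi> (n + length ws + Suc j)))"
      unfolding idx inB_wrap using j st by (intro walk_inB) auto
    show "\<not> inA (wrap N (pos u \<xi> (n + length ws + Suc j)))"
      unfolding idx inA_wrap using j by (intro later) auto
  qed
  ultimately show "excursion_event ws \<xi>" unfolding excursion_event_def by blast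
qed

lemma ex_last_at: "\<exists>t. last_at s m t X"
proof -
  let ?T = "{k. s \<le> k \<and> k < m \<and> inA (pos u \<xi> k)}"
  have fin: "finite ?T" by (rule finite_subset[of _ "{..<m}"]) auto
  have "s \<in> ?T" using s_less_m walk_s(1) by simp
  then have max: "Max ?T \<in> ?T" using Max_in[OF fin] by blast
  define t where "t = Max ?T"
  have t: "s \<le> t" "t < m" "inA (pos u \<xi> t)" using max unfolding t_def by blast+
  have "\<not> inA (pos u \<xi> k)" if "t < k" "k < m" for k
  proof
    assume "inA (pos u \<xi> k)"
    then have "k \<in> ?T" using that t by simp
    then have "k \<le> t" unfolding t_def by (rule Max_ge[OF fin])
    then show False using that(1) by simp
  qed
  then have "last_at s m t X" using t unfolding last_at_def by simp
  then show ?thesis by blast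
qed

end

lemma tprob_departs_at_w: "tprob N u departs_at_w = tprob N u departs"
proof -
  have "departs_at_w (\<lambda>n. wrap N (pos u \<xi> n)) \<longleftrightarrow> departs (\<lambda>n. wrap N (pos u \<xi> n))" for \<xi>
  proof
    assume "departs_at_w (\<lambda>n. wrap N (pos u \<xi> n))"
    then obtain s m where "enters_and_departs s m (\<lambda>n. wrap N (pos u \<xi> n))"
      unfolding departs_at_w_iff by blast
    then show "departs (\<lambda>n. wrap N (pos u \<xi> n))"
      unfolding enters_and_departs_def departs_def exits_at_w_def
      by (intro exI[of _ s] conjI exI[of _ "m - s"]) auto
  next
    assume "departs (\<lambda>n. wrap N (pos u \<xi> n))"
    then obtain s m where s: "\<forall>k<s. \<not> inA (pos u \<xi> k)" "inA (pos u \<xi> s)"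
      and m: "\<forall>j<m. inB (pos u \<xi> (s + j))" "wrap N (pos u \<xi> (s + m)) = w"
      unfolding departs_def exits_at_w_def by auto
    have "inB (pos u \<xi> k)" if "s \<le> k" "k < s + m" for k
    proof -
      have "k - s < m" using that by simp
      then have "inB (pos u \<xi> (s + (k - s)))" using m(1) by blast
      then show ?thesis using that by simp
    qed
    then have "enters_and_departs s (s + m) (\<lambda>n. wrap N (pos u \<xi> n))"
      unfolding enters_and_departs_def m(2) using s w_not_in_largeB by simp
    then show "departs_at_w (\<lambda>n. wrap N (pos u \<xi> n))" unfolding departs_at_w_iff by blast
  qed
  then show ?thesis unfolding tprob_def by simp
qed

definition cond_law :: "(int ^ 'd) list \<Rightarrow> real" where
  "cond_law ws = \<P>(X in torus_srw N u. excursion_is ws X \<bar> departs_at_w X)"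

lemma cond_law_eq:
  "cond_law ws = tprob N u (\<lambda>X. excursion_is ws X \<and> departs_at_w X) / tprob N u departs"
  unfolding cond_law_def cond_prob_def measure_torus_srw[OF pred_excursion_is]
    measure_torus_srw[OF pred_departs_at_w] tprob_departs_at_w ..

lemma cond_law_nonneg: "0 \<le> cond_law ws"
  unfolding cond_law_eq by simp

lemma excursion_le:
  "tprob N u (\<lambda>X. excursion_is ws X \<and> departs_at_w X) \<le> sprob (excursion_event ws)"
  unfolding tprob_def
proof (rule sprob_mono_AE)
  fix \<xi> :: "nat \<Rightarrow> int ^ 'd"
  assume unit: "\<And>n. \<xi> n \<in> unit_steps"
    and "excursion_is ws (\<lambda>n. wrap N (pos u \<xi> n)) \<and> departs_at_w (\<lambda>n. wrap N (pos u \<xi> n))"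
  then obtain s m t where "enters_and_departs s m (\<lambda>n. wrap N (pos u \<xi> n))"
    "last_at s m t (\<lambda>n. wrap N (pos u \<xi> n))" "map (centred (\<lambda>n. wrap N (pos u \<xi> n))) [s..<Suc t] = ws"
    unfolding excursion_is_iff by blast
  then show "excursion_event ws \<xi>" using excursion_path(2)[of \<xi>, OF unit] by blast
next
  show "Measurable.pred step_seq (\<lambda>\<xi>. excursion_is ws (\<lambda>n. wrap N (pos u \<xi> n)) \<and> departs_at_w (\<lambda>n. wrap N (pos u \<xi> n)))"
    by (rule measurable_compose[OF measurable_walk pred_excursion_is])
qed (rule pred_excursion_event)

text \<open>When all steps are unit steps, departure at \<open>w\<close> produces an excursion in
  \<open>excursion_paths\<close>. This gives the conditioned law its mass one, on which the
  one-sided density argument rests.\<close>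

lemma excursion_total:
  "tprob N u (\<lambda>X. \<exists>ws\<in>excursion_paths L. excursion_is ws X \<and> departs_at_w X) = tprob N u departs"
proof -
  let ?E = "\<lambda>X. \<exists>ws\<in>excursion_paths L. excursion_is ws X \<and> departs_at_w X"
  have iff: "?E (\<lambda>n. wrap N (pos u \<xi> n)) = departs_at_w (\<lambda>n. wrap N (pos u \<xi> n))"
    if unit: "\<And>n. \<xi> n \<in> unit_steps" for \<xi>
  proof
    let ?X = "\<lambda>n. wrap N (pos u \<xi> n)"
    assume "departs_at_w ?X"
    then obtain s m where sm: "enters_and_departs s m ?X" unfolding departs_at_w_iff by blast
    obtain t where t: "last_at s m t ?X" using ex_last_at[of \<xi>, OF unit sm] by blast
    have "excursion_is (map (centred ?X) [s..<Suc t]) ?X \<and> departs_at_w ?X"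
      unfolding excursion_is_iff using sm t by blast
    then show "?E ?X" using excursion_path(1)[of \<xi>, OF unit sm t] by blast
  qed blast
  have pE: "Measurable.pred trajectories ?E"
    by (rule pred_intros_countable_bounded(4)[OF pred_excursion_is])
  have "sprob (\<lambda>\<xi>. ?E (\<lambda>n. wrap N (pos u \<xi> n))) = sprob (\<lambda>\<xi>. departs_at_w (\<lambda>n. wrap N (pos u \<xi> n)))"
    by (rule sprob_eq_AE[OF iff measurable_compose[OF measurable_walk pE]
        measurable_compose[OF measurable_walk pred_departs_at_w]])
  then have "tprob N u ?E = tprob N u departs_at_w" unfolding tprob_def .
  then show ?thesis by (simp only: tprob_departs_at_w)
qed

text \<open>The value zero stands for division by zero in a null conditioning event. Positivity of
  that event is derived only for small \<open>rate\<close>; for large \<open>rate\<close> the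
  trivial bound accepts either mass.\<close>

lemma cond_law_has_sum:
  "(cond_law has_sum (if tprob N u departs = 0 then 0 else 1)) (excursion_paths L)"
proof -
  let ?M = "torus_srw N u"
  let ?E = "\<lambda>ws X. excursion_is ws X \<and> departs_at_w X"
  have pE: "Measurable.pred trajectories (\<lambda>X. \<exists>ws\<in>excursion_paths L. ?E ws X)"
    by (rule pred_intros_countable_bounded(4)[OF pred_excursion_is])
  have "((\<lambda>ws. measure ?M {X\<in>space ?M. ?E ws X})
      has_sum measure ?M {X\<in>space ?M. \<exists>ws\<in>excursion_paths L. ?E ws X}) (excursion_paths L)"
  proof (rule has_sum_measure_countable)
    show "finite_measure ?M" by (rule prob_space.finite_measure[OF prob_space_torus_srw])
    show "{X\<in>space ?M. ?E ws X} \<in> sets ?M" for ws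
      using pred_excursion_is[of ws] by (simp add: Measurable.pred_def)
    show "ws = ws'" if "?E ws X" "?E ws' X" for ws ws' X
      using that unfolding excursion_is_def by auto
  qed
  then have "((\<lambda>ws. tprob N u (?E ws)) has_sum tprob N u departs) (excursion_paths L)"
    unfolding measure_torus_srw[OF pred_excursion_is] measure_torus_srw[OF pE] excursion_total .
  then have "((\<lambda>ws. (1 / tprob N u departs) * tprob N u (?E ws)) has_sum ((1 / tprob N u departs) * tprob N u departs)) (excursion_paths L)"
    by (rule has_sum_cmult_right)
  moreover have "(1 / tprob N u departs) * tprob N u departs = (if tprob N u departs = 0 then 0 else 1)" by simp
  ultimately show ?thesis unfolding cond_law_eq[abs_def] by simp
qed

text \<open>For \<open>rate\<close> above one half the right-hand side exceeds 16, more than two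
  laws of mass at most one can differ by. Otherwise \<open>rate\<close> is small enough for the
  Harnack comparison.\<close>

lemma tv_cond_law:
  "tv_norm (excursion_paths L) (\<lambda>ws. cond_law ws - Q_limit L ws) \<le> ennreal (32 * rate)"
proof -
  obtain G where G: "(Q_limit L has_sum G) (excursion_paths L :: (int ^ 'd) list set)" "G \<le> 1"
    using Q_limit_has_sum[OF dim L1] by blast
  have G0: "0 \<le> Q_limit L ws" for ws :: "(int ^ 'd) list" by (simp add: Q_limit_eq)
  show ?thesis
  proof (cases "rate \<le> 1 / 2")
    case True
    fix i :: 'd
    define a where "a = (axis i (int L) :: int ^ 'd)"
    have "a \<in> cube L" "\<bar>a $ i\<bar> = int L" by (auto simp: a_def mem_cube axis_def)
    then have a: "a \<in> face" by (auto simp: face_def)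
    \<comment> \<open>Positivity of the conditioning event comes with
      \<open>excursion_ratio\<close>, which speaks about a given path; a one-point path on the face
      serves.\<close>
    have pos: "0 < tprob N u departs" using excursion_ratio(1)[OF True, of "[a]"] a by simp
    have "exit_const TYPE('d) \<ge> 0"
      using cube_harnack_const_ge[where 'd='d] by (simp add: exit_const_def hit_const_def)
    then have r0: "0 \<le> 16 * rate"
      unfolding rate_def using escape_const_pos[where 'd='d] by simp
    have "tv_norm (excursion_paths L) (\<lambda>ws. cond_law ws - Q_limit L ws) \<le> ennreal (2 * (16 * rate))"
    proof (rule tv_norm_le_of_density[OF _ G G0 r0])
      show "(cond_law has_sum 1) (excursion_paths L)" using cond_law_has_sum pos by simp
      fix ws :: "(int ^ 'd) list" assume ws: "ws \<in> excursion_paths L"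
      then have w: "ws \<noteq> []" "hd ws \<in> face" "last ws \<in> face"
        unfolding excursion_paths_iff[OF L1] face_def by auto
      have "cond_law ws \<le> sprob (excursion_event ws) / tprob N u departs"
        unfolding cond_law_eq using excursion_le pos by (intro divide_right_mono) auto
      also have "\<dots> \<le> (1 + 16 * rate) * (step_mean (escape L) (hd ws) / capacity TYPE('d) L
          * (step_mean (escape L) (last ws) / valency TYPE('d) ^ (length ws - 1)))"
        by (rule excursion_ratio(2)[OF True w])
      also have "\<dots> \<le> (1 + 16 * rate) * Q_limit L ws"
        using Q_limit_ge[OF dim L1 ws] r0 by (intro mult_left_mono) auto
      finally show "cond_law ws \<le> (1 + 16 * rate) * Q_limit L ws" .
    qed
    then show ?thesis by simp
  next
    case False
    have "tv_norm (excursion_paths L) (\<lambda>ws. cond_law ws - Q_limit L ws) \<le> ennreal 2"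
      by (rule tv_norm_le_two[OF cond_law_has_sum _ cond_law_nonneg G G0]) simp
    also have "\<dots> \<le> ennreal (32 * rate)" using False by (intro ennreal_leI) simp
    finally show ?thesis .
  qed
qed

end

theorem theorem3p1:
  assumes "CARD('d::finite) \<ge> 3"
  shows "\<exists>c::real. c > 0 \<and>
    (\<forall>(N::nat) (L::nat) (r::nat) (x\<^sub>1::int ^ 'd) (x\<^sub>2::int ^ 'd) (u::int ^ 'd) (w::int ^ 'd).
       N \<ge> 1 \<longrightarrow> L \<ge> 1 \<longrightarrow> r \<ge> 10 * L \<longrightarrow> N \<ge> 4 * r + 6 \<longrightarrow>
       x\<^sub>1 \<in> torus N \<longrightarrow> x\<^sub>2 \<in> torus N \<longrightarrow> torus_distinf N x\<^sub>1 x\<^sub>2 \<ge> 2 * real r + 3 \<longrightarrow>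
       u \<in> torus N - (torus_ball N x\<^sub>1 r \<union> torus_ball N x\<^sub>2 r) \<longrightarrow>
       w \<in> torus_boundary N (torus_ball N x\<^sub>1 r) \<union> torus_boundary N (torus_ball N x\<^sub>2 r) \<longrightarrow>
       tv_norm (excursion_paths L) (\<lambda>ws. Q_cond N L r x\<^sub>1 x\<^sub>2 u w ws - Q_limit L ws)
         \<le> ennreal (c * (real L)\<^sup>2 / real r))"
proof (intro exI[of _ "32 * (exit_const TYPE('d) / escape_const TYPE('d))"] conjI allI impI)
  have "8 \<le> exit_const TYPE('d)"
    using cube_harnack_const_ge[where 'd='d] by (simp add: exit_const_def hit_const_def add_increasing2)
  then show "0 < 32 * (exit_const TYPE('d) / escape_const TYPE('d))"
    using escape_const_pos[where 'd='d] by simp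
  fix N L r :: nat and x\<^sub>1 x\<^sub>2 u w :: "int ^ 'd"
  assume L: "L \<ge> 1" and r: "r \<ge> 10 * L" and N: "N \<ge> 4 * r + 6"
    and sep: "torus_distinf N x\<^sub>1 x\<^sub>2 \<ge> 2 * real r + 3"
    and u: "u \<in> torus N - (torus_ball N x\<^sub>1 r \<union> torus_ball N x\<^sub>2 r)"
    and w: "w \<in> torus_boundary N (torus_ball N x\<^sub>1 r) \<union> torus_boundary N (torus_ball N x\<^sub>2 r)"
  have "\<not> near N x\<^sub>2 (2 * r + 2) x\<^sub>1"
    using sep by (intro not_near_of_torus_distinf) simp
  then have sep12: "\<not> near N x\<^sub>1 (2 * r + 2) x\<^sub>2" "\<not> near N x\<^sub>2 (2 * r + 2) x\<^sub>1"
    by (simp_all add: near_sym)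
  have u12: "\<not> near N x\<^sub>1 r u" "\<not> near N x\<^sub>2 r u" using u by (auto simp: mem_torus_ball)
  \<comment> \<open>The same choice of centre as in \<open>Q_cond\<close>. The locale distinguishes
    the two boxes only by which one is left at \<open>w\<close>, so both cases are covered by one
    interpretation.\<close>
  define x where "x = (if w \<in> torus_boundary N (torus_ball N x\<^sub>1 r) then x\<^sub>1 else x\<^sub>2)"
  define xo where "xo = (if w \<in> torus_boundary N (torus_ball N x\<^sub>1 r) then x\<^sub>2 else x\<^sub>1)"
  have "w \<in> torus_boundary N (torus_ball N x r)" using w by (auto simp: x_def)
  then obtain y e where ye: "near N x r y" "e \<in> unit_steps" "wrap N (y + e) = wrap N w"
    "w \<in> torus N" "\<not> near N x r w" by (rule torus_boundary_ball)
  interpret two_boxes N L r x xo u w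
  proof
    show "\<not> near N x (2 * r + 2) xo" using sep12 by (simp add: x_def xo_def)
    show "\<not> near N x r u" "\<not> near N xo r u" using u12 by (simp_all add: x_def xo_def)
    show "wrap N w = w" using ye(4) by (rule wrap_torus)
    show "\<exists>y e. near N x r y \<and> e \<in> unit_steps \<and> wrap N (y + e) = wrap N w" using ye by blast
  qed (use assms L r N ye(5) in auto)
  have "smallA = torus_ball N x\<^sub>1 L \<union> torus_ball N x\<^sub>2 L" "largeB = torus_ball N x\<^sub>1 r \<union> torus_ball N x\<^sub>2 r"
    unfolding smallA_def largeB_def by (auto simp: x_def xo_def)
  then have "Q_cond N L r x\<^sub>1 x\<^sub>2 u w = cond_law"
    unfolding Q_cond_def cond_law_def excursion_is_def departs_at_w_def centred_def Let_def x_def[symmetric]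
    by simp
  then show "tv_norm (excursion_paths L) (\<lambda>ws. Q_cond N L r x\<^sub>1 x\<^sub>2 u w ws - Q_limit L ws)
      \<le> ennreal (32 * (exit_const TYPE('d) / escape_const TYPE('d)) * (real L)\<^sup>2 / real r)"
    using tv_cond_law by (simp add: rate_def mult.assoc)
qed

end
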